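(* Let $N\ge 2$, let $\Omega\subseteq\mathbb{R}^N$ be a bounded domain of class $C^2$ which is convex and symmetric, and let $1<q<p<N$ with $p<q^*:=\frac{Nq}{N-q}$. Then for every nonnegative weight $w\in C^1(\overline{\Omega})\cap A_p$ one has $\phi_p^w\neq\phi_q$.
   Context: $\Omega$ is called symmetric if there exist $N-1$ two-dimensional planes $T_1,\dots,T_{N-1}$ in $\mathbb{R}^N$ and angles $\theta_1,\dots,\theta_{N-1}$ with $\theta_k\notin\{0,\pi\}$ (mod $2\pi$) such that, for each $k=1,\dots,N-1$, $\Omega$ is invariant under the rotation by angle $\theta_k$ in the plane $T_k$. A function $w$ belongs to the $p$-Muckenhoupt class $A_p$ (on $\Omega$) if $w,w^{-1}\in L^1_{\rm loc}(\Omega)$ and there is $C>0$ such that for every ball $B\subseteq\Omega$, $\frac{1}{|B|}\int_B w\,dx\le C\left(\frac{1}{|B|}\int_B w^{\frac{1}{1-p}}\,dx\right)^{1-p}$. For such $w$, $\phi_p^w$ denotes the first eigenfunction of the weighted $p$-Laplacian Dirichlet problem $-\mathrm{div}(w|\nabla v|^{p-2}\nabla v)=\lambda\, w|v|^{p-2}v$ in $\Omega$, $v=0$ on $\partial\Omega$: the positive eigenfunction, normalized by $\|\phi_p^w\|_{L^\infty(\Omega)}=1$, associated with the smallest eigenvalue $\lambda_p^w>0$. Similarly, $\phi_q$ denotes the positive first eigenfunction, normalized by $\|\phi_q\|_{L^\infty(\Omega)}=1$, of $-\Delta_q z=\mu|z|^{q-2}z$ in $\Omega$, $z=0$ on $\partial\Omega$,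 associated with its smallest eigenvalue $\lambda_q>0$. *)

theory Defs
  imports "HOL-Analysis.Analysis"
begin

text \<open>Rotation by angle th in the oriented plane spanned by the orthonormal pair u, v
  (identity on the orthogonal complement).\<close>
definition plane_rot :: "'a::euclidean_space \<Rightarrow> 'a \<Rightarrow> real \<Rightarrow> 'a \<Rightarrow> 'a" where
  "plane_rot u v th x =
     x + ((cos th - 1) * (x \<bullet> u) - sin th * (x \<bullet> v)) *\<^sub>R u
       + (sin th * (x \<bullet> u) + (cos th - 1) * (x \<bullet> v)) *\<^sub>R v"

definition symmetric_domain :: "'a::euclidean_space set \<Rightarrow> bool" where
  "symmetric_domain \<Omega> \<longleftrightarrow>
     (\<exists>u v :: nat \<Rightarrow> 'a. \<exists>th :: nat \<Rightarrow> real. \<forall>k\<in>{1..DIM('a) - 1}.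
        norm (u k) = 1 \<and> norm (v k) = 1 \<and> u k \<bullet> v k = 0 \<and>
        (\<forall>m::int. th k \<noteq> of_int m * pi) \<and>
        plane_rot (u k) (v k) (th k) ` \<Omega> = \<Omega>)"

definition C2_domain :: "'a::euclidean_space set \<Rightarrow> bool" where
  "C2_domain \<Omega> \<longleftrightarrow>
     (\<forall>x0\<in>frontier \<Omega>. \<exists>U \<rho> (G :: 'a \<Rightarrow> 'a) (H :: 'a \<Rightarrow> 'a \<Rightarrow>\<^sub>L 'a).
        open U \<and> x0 \<in> U \<and>
        (\<forall>x\<in>U. (\<rho> has_derivative (\<lambda>h. G x \<bullet> h)) (at x) \<and>
                 (G has_derivative blinfun_apply (H x)) (at x) \<and> G x \<noteq> 0) \<and>
        continuous_on U H \<and>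
        \<Omega> \<inter> U = {x\<in>U. \<rho> x < 0})"

definition C1_closure :: "'a::euclidean_space set \<Rightarrow> ('a \<Rightarrow> real) \<Rightarrow> bool" where
  "C1_closure \<Omega> w \<longleftrightarrow> continuous_on (closure \<Omega>) w \<and>
     (\<exists>G :: 'a \<Rightarrow> 'a. continuous_on (closure \<Omega>) G \<and>
        (\<forall>x\<in>\<Omega>. (w has_derivative (\<lambda>h. G x \<bullet> h)) (at x)))"

definition pdiff :: "'a::euclidean_space \<Rightarrow> ('a \<Rightarrow> real) \<Rightarrow> 'a \<Rightarrow> real" where
  "pdiff e f x = deriv (\<lambda>t. f (x + t *\<^sub>R e)) 0"

fun iter_pdiff :: "'a::euclidean_space list \<Rightarrow> ('a \<Rightarrow> real) \<Rightarrow> 'a \<Rightarrow> real" where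
  "iter_pdiff [] f = f"
| "iter_pdiff (e # es) f = pdiff e (iter_pdiff es f)"

definition smooth_fun :: "('a::euclidean_space \<Rightarrow> real) \<Rightarrow> bool" where
  "smooth_fun f \<longleftrightarrow> (\<forall>es. set es \<subseteq> Basis \<longrightarrow>
      continuous_on UNIV (iter_pdiff es f) \<and>
      (\<forall>e\<in>Basis. \<forall>x. (\<lambda>t. iter_pdiff es f (x + t *\<^sub>R e)) differentiable (at 0)))"

definition grad :: "('a::euclidean_space \<Rightarrow> real) \<Rightarrow> 'a \<Rightarrow> 'a" where
  "grad f x = (\<Sum>e\<in>Basis. pdiff e f x *\<^sub>R e)"

definition test_fun :: "'a::euclidean_space set \<Rightarrow> ('a \<Rightarrow> real) \<Rightarrow> bool" where
  "test_fun \<Omega> \<phi> \<longleftrightarrow> smooth_fun \<phi> \<and> compact (closure {x. \<phi> x \<noteq> 0}) \<and>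
      closure {x. \<phi> x \<noteq> 0} \<subseteq> \<Omega>"

definition Ap_weight :: "real \<Rightarrow> 'a::euclidean_space set \<Rightarrow> ('a \<Rightarrow> real) \<Rightarrow> bool" where
  "Ap_weight p \<Omega> w \<longleftrightarrow>
     (AE x in lebesgue. x \<in> \<Omega> \<longrightarrow> w x > 0) \<and>
     (\<forall>K. compact K \<and> K \<subseteq> \<Omega> \<longrightarrow>
        set_integrable lebesgue K w \<and> set_integrable lebesgue K (\<lambda>x. inverse (w x))) \<and>
     (\<exists>C>0. \<forall>x r. r > 0 \<and> ball x r \<subseteq> \<Omega> \<longrightarrow>
        set_integrable lebesgue (ball x r) w \<and>
        set_integrable lebesgue (ball x r) (\<lambda>y. w y powr (1 / (1 - p))) \<and>
        (1 / measure lebesgue (ball x r)) * (LINT y:ball x r|lebesgue. w y)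
          \<le> C * ((1 / measure lebesgue (ball x r)) *
                  (LINT y:ball x r|lebesgue. w y powr (1 / (1 - p)))) powr (1 - p))"

text \<open>(u, g) belongs to W_0^{1,p}(Omega, w) with weak gradient g: limit of test functions
  in the weighted W^{1,p} norm.\<close>
definition W0 :: "real \<Rightarrow> ('a::euclidean_space \<Rightarrow> real) \<Rightarrow> 'a set \<Rightarrow> ('a \<Rightarrow> real) \<Rightarrow> ('a \<Rightarrow> 'a) \<Rightarrow> bool" where
  "W0 p w \<Omega> u g \<longleftrightarrow> u \<in> borel_measurable lebesgue \<and> g \<in> borel_measurable lebesgue \<and>
     (\<exists>\<phi> :: nat \<Rightarrow> 'a \<Rightarrow> real. (\<forall>n. test_fun \<Omega> (\<phi> n)) \<and>
        (\<lambda>n. \<integral>\<^sup>+x\<in>\<Omega>. ennreal (w x * \<bar>\<phi> n x - u x\<bar> powr p) \<partial>lebesgue) \<longlonglongrightarrow> 0 \<and>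
        (\<lambda>n. \<integral>\<^sup>+x\<in>\<Omega>. ennreal (w x * norm (grad (\<phi> n) x - g x) powr p) \<partial>lebesgue) \<longlonglongrightarrow> 0)"

text \<open>Weak eigenpair of -div(w |grad v|^(p-2) grad v) = lam w |v|^(p-2) v, v = 0 on the boundary.\<close>
definition eigenpair :: "real \<Rightarrow> ('a::euclidean_space \<Rightarrow> real) \<Rightarrow> 'a set \<Rightarrow> real \<Rightarrow> ('a \<Rightarrow> real) \<Rightarrow> ('a \<Rightarrow> 'a) \<Rightarrow> bool" where
  "eigenpair p w \<Omega> lam u g \<longleftrightarrow> W0 p w \<Omega> u g \<and>
     \<not> (AE x in lebesgue. x \<in> \<Omega> \<longrightarrow> u x = 0) \<and>
     (\<forall>\<phi>. test_fun \<Omega> \<phi> \<longrightarrow>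
        (LINT x:\<Omega>|lebesgue. w x * (norm (g x) powr (p - 2) * (g x \<bullet> grad \<phi> x)))
        = lam * (LINT x:\<Omega>|lebesgue. w x * (\<bar>u x\<bar> powr (p - 2) * u x * \<phi> x)))"

definition eigenvalue :: "real \<Rightarrow> ('a::euclidean_space \<Rightarrow> real) \<Rightarrow> 'a set \<Rightarrow> real \<Rightarrow> bool" where
  "eigenvalue p w \<Omega> lam \<longleftrightarrow> (\<exists>u g. eigenpair p w \<Omega> lam u g)"

definition first_eigenfunction :: "real \<Rightarrow> ('a::euclidean_space \<Rightarrow> real) \<Rightarrow> 'a set \<Rightarrow> ('a \<Rightarrow> real) \<Rightarrow> bool" where
  "first_eigenfunction p w \<Omega> u \<longleftrightarrow>
     (\<exists>lam g. eigenpair p w \<Omega> lam u g \<and> (\<forall>\<mu>. eigenvalue p w \<Omega> \<mu> \<longrightarrow> lam \<le> \<mu>)) \<and>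
     (AE x in lebesgue. x \<in> \<Omega> \<longrightarrow> u x > 0) \<and>
     (AE x in lebesgue. x \<in> \<Omega> \<longrightarrow> \<bar>u x\<bar> \<le> 1) \<and>
     (\<forall>c<1. \<not> (AE x in lebesgue. x \<in> \<Omega> \<longrightarrow> \<bar>u x\<bar> \<le> c))"

end

theory Submission
  imports Defs
begin

text \<open>
  Suppose the two eigenfunctions agree, and put \<open>v = 1 - z\<close>. As a solution of a \<open>q\<close>-Laplace equation with
  bounded right-hand side, \<open>v \<ge> 0\<close> satisfies a Harnack inequality, so at a maximum point \<open>x0\<close> of \<open>z\<close> one has
  \<open>v \<le> C * r powr (q / (q - 1))\<close> on \<open>ball x0 r\<close>; convexity of the domain keeps \<open>x0\<close> off the boundary.
  The weighted equation, tested with a cutoff \<open>\<eta>\<close> and with \<open>\<eta> * v\<close>, gives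
  \<open>w(ball x0 (r/2)) \<le> C * r powr (- p) * (SUP v) powr (p - 1) * w(ball x0 r)\<close>, where \<open>w(B)\<close> is the
  integral of the weight over \<open>B\<close>. Inserting the growth bound, the factor in front of \<open>w(ball x0 r)\<close> is
  \<open>r powr ((p - q) / (q - 1))\<close> up to a constant, so \<open>w(ball x0 r)\<close> decays faster than any power of \<open>r\<close>. This
  contradicts the local integrability of \<open>1 / w\<close>, by the Cauchy-Schwarz inequality.
\<close>

subsection \<open>Smooth functions\<close>

text \<open>The inequality \<open>q < p\<close> enters as \<open>q / (q - 1) * (p - 1) > p\<close>:
  the growth exponent of \<open>1 - z\<close> at its maximum, which is the natural one for the
  \<open>q\<close>-Laplacian, is too large for an equation of order \<open>p\<close>, so both
  equations can hold near that point only if the weight vanishes there to infinite order.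
  Integrability of \<open>1 / w\<close> bounds \<open>w(ball x0 r)\<close> below by a multiple of
  \<open>r powr (2 * N)\<close>, with \<open>N\<close> the dimension.

  Two obstacles shape the rest. Weak solutions are given only as limits of test functions, so a
  function of a solution is not by itself an admissible test function: nonlinear test functions are
  reached through polynomials, and every embedding is reduced to \<open>L1\<close> bounds on first
  differences, which survive the limit. Moreover the eigenvalue of the weighted problem cannot be
  assumed positive. If it is 0, the gradient vanishes and the eigenfunction is 1 on the largest ball
  around \<open>x0\<close> inside the domain; the point where this ball touches the complement is
  then a maximum point outside the domain, which convexity excludes.\<close>

lemma iter_pdiff_append: "iter_pdiff (es @ fs) f = iter_pdiff es (iter_pdiff fs f)"
  by (induction es) auto

lemma smooth_fun_pdiff:
  assumes "smooth_fun f" "e \<in> Basis"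
  shows "smooth_fun (pdiff e f)"
  unfolding smooth_fun_def
proof (intro allI impI)
  fix es :: "'a list" assume "set es \<subseteq> Basis"
  then have s: "set (es @ [e]) \<subseteq> Basis" using assms by auto
  have "iter_pdiff es (pdiff e f) = iter_pdiff (es @ [e]) f"
    by (simp add: iter_pdiff_append)
  then show "continuous_on UNIV (iter_pdiff es (pdiff e f)) \<and>
     (\<forall>e'\<in>Basis. \<forall>x. (\<lambda>t. iter_pdiff es (pdiff e f) (x + t *\<^sub>R e')) differentiable at 0)"
    using assms(1) s unfolding smooth_fun_def by simp
qed

lemma smooth_fun_continuous: "smooth_fun f \<Longrightarrow> continuous_on UNIV f"
  unfolding smooth_fun_def by (auto dest: spec[of _ "[]"])

lemma smooth_fun_has_pdiff:
  assumes "smooth_fun f" "e \<in> Basis"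
  shows "((\<lambda>t. f (x + t *\<^sub>R e)) has_real_derivative pdiff e f x) (at 0)"
proof -
  have "(\<lambda>t. f (x + t *\<^sub>R e)) differentiable (at 0)"
    using assms unfolding smooth_fun_def by (auto dest: spec[of _ "[]"])
  then show ?thesis
    unfolding pdiff_def using DERIV_deriv_iff_real_differentiable by blast
qed

text \<open>Iterated partial derivatives never leave \<open>S\<close>, so a class of continuous
  functions closed under first partial derivatives consists of smooth functions. Smoothness proofs
  below amount to exhibiting such a class.\<close>

lemma smooth_fun_coinduct:
  assumes f: "f \<in> S"
    and cont: "\<And>h. h \<in> S \<Longrightarrow> continuous_on UNIV h"
    and der: "\<And>h e. h \<in> S \<Longrightarrow> e \<in> Basis \<Longrightarrow>
        \<exists>h'\<in>S. \<forall>x. ((\<lambda>t. h (x + t *\<^sub>R e)) has_real_derivative h' x) (at 0)"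
  shows "smooth_fun f"
proof -
  have step: "pdiff e h \<in> S" if he: "h \<in> S" "e \<in> Basis" for h e
  proof -
    obtain h' where h': "h' \<in> S" "\<And>x. ((\<lambda>t. h (x + t *\<^sub>R e)) has_real_derivative h' x) (at 0)"
      using der he by blast
    then have "pdiff e h = h'" unfolding pdiff_def using DERIV_imp_deriv by blast
    then show ?thesis using h' by simp
  qed
  have it: "iter_pdiff es f \<in> S" if "set es \<subseteq> Basis" for es
    using that f step by (induction es) auto
  show ?thesis unfolding smooth_fun_def
  proof (intro allI impI conjI ballI)
    fix es :: "'a list" and e x :: 'a assume es: "set es \<subseteq> Basis"
    show "continuous_on UNIV (iter_pdiff es f)" by (rule cont[OF it[OF es]])
    assume "e \<in> Basis"
    from der[OF it[OF es] this] show "(\<lambda>t. iter_pdiff es f (x + t *\<^sub>R e)) differentiable at 0"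
      by (auto simp: real_differentiable_def)
  qed
qed

inductive_set smooth_alg :: "('a::euclidean_space \<Rightarrow> real) set \<Rightarrow> ('a \<Rightarrow> real) set"
  for B where
  gen: "f \<in> B \<Longrightarrow> f \<in> smooth_alg B"
| cst: "(\<lambda>_. c) \<in> smooth_alg B"
| add: "f \<in> smooth_alg B \<Longrightarrow> h \<in> smooth_alg B \<Longrightarrow> (\<lambda>x. f x + h x) \<in> smooth_alg B"
| mul: "f \<in> smooth_alg B \<Longrightarrow> h \<in> smooth_alg B \<Longrightarrow> (\<lambda>x. f x * h x) \<in> smooth_alg B"

text \<open>Sum and product rule carry closure under partial derivatives from the generators to the
  whole algebra. Derivatives of generators may leave \<open>B\<close> as long as they stay in the
  algebra, which is what the chain rule produces.\<close>

lemma smooth_algI: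
  assumes f: "f \<in> smooth_alg B"
    and cont: "\<And>h. h \<in> B \<Longrightarrow> continuous_on UNIV h"
    and der: "\<And>h e. h \<in> B \<Longrightarrow> e \<in> Basis \<Longrightarrow>
        \<exists>h'\<in>smooth_alg B. \<forall>x. ((\<lambda>t. h (x + t *\<^sub>R e)) has_real_derivative h' x) (at 0)"
  shows "smooth_fun f"
proof (rule smooth_fun_coinduct[OF f])
  show "continuous_on UNIV h" if "h \<in> smooth_alg B" for h
    using that by (induction rule: smooth_alg.induct) (auto intro: cont continuous_on_add continuous_on_mult)
  show "\<exists>h'\<in>smooth_alg B. \<forall>x. ((\<lambda>t. h (x + t *\<^sub>R e)) has_real_derivative h' x) (at 0)"
    if "h \<in> smooth_alg B" "e \<in> Basis" for h e
    using that
  proof (induction rule: smooth_alg.induct)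
    case (gen f)
    then show ?case using der by blast
  next
    case (cst c)
    show ?case by (rule bexI[of _ "\<lambda>_. 0"]) (auto intro: smooth_alg.cst)
  next
    case (add f h)
    then obtain f' h' where "f' \<in> smooth_alg B" "h' \<in> smooth_alg B"
      "\<And>x. ((\<lambda>t. f (x + t *\<^sub>R e)) has_real_derivative f' x) (at 0)"
      "\<And>x. ((\<lambda>t. h (x + t *\<^sub>R e)) has_real_derivative h' x) (at 0)" by blast
    then show ?case
      by (intro bexI[of _ "\<lambda>x. f' x + h' x"] allI DERIV_add smooth_alg.add)
  next
    case (mul f h)
    then obtain f' h' where fh: "f' \<in> smooth_alg B" "h' \<in> smooth_alg B"
      "\<And>x. ((\<lambda>t. f (x + t *\<^sub>R e)) has_real_derivative f' x) (at 0)"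
      "\<And>x. ((\<lambda>t. h (x + t *\<^sub>R e)) has_real_derivative h' x) (at 0)" by blast
    show ?case
    proof (intro bexI[of _ "\<lambda>x. f' x * h x + h' x * f x"] allI)
      show "(\<lambda>x. f' x * h x + h' x * f x) \<in> smooth_alg B"
        using fh mul by (intro smooth_alg.add smooth_alg.mul)
      show "((\<lambda>t. f (x + t *\<^sub>R e) * h (x + t *\<^sub>R e)) has_real_derivative f' x * h x + h' x * f x) (at 0)" for x
        using DERIV_mult[OF fh(3,4), of x x] by simp
    qed
  qed
qed

lemma smooth_alg_smooth:
  assumes "f \<in> smooth_alg {h. smooth_fun h}"
  shows "smooth_fun f"
proof (rule smooth_algI[OF assms])
  fix h :: "'a \<Rightarrow> real" and e :: 'a assume "h \<in> {h. smooth_fun h}" and e: "e \<in> Basis"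
  then have h: "smooth_fun h" by simp
  show "\<exists>h'\<in>smooth_alg {h. smooth_fun h}. \<forall>x. ((\<lambda>t. h (x + t *\<^sub>R e)) has_real_derivative h' x) (at 0)"
    by (rule bexI[of _ "pdiff e h"])
      (use smooth_fun_has_pdiff[OF h e] smooth_fun_pdiff[OF h e] in \<open>auto intro: smooth_alg.gen\<close>)
qed (auto intro: smooth_fun_continuous)

lemma smooth_fun_const [simp]: "smooth_fun (\<lambda>_. c)"
  by (rule smooth_alg_smooth[OF smooth_alg.cst])

lemma smooth_fun_add: "smooth_fun f \<Longrightarrow> smooth_fun h \<Longrightarrow> smooth_fun (\<lambda>x. f x + h x)"
  by (rule smooth_alg_smooth, rule smooth_alg.add) (auto intro: smooth_alg.gen)

lemma smooth_fun_mult: "smooth_fun f \<Longrightarrow> smooth_fun h \<Longrightarrow> smooth_fun (\<lambda>x. f x * h x)"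
  by (rule smooth_alg_smooth, rule smooth_alg.mul) (auto intro: smooth_alg.gen)

lemma smooth_fun_power: "smooth_fun f \<Longrightarrow> smooth_fun (\<lambda>x. f x ^ n)"
  by (induction n) (auto intro: smooth_fun_mult)

lemma smooth_fun_sum: "finite I \<Longrightarrow> (\<And>i. i \<in> I \<Longrightarrow> smooth_fun (f i)) \<Longrightarrow> smooth_fun (\<lambda>x. \<Sum>i\<in>I. f i x)"
  by (induction I rule: finite_induct) (auto intro: smooth_fun_add)

text \<open>Coordinates are changed one at a time, by induction over the set of coordinates already
  moved; each move is controlled by the mean value theorem and the continuity of that partial
  derivative. As \<open>smooth_fun\<close> speaks of partial derivatives only, this is the bridge to
  Frechet derivatives.\<close>

lemma has_derivative_of_partials:
  fixes f :: "'a::euclidean_space \<Rightarrow> real"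
  assumes der: "\<And>e x. e \<in> Basis \<Longrightarrow> ((\<lambda>t. f (x + t *\<^sub>R e)) has_real_derivative D e x) (at 0)"
    and cont: "\<And>e. e \<in> Basis \<Longrightarrow> continuous_on UNIV (D e)"
  shows "(f has_derivative (\<lambda>h. \<Sum>e\<in>Basis. D e x * (h \<bullet> e))) (at x)"
proof -
  have main: "\<exists>\<delta>>0. \<forall>h. norm h < \<delta> \<longrightarrow>
      \<bar>f (x + (\<Sum>e\<in>S. (h \<bullet> e) *\<^sub>R e)) - f x - (\<Sum>e\<in>S. D e x * (h \<bullet> e))\<bar> \<le> \<epsilon> * norm h"
    if "finite S" "S \<subseteq> Basis" "\<epsilon> > 0" for S \<epsilon>
    using that
  proof (induction S arbitrary: \<epsilon> rule: finite_induct)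
    case empty
    then show ?case by (intro exI[of _ 1]) auto
  next
    case (insert e S)
    then obtain d1 where d1: "d1 > 0" "\<And>h. norm h < d1 \<Longrightarrow>
      \<bar>f (x + (\<Sum>e\<in>S. (h \<bullet> e) *\<^sub>R e)) - f x - (\<Sum>e\<in>S. D e x * (h \<bullet> e))\<bar> \<le> \<epsilon>/2 * norm h"
      using insert.IH[of "\<epsilon>/2"] by auto
    have e: "e \<in> Basis" using insert by auto
    have "continuous (at x) (D e)" using cont[OF e] by (simp add: continuous_on_eq_continuous_at)
    then obtain d2 where d2: "d2 > 0" "\<And>y. norm (y - x) < d2 \<Longrightarrow> \<bar>D e y - D e x\<bar> < \<epsilon>/2"
      unfolding continuous_at_eps_delta dist_norm real_norm_def
      using insert.prems(2) half_gt_zero by blast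
    \<comment> \<open>With the coordinates in \<open>S\<close> moved, and part of the one along
      \<open>e\<close>, the distance to \<open>x\<close> is at most \<open>c * norm h\<close>; hence
      the radius \<open>d2 / c\<close>.\<close>
    define c where "c = real (card S) + 1"
    have c: "c > 0" unfolding c_def by linarith
    show ?case
    proof (intro exI[of _ "min d1 (d2 / c)"] conjI allI impI)
      show "min d1 (d2 / c) > 0" using d1 d2 c by auto
      fix h :: 'a assume h: "norm h < min d1 (d2 / c)"
      define y where "y = x + (\<Sum>e\<in>S. (h \<bullet> e) *\<^sub>R e)"
      have nS: "norm (y - x) \<le> real (card S) * norm h"
      proof -
        have "norm (y - x) \<le> (\<Sum>e\<in>S. norm ((h \<bullet> e) *\<^sub>R e))"
          unfolding y_def by (simp del: norm_scaleR add: norm_sum)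
        also have "\<dots> \<le> (\<Sum>e\<in>S. norm h)"
          using insert.prems by (intro sum_mono) (auto simp: Basis_le_norm)
        finally show ?thesis by simp
      qed
      have "\<exists>z. \<bar>z\<bar> \<le> \<bar>h \<bullet> e\<bar> \<and> f (y + (h \<bullet> e) *\<^sub>R e) - f y = (h \<bullet> e) * D e (y + z *\<^sub>R e)"
      proof -
        have dd: "((\<lambda>t. f (y + t *\<^sub>R e)) has_real_derivative D e (y + s *\<^sub>R e)) (at s)" for s
        proof -
          have "((\<lambda>t. f ((y + s *\<^sub>R e) + t *\<^sub>R e)) has_real_derivative D e (y + s *\<^sub>R e)) (at (s - s))"
            using der[OF e, of "y + s *\<^sub>R e"] by simp
          then have "((\<lambda>t. f ((y + s *\<^sub>R e) + (t - s) *\<^sub>R e)) has_real_derivative D e (y + s *\<^sub>R e)) (at s)"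
            using DERIV_shift[of "\<lambda>t. f ((y + s *\<^sub>R e) + t *\<^sub>R e)" "D e (y + s *\<^sub>R e)" s "-s"]
            by simp
          then show ?thesis by (simp add: algebra_simps)
        qed
        consider "h \<bullet> e = 0" | "h \<bullet> e > 0" | "h \<bullet> e < 0" by linarith
        then show ?thesis
        proof cases
          case 1 then show ?thesis by (intro exI[of _ 0]) auto
        next
          case 2
          obtain z where "0 < z" "z < h \<bullet> e" "f (y + (h \<bullet> e) *\<^sub>R e) - f (y + 0 *\<^sub>R e) = (h \<bullet> e - 0) * D e (y + z *\<^sub>R e)"
            using MVT2[OF 2, of "\<lambda>t. f (y + t *\<^sub>R e)" "\<lambda>s. D e (y + s *\<^sub>R e)"] dd by blast
          then show ?thesis by (intro exI[of _ z]) auto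
        next
          case 3
          obtain z where "h \<bullet> e < z" "z < 0" "f (y + 0 *\<^sub>R e) - f (y + (h \<bullet> e) *\<^sub>R e) = (0 - h \<bullet> e) * D e (y + z *\<^sub>R e)"
            using MVT2[OF 3, of "\<lambda>t. f (y + t *\<^sub>R e)" "\<lambda>s. D e (y + s *\<^sub>R e)"] dd by blast
          then show ?thesis by (intro exI[of _ z]) (auto simp: algebra_simps)
        qed
      qed
      then obtain z where z: "\<bar>z\<bar> \<le> \<bar>h \<bullet> e\<bar>" "f (y + (h \<bullet> e) *\<^sub>R e) - f y = (h \<bullet> e) * D e (y + z *\<^sub>R e)" by blast
      have he: "\<bar>h \<bullet> e\<bar> \<le> norm h" using e by (simp add: Basis_le_norm)
      have "norm (y + z *\<^sub>R e - x) \<le> norm (y - x) + \<bar>z\<bar>"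
        using norm_triangle_ineq[of "y - x" "z *\<^sub>R e"] e by (simp add: algebra_simps)
      also have "\<dots> \<le> c * norm h" using nS z he unfolding c_def by (simp add: algebra_simps)
      also have "\<dots> < d2" using h c by (simp add: field_simps)
      finally have "\<bar>D e (y + z *\<^sub>R e) - D e x\<bar> < \<epsilon>/2" using d2 by blast
      then have "\<bar>(h \<bullet> e) * (D e (y + z *\<^sub>R e) - D e x)\<bar> \<le> norm h * (\<epsilon>/2)"
        unfolding abs_mult using he by (intro mult_mono) auto
      moreover have "\<bar>f y - f x - (\<Sum>e\<in>S. D e x * (h \<bullet> e))\<bar> \<le> \<epsilon>/2 * norm h"
        using d1 h unfolding y_def by auto
      moreover have "f (x + (\<Sum>e\<in>insert e S. (h \<bullet> e) *\<^sub>R e)) = f (y + (h \<bullet> e) *\<^sub>R e)"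
        using insert.hyps unfolding y_def by (simp add: algebra_simps)
      moreover have "(\<Sum>e\<in>insert e S. D e x * (h \<bullet> e)) = D e x * (h \<bullet> e) + (\<Sum>e\<in>S. D e x * (h \<bullet> e))"
        using insert.hyps by simp
      moreover have "\<bar>f (y + (h \<bullet> e) *\<^sub>R e) - f x - (D e x * (h \<bullet> e) + (\<Sum>e\<in>S. D e x * (h \<bullet> e)))\<bar>
          \<le> \<bar>(h \<bullet> e) * (D e (y + z *\<^sub>R e) - D e x)\<bar> + \<bar>f y - f x - (\<Sum>e\<in>S. D e x * (h \<bullet> e))\<bar>"
      proof -
        have "f (y + (h \<bullet> e) *\<^sub>R e) - f x - (D e x * (h \<bullet> e) + (\<Sum>e\<in>S. D e x * (h \<bullet> e)))
          = (h \<bullet> e) * (D e (y + z *\<^sub>R e) - D e x) + (f y - f x - (\<Sum>e\<in>S. D e x * (h \<bullet> e)))"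
          using z(2) by (simp add: algebra_simps)
        then show ?thesis by (simp only: abs_triangle_ineq)
      qed
      ultimately show "\<bar>f (x + (\<Sum>e\<in>insert e S. (h \<bullet> e) *\<^sub>R e)) - f x - (\<Sum>e\<in>insert e S. D e x * (h \<bullet> e))\<bar> \<le> \<epsilon> * norm h"
        using mult.commute[of "norm h" \<epsilon>] by simp
    qed
  qed
  show ?thesis
    unfolding has_derivative_at_alt
  proof (intro conjI allI impI)
    show "bounded_linear (\<lambda>h. \<Sum>e\<in>Basis. D e x * (h \<bullet> e))"
      by (intro bounded_linear_sum bounded_linear_const_mult bounded_linear_inner_left)
    fix \<epsilon> :: real assume "\<epsilon> > 0"
    then obtain \<delta> where \<delta>: "\<delta> > 0" "\<And>h. norm h < \<delta> \<Longrightarrow>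
      \<bar>f (x + (\<Sum>e\<in>Basis. (h \<bullet> e) *\<^sub>R e)) - f x - (\<Sum>e\<in>Basis. D e x * (h \<bullet> e))\<bar> \<le> \<epsilon> * norm h"
      using main[of Basis \<epsilon>] by auto
    show "\<exists>d>0. \<forall>y. norm (y - x) < d \<longrightarrow> norm (f y - f x - (\<Sum>e\<in>Basis. D e x * ((y - x) \<bullet> e))) \<le> \<epsilon> * norm (y - x)"
    proof (intro exI[of _ \<delta>] conjI allI impI)
      fix y assume "norm (y - x) < \<delta>"
      from \<delta>(2)[OF this] show "norm (f y - f x - (\<Sum>e\<in>Basis. D e x * ((y - x) \<bullet> e))) \<le> \<epsilon> * norm (y - x)"
        by (simp add: euclidean_representation)
    qed (rule \<delta>)
  qed
qed

lemma smooth_fun_has_derivative: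
  assumes "smooth_fun f"
  shows "(f has_derivative (\<lambda>h. grad f x \<bullet> h)) (at x)"
proof -
  have "(f has_derivative (\<lambda>h. \<Sum>e\<in>Basis. pdiff e f x * (h \<bullet> e))) (at x)"
    by (rule has_derivative_of_partials[OF smooth_fun_has_pdiff[OF assms]
          smooth_fun_continuous[OF smooth_fun_pdiff[OF assms]]])
  moreover have "(\<lambda>h. \<Sum>e\<in>Basis. pdiff e f x * (h \<bullet> e)) = (\<lambda>h. grad f x \<bullet> h)"
    unfolding grad_def inner_sum_left inner_scaleR_left by (simp add: inner_commute)
  ultimately show ?thesis by simp
qed

lemma grad_eqI:
  assumes "(f has_derivative (\<lambda>h. G \<bullet> h)) (at x)"
  shows "grad f x = G"
proof -
  have "pdiff e f x = G \<bullet> e" if "e \<in> Basis" for e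
  proof -
    have "((\<lambda>t. f (x + t *\<^sub>R e)) has_derivative (\<lambda>t. G \<bullet> (t *\<^sub>R e))) (at 0)"
      by (rule has_derivative_compose[where f = "\<lambda>t. x + t *\<^sub>R e" and g = f, simplified])
        (use assms in \<open>auto intro!: derivative_eq_intros\<close>)
    then have "((\<lambda>t. f (x + t *\<^sub>R e)) has_real_derivative G \<bullet> e) (at 0)"
      by (simp add: has_field_derivative_def mult_commute_abs)
    then show ?thesis unfolding pdiff_def by (rule DERIV_imp_deriv)
  qed
  then show ?thesis unfolding grad_def by (simp add: euclidean_representation)
qed

lemma continuous_on_grad: "smooth_fun f \<Longrightarrow> continuous_on UNIV (grad f)"
  unfolding grad_def using smooth_fun_pdiff smooth_fun_continuous
  by (intro continuous_on_sum continuous_on_scaleR continuous_on_const) blast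

section \<open>Flat functions and a smooth step\<close>

definition flat_exp :: "real poly \<Rightarrow> real \<Rightarrow> real" where
  "flat_exp P t = (if t > 0 then poly P (1 / t) * exp (- (1 / t)) else 0)"

lemma poly_mult_exp_minus_tendsto_0: "((\<lambda>x::real. poly P x * exp (- x)) \<longlongrightarrow> 0) at_top"
proof -
  have "((\<lambda>x. \<Sum>i\<le>degree P. coeff P i * (x ^ i / exp x)) \<longlongrightarrow> (\<Sum>i\<le>degree P. coeff P i * 0)) at_top"
    by (intro tendsto_sum tendsto_mult tendsto_const tendsto_power_div_exp_0)
  then show ?thesis
    by (simp add: poly_altdef exp_minus divide_inverse sum_distrib_right mult.assoc)
qed

lemma flat_exp_tendsto_0: "((\<lambda>t. flat_exp P t) \<longlongrightarrow> 0) (at 0)"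
proof -
  have l: "((\<lambda>t. flat_exp P t) \<longlongrightarrow> 0) (at_left 0)"
    by (rule tendsto_eventually) (auto simp: flat_exp_def eventually_at_filter)
  have "((\<lambda>t. poly P (inverse t) * exp (- inverse t)) \<longlongrightarrow> 0) (at_right 0)"
    by (rule filterlim_compose[OF poly_mult_exp_minus_tendsto_0 filterlim_inverse_at_top_right])
  then have r: "((\<lambda>t. flat_exp P t) \<longlongrightarrow> 0) (at_right 0)"
    by (rule Lim_transform_eventually)
      (auto simp: flat_exp_def eventually_at_filter inverse_eq_divide)
  show ?thesis using l r by (simp add: filterlim_split_at)
qed

text \<open>With \<open>s = 1 / t\<close>, differentiating \<open>P(s) * exp (- s)\<close>
  multiplies by \<open>s^2\<close> and replaces \<open>P\<close> by \<open>P - pderiv P\<close>. The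
  polynomial parameter thus closes the family under differentiation, also at 0, where exponential
  decay beats every polynomial.\<close>

lemma flat_exp_has_derivative:
  "(flat_exp P has_real_derivative flat_exp ((P - pderiv P) * [:0, 0, 1:]) t) (at t)"
proof -
  consider "t > 0" | "t < 0" | "t = 0" by linarith
  then show ?thesis
  proof cases
    case 1
    have "((\<lambda>t. poly P (1 / t) * exp (- (1 / t))) has_real_derivative
        flat_exp ((P - pderiv P) * [:0, 0, 1:]) t) (at t)"
      using 1 by (auto intro!: derivative_eq_intros simp: flat_exp_def field_simps power2_eq_square)
    then show ?thesis
      by (rule has_field_derivative_transform_within_open[of _ _ _ "{0<..}"])
        (use 1 in \<open>auto simp: flat_exp_def\<close>)
  next
    case 2
    have "((\<lambda>t. 0) has_real_derivative flat_exp ((P - pderiv P) * [:0, 0, 1:]) t) (at t)"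
      using 2 by (simp add: flat_exp_def)
    then show ?thesis
      by (rule has_field_derivative_transform_within_open[of _ _ _ "{..<0}"])
        (use 2 in \<open>auto simp: flat_exp_def\<close>)
  next
    case 3
    \<comment> \<open>The difference quotient at 0 is itself a flat function: dividing by
      \<open>h\<close> multiplies the polynomial by its variable.\<close>
    have "((\<lambda>h. flat_exp (P * [:0, 1:]) h) \<longlongrightarrow> 0) (at 0)"
      by (rule flat_exp_tendsto_0)
    then have "((\<lambda>h. (flat_exp P (0 + h) - flat_exp P 0) / h) \<longlongrightarrow> 0) (at 0)"
      by (rule Lim_transform_eventually)
        (auto simp: flat_exp_def eventually_at_filter)
    then show ?thesis using 3 by (simp add: DERIV_def flat_exp_def)
  qed
qed

text \<open>The one-variable counterpart of \<open>smooth_alg\<close>. The reflected flat functions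
  are generators because the bump used below is a product of one function flat at 0 and one flat at
  1.\<close>

inductive_set smooth_real :: "(real \<Rightarrow> real) set" where
  "flat_exp P \<in> smooth_real"
| "(\<lambda>t. flat_exp P (1 - t)) \<in> smooth_real"
| "(\<lambda>_. c) \<in> smooth_real"
| "f \<in> smooth_real \<Longrightarrow> h \<in> smooth_real \<Longrightarrow> (\<lambda>t. f t + h t) \<in> smooth_real"
| "f \<in> smooth_real \<Longrightarrow> h \<in> smooth_real \<Longrightarrow> (\<lambda>t. f t * h t) \<in> smooth_real"

lemma smooth_real_deriv:
  "f \<in> smooth_real \<Longrightarrow> \<exists>f'\<in>smooth_real. \<forall>t. (f has_real_derivative f' t) (at t)"
proof (induction rule: smooth_real.induct)
  case (1 P)
  show ?case using flat_exp_has_derivative smooth_real.intros(1) by blast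
next
  case (2 P)
  show ?case
  proof (intro bexI[of _ "\<lambda>t. -1 * flat_exp ((P - pderiv P) * [:0, 0, 1:]) (1 - t)"] allI)
    fix t :: real
    have "((\<lambda>t. 1 - t) has_real_derivative -1) (at t)" by (auto intro!: derivative_eq_intros)
    from DERIV_chain2[OF flat_exp_has_derivative this]
    show "((\<lambda>t. flat_exp P (1 - t)) has_real_derivative -1 * flat_exp ((P - pderiv P) * [:0, 0, 1:]) (1 - t)) (at t)"
      by (simp add: mult.commute)
  qed (intro smooth_real.intros)
next
  case (3 c)
  show ?case using smooth_real.intros(3)[of 0] DERIV_const by fast
next
  case (4 f h)
  then obtain f' h' where fh: "f' \<in> smooth_real" "h' \<in> smooth_real"
    "\<And>t. (f has_real_derivative f' t) (at t)" "\<And>t. (h has_real_derivative h' t) (at t)" by blast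
  show ?case
    by (intro bexI[of _ "\<lambda>t. f' t + h' t"] allI DERIV_add[OF fh(3,4)] smooth_real.intros(4)[OF fh(1,2)])
next
  case (5 f h)
  then obtain f' h' where fh: "f' \<in> smooth_real" "h' \<in> smooth_real"
    "\<And>t. (f has_real_derivative f' t) (at t)" "\<And>t. (h has_real_derivative h' t) (at t)" by blast
  show ?case
  proof (intro bexI[of _ "\<lambda>t. f' t * h t + h' t * f t"] allI)
    show "((\<lambda>t. f t * h t) has_real_derivative f' t * h t + h' t * f t) (at t)" for t
      by (rule DERIV_mult[OF fh(3,4)])
    show "(\<lambda>t. f' t * h t + h' t * f t) \<in> smooth_real"
      using fh(1,2) \<open>f \<in> smooth_real\<close> \<open>h \<in> smooth_real\<close> by (simp add: smooth_real.intros(4,5))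
  qed
qed

lemma smooth_real_continuous:
  assumes "f \<in> smooth_real"
  shows "continuous_on S f"
proof -
  obtain f' where "\<And>t. (f has_real_derivative f' t) (at t)" using smooth_real_deriv[OF assms] by blast
  from has_field_derivative_at_within[OF this] show ?thesis by (rule DERIV_continuous_on)
qed

text \<open>The step is the normalised primitive of the bump \<open>b\<close>. Membership in
  \<open>smooth_real\<close> is established for its derivative, so both functions are returned, and
  the primitive enters the later smoothness argument as a separate generator.\<close>

lemma smooth_step_exists:
  obtains \<Theta> \<Theta>' :: "real \<Rightarrow> real" and C where
    "\<Theta>' \<in> smooth_real" "\<And>t. (\<Theta> has_real_derivative \<Theta>' t) (at t)"
    "\<And>t. t \<le> 0 \<Longrightarrow> \<Theta> t = 0" "\<And>t. t \<ge> 1 \<Longrightarrow> \<Theta> t = 1" "\<And>t. 0 \<le> \<Theta> t" "\<And>t. \<Theta> t \<le> 1"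
    "\<And>t. \<bar>\<Theta>' t\<bar> \<le> C" "C \<ge> 0"
proof -
  define b where "b = (\<lambda>t. flat_exp 1 t * flat_exp 1 (1 - t))"
  have b: "b \<in> smooth_real" unfolding b_def by (intro smooth_real.intros)
  have cb: "continuous_on S b" for S by (rule smooth_real_continuous[OF b])
  have b0: "b t \<ge> 0" for t by (simp add: b_def flat_exp_def)
  have bz: "b t = 0" if "t \<le> 0 \<or> t \<ge> 1" for t using that by (auto simp: b_def flat_exp_def)
  have b1: "b t \<le> 1" for t by (auto simp: b_def flat_exp_def mult_le_one)
  have bi: "b integrable_on {s..t}" for s t
    by (rule integrable_continuous_interval[OF cb])
  define I where "I = integral {0..1} b"
  have "I > 0"
  proof -
    have "I \<noteq> 0"
    proof
      assume "I = 0"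
      have "integral {0..1} b = 0 \<longleftrightarrow> (\<forall>x\<in>{0..1}. b x = 0)"
        by (rule integral_eq_0_iff) (use cb b0 in auto)
      then have "b (1/2) = 0" using \<open>I = 0\<close> I_def by auto
      then show False by (simp add: b_def flat_exp_def)
    qed
    moreover have "I \<ge> 0" unfolding I_def by (intro integral_nonneg bi b0)
    ultimately show ?thesis by simp
  qed
  define \<Theta> where "\<Theta> t = integral {0..t} b / I" for t
  have th0: "\<Theta> t = 0" if "t \<le> 0" for t
    using that bz by (cases "t = 0") (auto simp: \<Theta>_def)
  have th1: "\<Theta> t = 1" if "t \<ge> 1" for t
  proof -
    have "integral {0..1} b + integral {1..t} b = integral {0..t} b"
      by (rule Henstock_Kurzweil_Integration.integral_combine) (use that bi in auto)
    moreover have "integral {1..t} b = integral {1..t} (\<lambda>_. 0)"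
      by (rule Henstock_Kurzweil_Integration.integral_cong) (use bz in auto)
    ultimately show ?thesis using \<open>I > 0\<close> by (simp add: \<Theta>_def I_def)
  qed
  have der: "(\<Theta> has_real_derivative (1 / I) * b t) (at t)" for t
  proof (cases "t \<le> -1")
    case True
    have "((\<lambda>t. 0) has_real_derivative (1 / I) * b t) (at t)" using True bz by simp
    then show ?thesis
      by (rule has_field_derivative_transform_within_open[of _ _ _ "{..<0}"]) (use True th0 in auto)
  next
    case False
    \<comment> \<open>The integral from 0 cannot be differentiated directly at points
      \<open>t \<le> 0\<close>. Since \<open>b\<close> vanishes left of 0, the base point may be
      moved to -2, which covers all remaining \<open>t > -1\<close>.\<close>
    define a :: real where "a = -2"
    have "((\<lambda>u. integral {a..u} b) has_real_derivative b t) (at t within {a..t+1})"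
      by (rule integral_has_real_derivative[OF cb]) (use False a_def in auto)
    moreover have "at t within {a..t+1} = at t"
      by (rule at_within_interior) (use False a_def in auto)
    ultimately have "((\<lambda>u. integral {a..u} b) has_real_derivative b t) (at t)" by simp
    then have d: "((\<lambda>u. (1 / I) * integral {a..u} b) has_real_derivative (1 / I) * b t) (at t)"
      by (rule DERIV_cmult)
    have eq: "(1 / I) * integral {a..u} b = \<Theta> u" if "u \<ge> a" for u
    proof -
      have z: "integral {a..s} b = 0" if "s \<le> 0" for s
      proof -
        have "integral {a..s} b = integral {a..s} (\<lambda>_. 0)"
          by (rule Henstock_Kurzweil_Integration.integral_cong) (use bz that in auto)
        then show ?thesis by simp
      qed
      show ?thesis
      proof (cases "u \<le> 0")
        case True
        then show ?thesis using z th0 by simp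
      next
        case False
        have "integral {a..0} b + integral {0..u} b = integral {a..u} b"
          by (rule Henstock_Kurzweil_Integration.integral_combine) (use False bi a_def in auto)
        then show ?thesis using z[of 0] by (simp add: \<Theta>_def)
      qed
    qed
    show ?thesis
      by (rule has_field_derivative_transform_within_open[OF d, of "{a<..}"]) (use False eq a_def in auto)
  qed
  have mono: "\<Theta> s \<le> \<Theta> t" if "s \<le> t" for s t
    by (rule DERIV_nonneg_imp_nondecreasing[OF that]) (use der b0 \<open>I > 0\<close> in \<open>meson divide_nonneg_pos mult_nonneg_nonneg zero_le_one\<close>)
  show ?thesis
  proof (rule that[of "\<lambda>t. (1 / I) * b t" \<Theta> "1 / I"])
    show "(\<lambda>t. (1 / I) * b t) \<in> smooth_real" using b by (intro smooth_real.intros)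
    show "0 \<le> \<Theta> t" for t using mono[of "min t 0" t] th0[of "min t 0"] by auto
    show "\<Theta> t \<le> 1" for t using mono[of t "max t 1"] th1[of "max t 1"] by auto
    show "\<bar>1 / I * b t\<bar> \<le> 1 / I" for t
      using b0 b1 \<open>I > 0\<close> by (auto simp: abs_mult divide_right_mono)
  qed (use der th0 th1 \<open>I > 0\<close> in auto)
qed

subsection \<open>Cutoffs and translation estimates\<close>

text \<open>The bound on the gradient by a power of \<open>\<eta>\<close> is obtained by raising a smooth cutoff to a power
  \<open>M \<ge> q\<close>; it is what makes Young's inequality applicable.\<close>

definition is_cutoff :: "real \<Rightarrow> real \<Rightarrow> 'a::euclidean_space \<Rightarrow> real \<Rightarrow> real \<Rightarrow> ('a \<Rightarrow> real) \<Rightarrow> bool" where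
  "is_cutoff q C x0 \<rho> \<sigma> \<eta> \<longleftrightarrow> smooth_fun \<eta> \<and> (\<forall>x. 0 \<le> \<eta> x \<and> \<eta> x \<le> 1) \<and>
     (\<forall>x. norm (x - x0) \<le> \<rho> \<longrightarrow> \<eta> x = 1) \<and> (\<forall>x. \<sigma> \<le> norm (x - x0) \<longrightarrow> \<eta> x = 0) \<and>
     (\<forall>x. norm (grad \<eta> x) \<le> C / (\<sigma> - \<rho>) * \<eta> x powr ((q - 1) / q))"

text \<open>The radial variable is the quadratic polynomial
  \<open>(x - x0) \<bullet> (x - x0)\<close>, which is smooth at \<open>x0\<close> too. The chain
  rule produces products of a function of \<open>s\<close> and a coordinate, so these together with
  the primitive \<open>\<Theta>\<close> of \<open>s\<close> generate an algebra closed under partial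
  derivatives.\<close>

lemma smooth_fun_radial:
  fixes x0 :: "'a::euclidean_space"
  assumes \<Theta>: "\<And>t. (\<Theta> has_real_derivative \<Theta>' t) (at t)" and \<Theta>': "\<Theta>' \<in> smooth_real"
  shows "smooth_fun (\<lambda>x. \<Theta> ((b - (x - x0) \<bullet> (x - x0)) / c))"
proof -
  define s where "s x = (b - (x - x0) \<bullet> (x - x0)) / c" for x :: 'a
  define B where "B = insert (\<lambda>x. \<Theta> (s x)) ((\<lambda>f x. f (s x)) ` smooth_real \<union> (\<lambda>e x. (x - x0) \<bullet> e) ` Basis)"
  have cont_s: "continuous_on UNIV s" unfolding s_def divide_inverse by (intro continuous_intros)
  have ds: "((\<lambda>t. s (x + t *\<^sub>R e)) has_real_derivative - 2 / c * ((x - x0) \<bullet> e)) (at 0)" for x e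
    unfolding s_def by (auto intro!: derivative_eq_intros simp: inner_commute divide_inverse algebra_simps)
  have chain: "\<exists>h'\<in>smooth_alg B. \<forall>x. ((\<lambda>t. F (s (x + t *\<^sub>R e))) has_real_derivative h' x) (at 0)"
    if F: "\<And>t. (F has_real_derivative F' t) (at t)" and F': "F' \<in> smooth_real" and e: "e \<in> Basis" for F F' e
  proof (intro bexI[of _ "\<lambda>x. F' (s x) * (- 2 / c * ((x - x0) \<bullet> e))"] allI)
    show "((\<lambda>t. F (s (x + t *\<^sub>R e))) has_real_derivative F' (s x) * (- 2 / c * ((x - x0) \<bullet> e))) (at 0)" for x
      using DERIV_chain2[OF F ds, of x e] by simp
    show "(\<lambda>x. F' (s x) * (- 2 / c * ((x - x0) \<bullet> e))) \<in> smooth_alg B"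
      by (rule smooth_alg.mul[OF smooth_alg.gen smooth_alg.mul[OF smooth_alg.cst smooth_alg.gen]])
        (use F' e in \<open>auto simp: B_def\<close>)
  qed
  have "smooth_fun (\<lambda>x. \<Theta> (s x))"
  proof (rule smooth_algI[of _ B])
    show "(\<lambda>x. \<Theta> (s x)) \<in> smooth_alg B" by (rule smooth_alg.gen) (simp add: B_def)
    fix h assume h: "h \<in> B"
    have "continuous_on UNIV \<Theta>" by (rule DERIV_continuous_on[OF has_field_derivative_at_within[OF \<Theta>]])
    then have "continuous_on UNIV (\<lambda>x. \<Theta> (s x))"
      by (rule continuous_on_compose2[OF _ cont_s]) auto
    moreover have "continuous_on UNIV (\<lambda>x. f (s x))" if "f \<in> smooth_real" for f
      by (rule continuous_on_compose2[OF smooth_real_continuous[OF that] cont_s subset_UNIV])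
    moreover have "continuous_on UNIV (\<lambda>x::'a. (x - x0) \<bullet> e)" for e by (intro continuous_intros)
    ultimately show "continuous_on UNIV h" using h unfolding B_def by blast
    fix e :: 'a assume e: "e \<in> Basis"
    consider "h = (\<lambda>x. \<Theta> (s x))" | f where "f \<in> smooth_real" "h = (\<lambda>x. f (s x))"
      | e' where "h = (\<lambda>x. (x - x0) \<bullet> e')" using h unfolding B_def by blast
    then show "\<exists>h'\<in>smooth_alg B. \<forall>x. ((\<lambda>t. h (x + t *\<^sub>R e)) has_real_derivative h' x) (at 0)"
    proof cases
      case 1 then show ?thesis using chain[OF \<Theta> \<Theta>' e] by simp
    next
      case 2
      obtain f' where "f' \<in> smooth_real" "\<And>t. (f has_real_derivative f' t) (at t)"
        using smooth_real_deriv[OF 2(1)] by blast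
      then show ?thesis using chain[of f f' e] e 2(2) by simp
    next
      case 3
      show ?thesis unfolding 3
        by (intro bexI[of _ "\<lambda>_. e \<bullet> e'"] allI smooth_alg.cst)
          (auto intro!: derivative_eq_intros simp: inner_diff_left inner_add_left)
    qed
  qed
  then show ?thesis by (simp add: s_def)
qed

lemma has_derivative_radial:
  fixes x0 :: "'a::euclidean_space"
  assumes \<Theta>: "\<And>t. (\<Theta> has_real_derivative \<Theta>' t) (at t)"
  shows "((\<lambda>x. \<Theta> ((b - (x - x0) \<bullet> (x - x0)) / c)) has_derivative
      (\<lambda>h. ((\<Theta>' ((b - (x - x0) \<bullet> (x - x0)) / c) * (- 2 / c)) *\<^sub>R (x - x0)) \<bullet> h)) (at x)"
proof -
  have "((\<lambda>x. (b - (x - x0) \<bullet> (x - x0)) / c) has_derivative (\<lambda>h. (- 2 / c) * ((x - x0) \<bullet> h))) (at x)"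
    by (auto intro!: derivative_eq_intros simp: inner_commute divide_inverse algebra_simps)
  from has_derivative_compose[OF this \<Theta>[unfolded has_field_derivative_def]]
  show ?thesis by (simp add: mult.assoc mult.left_commute)
qed

text \<open>One constant must serve all centres and radii, since the later iteration shrinks
  \<open>\<sigma> - \<rho>\<close>. The step is composed with
  \<open>(\<sigma>^2 - |x - x0|^2) / (\<sigma>^2 - \<rho>^2)\<close>, whose gradient is at most
  \<open>2 / (\<sigma> - \<rho>)\<close> on the ball of radius \<open>\<sigma>\<close>.\<close>

lemma cutoff_exists:
  assumes q: "q > 1"
  shows "\<exists>C\<ge>0. \<forall>(x0::'a::euclidean_space) \<rho> \<sigma>. 0 < \<rho> \<and> \<rho> < \<sigma> \<longrightarrow> (\<exists>\<eta>. is_cutoff q C x0 \<rho> \<sigma> \<eta>)"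
proof -
  obtain \<Theta>' \<Theta> :: "real \<Rightarrow> real" and C where T:
    "\<Theta>' \<in> smooth_real" "\<And>t. (\<Theta> has_real_derivative \<Theta>' t) (at t)"
    "\<And>t. t \<le> 0 \<Longrightarrow> \<Theta> t = 0" "\<And>t. t \<ge> 1 \<Longrightarrow> \<Theta> t = 1" "\<And>t. 0 \<le> \<Theta> t" "\<And>t. \<Theta> t \<le> 1"
    "\<And>t. \<bar>\<Theta>' t\<bar> \<le> C" "C \<ge> 0"
    by (rule smooth_step_exists) (rule that)
  \<comment> \<open>\<open>M \<ge> q\<close> is equivalent to
    \<open>M - 1 \<ge> M * (q - 1) / q\<close>, so the factor \<open>\<eta>0\<close> lost by
    differentiation still leaves the required power of \<open>\<eta>0 ^ M\<close>;
    \<open>M \<ge> 2\<close> makes the gradient vanish where \<open>\<eta>0\<close> does.\<close>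
  define M where "M = nat \<lceil>q\<rceil>"
  have M: "real M \<ge> q" "M \<ge> 2" using q unfolding M_def by linarith+
  have "\<exists>\<eta>. is_cutoff q (real M * C * 2) x0 \<rho> \<sigma> \<eta>" if r: "0 < \<rho>" "\<rho> < \<sigma>" for x0 :: 'a and \<rho> \<sigma>
  proof -
    define c where "c = \<sigma>^2 - \<rho>^2"
    have c: "c = (\<sigma> - \<rho>) * (\<sigma> + \<rho>)" "c > 0" using r by (auto simp: c_def power2_eq_square algebra_simps mult_strict_mono)
    define \<eta>0 where "\<eta>0 x = \<Theta> ((\<sigma>^2 - (x - x0) \<bullet> (x - x0)) / c)" for x
    have sm: "smooth_fun \<eta>0" unfolding \<eta>0_def by (rule smooth_fun_radial[OF T(2,1)])
    have zero: "\<eta>0 x = 0" if "\<sigma> \<le> norm (x - x0)" for x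
    proof -
      have "\<sigma>^2 \<le> (norm (x - x0))^2" using that r by (intro power_mono) auto
      then have "(\<sigma>^2 - (x - x0) \<bullet> (x - x0)) / c \<le> 0" using c
        by (simp add: power2_norm_eq_inner divide_nonpos_pos)
      then show ?thesis using T unfolding \<eta>0_def by blast
    qed
    have one: "\<eta>0 x = 1" if "norm (x - x0) \<le> \<rho>" for x
    proof -
      have "(norm (x - x0))^2 \<le> \<rho>^2" using that by (intro power_mono) auto
      then have "(\<sigma>^2 - (x - x0) \<bullet> (x - x0)) / c \<ge> 1" using c(2) unfolding c_def
        by (simp add: power2_norm_eq_inner)
      then show ?thesis using T unfolding \<eta>0_def by blast
    qed
    have rng: "0 \<le> \<eta>0 x" "\<eta>0 x \<le> 1" for x using T by (auto simp: \<eta>0_def)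
    define G where "G x = (\<Theta>' ((\<sigma>^2 - (x - x0) \<bullet> (x - x0)) / c) * (- 2 / c)) *\<^sub>R (x - x0)" for x
    have d0: "(\<eta>0 has_derivative (\<lambda>h. G x \<bullet> h)) (at x)" for x
      unfolding \<eta>0_def G_def by (rule has_derivative_radial[OF T(2)])
    have g: "grad (\<lambda>x. \<eta>0 x ^ M) x = (real M * \<eta>0 x ^ (M - 1)) *\<^sub>R G x" for x
      by (rule grad_eqI) (use has_derivative_power[OF d0, of M x] in \<open>simp add: ac_simps\<close>)
    have gb: "norm (grad (\<lambda>x. \<eta>0 x ^ M) x) \<le> real M * C * 2 / (\<sigma> - \<rho>) * (\<eta>0 x ^ M) powr ((q - 1) / q)" for x
    proof (cases "\<eta>0 x = 0")
      case True
      then show ?thesis using M by (simp add: g power_0_left)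
    next
      case False
      then have pos: "\<eta>0 x > 0" using rng by (simp add: less_le)
      have nx: "norm (x - x0) \<le> \<sigma>" using zero[of x] False by linarith
      have "norm (G x) \<le> C * (2 / c) * \<sigma>"
        unfolding G_def norm_scaleR abs_mult using c nx T by (intro mult_mono) auto
      also have "\<dots> \<le> C * 2 / (\<sigma> - \<rho>)"
      proof -
        have "2 / c * \<sigma> = 2 / (\<sigma> - \<rho>) * (\<sigma> / (\<sigma> + \<rho>))" using c r by simp
        also have "\<dots> \<le> 2 / (\<sigma> - \<rho>) * 1" using r by (intro mult_left_mono) auto
        finally have "C * (2 / c * \<sigma>) \<le> C * (2 / (\<sigma> - \<rho>))" using T(8) by (intro mult_left_mono) auto
        then show ?thesis by (simp add: algebra_simps)
      qed
      finally have 1: "norm (G x) \<le> C * 2 / (\<sigma> - \<rho>)" .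
      have "\<eta>0 x ^ (M - 1) = \<eta>0 x powr (real M - 1)"
        using pos M by (simp flip: powr_realpow add: of_nat_diff)
      also have "\<dots> \<le> \<eta>0 x powr (real M * ((q - 1) / q))"
      proof (rule powr_mono')
        show "real M * ((q - 1) / q) \<le> real M - 1" using M q by (simp add: field_simps)
      qed (use rng pos in auto)
      also have "\<dots> = (\<eta>0 x ^ M) powr ((q - 1) / q)" using pos by (simp add: powr_powr flip: powr_realpow)
      finally have 2: "\<eta>0 x ^ (M - 1) \<le> (\<eta>0 x ^ M) powr ((q - 1) / q)" .
      have "norm (grad (\<lambda>x. \<eta>0 x ^ M) x) = real M * (\<eta>0 x ^ (M - 1) * norm (G x))"
        using rng[of x] by (simp add: g abs_mult)
      also have "\<dots> \<le> real M * ((\<eta>0 x ^ M) powr ((q - 1) / q) * (C * 2 / (\<sigma> - \<rho>)))"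
        by (intro mult_left_mono mult_mono 1 2) auto
      finally show ?thesis by (simp add: algebra_simps)
    qed
    show ?thesis
      unfolding is_cutoff_def
    proof (intro exI[of _ "\<lambda>x. \<eta>0 x ^ M"] conjI allI impI smooth_fun_power[OF sm] gb)
      show "0 \<le> \<eta>0 x ^ M" "\<eta>0 x ^ M \<le> 1" for x using rng by (simp_all add: power_le_one)
      show "\<eta>0 x ^ M = 1" if "norm (x - x0) \<le> \<rho>" for x using one[OF that] by simp
      show "\<eta>0 x ^ M = 0" if "\<sigma> \<le> norm (x - x0)" for x using zero[OF that] M by simp
    qed
  qed
  moreover have "real M * C * 2 \<ge> 0" using T(8) by simp
  ultimately show ?thesis by blast
qed

text \<open>The difference is the integral of the derivative along a segment; convexity keeps the
  segment in \<open>B\<close>, and after Fubini translation invariance removes the shift. The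
  embedding inequalities below see a function only through a bound of this kind, which passes to
  limits of smooth functions.\<close>

lemma translation_estimate_C1:
  fixes \<psi> :: "'a::euclidean_space \<Rightarrow> real"
  assumes der: "\<And>x. (\<psi> has_derivative (\<lambda>h. D x \<bullet> h)) (at x)"
    and cont: "continuous_on UNIV D" and B: "convex B" "B \<in> sets borel"
  shows "(\<integral>\<^sup>+x. indicator B x * indicator B (x + h) * ennreal \<bar>\<psi> (x + h) - \<psi> x\<bar> \<partial>lborel)
    \<le> ennreal (norm h) * (\<integral>\<^sup>+x. indicator B x * ennreal (norm (D x)) \<partial>lborel)"
proof -
  note [measurable] = B(2)
  have [measurable]: "D \<in> borel_measurable borel" using cont by (rule borel_measurable_continuous_onI)
  have "continuous_on UNIV \<psi>"
    by (intro continuous_at_imp_continuous_on ballI has_derivative_continuous[OF der])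
  then have [measurable]: "\<psi> \<in> borel_measurable borel" by (rule borel_measurable_continuous_onI)
  have pt: "ennreal \<bar>\<psi> (x + h) - \<psi> x\<bar> \<le> (\<integral>\<^sup>+t. indicator {0..1} t * ennreal (norm (D (x + t *\<^sub>R h)) * norm h) \<partial>lborel)" for x
  proof -
    have c: "continuous_on {0..1} (\<lambda>t. D (x + t *\<^sub>R h) \<bullet> h)"
      by (intro continuous_intros continuous_on_compose2[OF cont]) auto
    have d: "((\<lambda>t. \<psi> (x + t *\<^sub>R h)) has_vector_derivative D (x + t *\<^sub>R h) \<bullet> h) (at t within {0..1})" for t
    proof -
      have "((\<lambda>t. x + t *\<^sub>R h) has_derivative (\<lambda>t. t *\<^sub>R h)) (at t within {0..1})"
        by (auto intro!: derivative_eq_intros)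
      from has_derivative_compose[OF this der] show ?thesis
        by (simp add: has_vector_derivative_def)
    qed
    have int: "integrable lborel (\<lambda>t. indicator {0..1} t *\<^sub>R (D (x + t *\<^sub>R h) \<bullet> h))"
      using borel_integrable_compact[OF _ c] by simp
    have "(\<integral>t. indicator {0..1} t *\<^sub>R (D (x + t *\<^sub>R h) \<bullet> h) \<partial>lborel) = \<psi> (x + 1 *\<^sub>R h) - \<psi> (x + 0 *\<^sub>R h)"
      by (rule integral_FTC_atLeastAtMost[OF _ d c]) auto
    then have "ennreal \<bar>\<psi> (x + h) - \<psi> x\<bar> \<le> (\<integral>\<^sup>+t. norm (indicator {0..1} t *\<^sub>R (D (x + t *\<^sub>R h) \<bullet> h)) \<partial>lborel)"
      using integral_norm_bound_ennreal[OF int] by simp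
    also have "\<dots> \<le> (\<integral>\<^sup>+t. indicator {0..1} t * ennreal (norm (D (x + t *\<^sub>R h)) * norm h) \<partial>lborel)"
      by (intro nn_integral_mono) (auto simp: indicator_def Cauchy_Schwarz_ineq2)
    finally show ?thesis .
  qed
  have "(\<integral>\<^sup>+x. indicator B x * indicator B (x + h) * ennreal \<bar>\<psi> (x + h) - \<psi> x\<bar> \<partial>lborel)
    \<le> (\<integral>\<^sup>+x. (\<integral>\<^sup>+t. indicator {0..1} t * (indicator B (x + t *\<^sub>R h) * ennreal (norm (D (x + t *\<^sub>R h)) * norm h)) \<partial>lborel) \<partial>lborel)"
  proof (rule nn_integral_mono)
    fix x
    show "indicator B x * indicator B (x + h) * ennreal \<bar>\<psi> (x + h) - \<psi> x\<bar>
      \<le> (\<integral>\<^sup>+t. indicator {0..1} t * (indicator B (x + t *\<^sub>R h) * ennreal (norm (D (x + t *\<^sub>R h)) * norm h)) \<partial>lborel)"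
    proof (cases "x \<in> B \<and> x + h \<in> B")
      case True
      have "x + t *\<^sub>R h \<in> B" if "0 \<le> t" "t \<le> 1" for t
        using convexD_alt[OF B(1), of x "x + h" t] True that by (simp add: algebra_simps)
      then have "(\<integral>\<^sup>+t. indicator {0..1} t * (indicator B (x + t *\<^sub>R h) * ennreal (norm (D (x + t *\<^sub>R h)) * norm h)) \<partial>lborel)
        = (\<integral>\<^sup>+t. indicator {0..1} t * ennreal (norm (D (x + t *\<^sub>R h)) * norm h) \<partial>lborel)"
        by (intro nn_integral_cong) (auto simp: indicator_def)
      then show ?thesis using pt[of x] True by simp
    qed auto
  qed
  also have "\<dots> = (\<integral>\<^sup>+t. (\<integral>\<^sup>+x. indicator {0..1} t * (indicator B (x + t *\<^sub>R h) * ennreal (norm (D (x + t *\<^sub>R h)) * norm h)) \<partial>lborel) \<partial>lborel)"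
    by (rule lborel_pair.Fubini') measurable
  also have "\<dots> = (\<integral>\<^sup>+t. indicator {0..1::real} t * (ennreal (norm h) * (\<integral>\<^sup>+x. indicator B x * ennreal (norm (D x)) \<partial>lborel)) \<partial>lborel)"
  proof (rule nn_integral_cong)
    fix t :: real
    have "(\<integral>\<^sup>+x. indicator B (x + t *\<^sub>R h) * ennreal (norm (D (x + t *\<^sub>R h)) * norm h) \<partial>lborel)
       = (\<integral>\<^sup>+x. indicator B x * ennreal (norm (D x) * norm h) \<partial>distr lborel borel ((+) (t *\<^sub>R h)))"
      by (subst nn_integral_distr) (auto simp: add.commute)
    also have "\<dots> = (\<integral>\<^sup>+x. ennreal (norm h) * (indicator B x * ennreal (norm (D x))) \<partial>lborel)"
      unfolding lborel_distr_plus by (intro nn_integral_cong) (simp add: ennreal_mult' mult_ac)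
    also have "\<dots> = ennreal (norm h) * (\<integral>\<^sup>+x. indicator B x * ennreal (norm (D x)) \<partial>lborel)"
      by (rule nn_integral_cmult) measurable
    finally show "(\<integral>\<^sup>+x. indicator {0..1} t * (indicator B (x + t *\<^sub>R h) * ennreal (norm (D (x + t *\<^sub>R h)) * norm h)) \<partial>lborel)
      = indicator {0..1} t * (ennreal (norm h) * (\<integral>\<^sup>+x. indicator B x * ennreal (norm (D x)) \<partial>lborel))"
      by (subst nn_integral_cmult) (auto intro!: measurable_compose[OF _ borel_measurable_indicator])
  qed
  also have "\<dots> = ennreal (norm h) * (\<integral>\<^sup>+x. indicator B x * ennreal (norm (D x)) \<partial>lborel)"
    by (subst nn_integral_multc) auto
  finally show ?thesis .
qed

lemma nn_integral_shift_lborel: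
  fixes f :: "'a::euclidean_space \<Rightarrow> ennreal"
  assumes [measurable]: "f \<in> borel_measurable borel"
  shows "(\<integral>\<^sup>+x. f (c + x) \<partial>lborel) = (\<integral>\<^sup>+x. f x \<partial>lborel)"
  by (subst (2) lborel_distr_plus[of c, symmetric], subst nn_integral_distr) auto

text \<open>For every \<open>x\<close>, at least half of the \<open>h\<close> in a ball of volume \<open>2 V\<close> satisfy \<open>x + h \<notin> E\<close>, that is
  \<open>\<psi> (x + h) = 0\<close>.\<close>

lemma faber_krahn_L1:
  fixes \<psi> d :: "'a::euclidean_space \<Rightarrow> real"
  assumes [measurable]: "\<psi> \<in> borel_measurable borel" "E \<in> sets borel"
    and nn: "\<And>x. 0 \<le> \<psi> x" and supp: "\<And>x. x \<notin> E \<Longrightarrow> \<psi> x = 0"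
    and V: "emeasure lborel E = ennreal V" "V \<ge> 0"
    and T: "\<And>h. (\<integral>\<^sup>+x. ennreal \<bar>\<psi> (x + h) - \<psi> x\<bar> \<partial>lborel) \<le> ennreal (norm h) * I"
  shows "(\<integral>\<^sup>+x. ennreal (\<psi> x) \<partial>lborel)
    \<le> ennreal (2 * (2 * V / unit_ball_vol (real DIM('a))) powr (1 / real DIM('a))) * I"
proof (cases "V = 0")
  case True
  then have "E \<in> null_sets lborel" using V by (simp add: null_setsI)
  then have "AE x in lborel. ennreal (\<psi> x) = 0"
    by (rule AE_mp[OF AE_not_in]) (use supp in auto)
  then have "(\<integral>\<^sup>+x. ennreal (\<psi> x) \<partial>lborel) = 0" by (subst nn_integral_0_iff_AE) auto
  then show ?thesis by simp
next
  case False
  with V have Vp: "V > 0" by simp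
  have [measurable]: "ball c r \<in> sets borel" for c :: 'a and r by simp
  define \<omega> where "\<omega> = unit_ball_vol (real DIM('a))"
  have \<omega>: "\<omega> > 0" by (simp add: \<omega>_def)
  define \<rho> where "\<rho> = (2 * V / \<omega>) powr (1 / real DIM('a))"
  have \<rho>: "\<rho> > 0" using Vp \<omega> by (simp add: \<rho>_def)
  have "\<rho> ^ DIM('a) = 2 * V / \<omega>"
    using \<rho> Vp \<omega> by (simp add: \<rho>_def powr_powr flip: powr_realpow)
  then have ball: "emeasure lborel (ball (0::'a) \<rho>) = ennreal (2 * V)"
    using \<rho> \<omega> by (simp add: emeasure_ball flip: \<omega>_def)
  have "ennreal V * (\<integral>\<^sup>+x. ennreal (\<psi> x) \<partial>lborel) = (\<integral>\<^sup>+x. ennreal V * ennreal (\<psi> x) \<partial>lborel)"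
    by (simp add: nn_integral_cmult)
  also have "\<dots> \<le> (\<integral>\<^sup>+x. (\<integral>\<^sup>+h. indicator (ball 0 \<rho>) h * ennreal \<bar>\<psi> (x + h) - \<psi> x\<bar> \<partial>lborel) \<partial>lborel)"
  proof (rule nn_integral_mono)
    fix x
    define S where "S = {h. x + h \<in> E}"
    have [measurable]: "S \<in> sets borel" unfolding S_def by measurable
    have "emeasure lborel S = (\<integral>\<^sup>+h. indicator E (x + h) \<partial>lborel)"
      using nn_integral_indicator[of S lborel] by (simp add: S_def indicator_def)
    also have "\<dots> = ennreal V" using V nn_integral_shift_lborel[of "indicator E" x] by simp
    finally have S: "emeasure lborel S = ennreal V" .
    have "emeasure lborel (ball (0::'a) \<rho>) \<le> emeasure lborel (S \<union> (ball 0 \<rho> - S))"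
      by (rule emeasure_mono) auto
    also have "\<dots> \<le> emeasure lborel S + emeasure lborel (ball 0 \<rho> - S)"
      by (rule emeasure_subadditive) auto
    finally have "ennreal V + ennreal V \<le> ennreal V + emeasure lborel (ball 0 \<rho> - S)"
      unfolding S ball using Vp by (simp flip: ennreal_plus)
    then have le: "ennreal V \<le> emeasure lborel (ball 0 \<rho> - S)"
      by (simp add: ennreal_add_left_cancel_le)
    have "ennreal V * ennreal (\<psi> x) \<le> emeasure lborel (ball 0 \<rho> - S) * ennreal (\<psi> x)"
      by (rule mult_right_mono[OF le]) simp
    also have "\<dots> = (\<integral>\<^sup>+h. ennreal (\<psi> x) * indicator (ball 0 \<rho> - S) h \<partial>lborel)"
      by (subst nn_integral_cmult_indicator) (auto simp: mult.commute)
    also have "\<dots> \<le> (\<integral>\<^sup>+h. indicator (ball 0 \<rho>) h * ennreal \<bar>\<psi> (x + h) - \<psi> x\<bar> \<partial>lborel)"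
      using nn[of x] supp by (intro nn_integral_mono) (auto simp: indicator_def S_def)
    finally show "ennreal V * ennreal (\<psi> x) \<le> (\<integral>\<^sup>+h. indicator (ball 0 \<rho>) h * ennreal \<bar>\<psi> (x + h) - \<psi> x\<bar> \<partial>lborel)" .
  qed
  also have "\<dots> = (\<integral>\<^sup>+h. (\<integral>\<^sup>+x. indicator (ball 0 \<rho>) h * ennreal \<bar>\<psi> (x + h) - \<psi> x\<bar> \<partial>lborel) \<partial>lborel)"
    by (rule lborel_pair.Fubini') measurable
  also have "\<dots> \<le> (\<integral>\<^sup>+h. (ennreal \<rho> * I) * indicator (ball (0::'a) \<rho>) h \<partial>lborel)"
  proof (rule nn_integral_mono)
    fix h :: 'a
    have "(\<integral>\<^sup>+x. indicator (ball 0 \<rho>) h * ennreal \<bar>\<psi> (x + h) - \<psi> x\<bar> \<partial>lborel)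
       = indicator (ball 0 \<rho>) h * (\<integral>\<^sup>+x. ennreal \<bar>\<psi> (x + h) - \<psi> x\<bar> \<partial>lborel)"
      by (rule nn_integral_cmult) measurable
    also have "\<dots> \<le> indicator (ball 0 \<rho>) h * (ennreal (norm h) * I)"
      by (rule mult_left_mono[OF T]) simp
    also have "\<dots> \<le> (ennreal \<rho> * I) * indicator (ball 0 \<rho>) h"
      by (auto simp: indicator_def intro!: mult_right_mono ennreal_leI)
    finally show "(\<integral>\<^sup>+x. indicator (ball 0 \<rho>) h * ennreal \<bar>\<psi> (x + h) - \<psi> x\<bar> \<partial>lborel)
       \<le> (ennreal \<rho> * I) * indicator (ball 0 \<rho>) h" .
  qed
  also have "\<dots> = (ennreal \<rho> * I) * ennreal (2 * V)"
    by (subst nn_integral_cmult_indicator) (auto simp: ball)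
  also have "\<dots> = ennreal V * (ennreal (2 * \<rho>) * I)"
  proof -
    have "ennreal \<rho> * ennreal (2 * V) = ennreal V * ennreal (2 * \<rho>)"
      using Vp \<rho> by (simp flip: ennreal_mult' add: mult_ac)
    then show ?thesis by (metis mult.assoc mult.commute)
  qed
  finally have "ennreal V * (\<integral>\<^sup>+x. ennreal (\<psi> x) \<partial>lborel) \<le> ennreal V * (ennreal (2 * \<rho>) * I)" .
  then show ?thesis using Vp by (simp add: ennreal_mult_le_mult_iff \<rho>_def \<omega>_def)
qed

text \<open>For \<open>z\<close> in \<open>Z\<close> one has \<open>f x = |f x - f z|\<close>.
  Integrating over \<open>z = x + h\<close> turns \<open>f\<close> into its first differences, and
  two points of the ball differ by less than \<open>2 * r\<close>, so only such shifts
  occur.\<close>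

lemma poincare_L1:
  fixes f :: "'a::euclidean_space \<Rightarrow> real"
  assumes [measurable]: "f \<in> borel_measurable borel" "Z \<in> sets borel"
    and nn: "\<And>x. 0 \<le> f x" and Z: "Z \<subseteq> ball x0 r" "\<And>x. x \<in> Z \<Longrightarrow> f x = 0"
    and T: "\<And>h. (\<integral>\<^sup>+x. indicator (ball x0 r) x * indicator (ball x0 r) (x + h) * ennreal \<bar>f (x + h) - f x\<bar> \<partial>lborel)
      \<le> ennreal (norm h) * I"
  shows "emeasure lborel Z * (\<integral>\<^sup>+x. indicator (ball x0 r) x * ennreal (f x) \<partial>lborel)
    \<le> emeasure lborel (ball (0::'a) (2 * r)) * (ennreal (2 * r) * I)"
proof -
  have [measurable]: "ball c r \<in> sets borel" for c :: 'a and r by simp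
  let ?B = "ball x0 r" and ?D = "ball (0::'a) (2 * r)"
  have "emeasure lborel Z * (\<integral>\<^sup>+x. indicator ?B x * ennreal (f x) \<partial>lborel)
    = (\<integral>\<^sup>+x. emeasure lborel Z * (indicator ?B x * ennreal (f x)) \<partial>lborel)"
    by (rule nn_integral_cmult[symmetric]) auto
  also have "\<dots> \<le> (\<integral>\<^sup>+x. (\<integral>\<^sup>+h. indicator ?D h * (indicator ?B x * indicator ?B (x + h) * ennreal \<bar>f (x + h) - f x\<bar>) \<partial>lborel) \<partial>lborel)"
  proof (rule nn_integral_mono)
    fix x
    have "emeasure lborel Z * (indicator ?B x * ennreal (f x)) = (\<integral>\<^sup>+h. indicator Z (x + h) \<partial>lborel) * (indicator ?B x * ennreal (f x))"
      using nn_integral_shift_lborel[of "indicator Z" x] by simp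
    also have "\<dots> = (\<integral>\<^sup>+h. indicator Z (x + h) * (indicator ?B x * ennreal (f x)) \<partial>lborel)"
      by (rule nn_integral_multc[symmetric]) measurable
    also have "\<dots> \<le> (\<integral>\<^sup>+h. indicator ?D h * (indicator ?B x * indicator ?B (x + h) * ennreal \<bar>f (x + h) - f x\<bar>) \<partial>lborel)"
    proof (rule nn_integral_mono)
      fix h
      show "indicator Z (x + h) * (indicator ?B x * ennreal (f x))
        \<le> indicator ?D h * (indicator ?B x * indicator ?B (x + h) * ennreal \<bar>f (x + h) - f x\<bar>)"
      proof (cases "x + h \<in> Z \<and> x \<in> ?B")
        case True
        then have "x + h \<in> ?B" using Z by auto
        with True have "dist x0 (x + h) < r" "dist x0 x < r" by auto
        then have "h \<in> ?D" using dist_triangle_half_r[of x0 x "2 * r" "x + h"] by (auto simp: dist_norm norm_minus_commute)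
        then show ?thesis using True \<open>x + h \<in> ?B\<close> Z(2)[of "x + h"] nn[of x] by simp
      qed auto
    qed
    finally show "emeasure lborel Z * (indicator ?B x * ennreal (f x))
      \<le> (\<integral>\<^sup>+h. indicator ?D h * (indicator ?B x * indicator ?B (x + h) * ennreal \<bar>f (x + h) - f x\<bar>) \<partial>lborel)" .
  qed
  also have "\<dots> = (\<integral>\<^sup>+h. (\<integral>\<^sup>+x. indicator ?D h * (indicator ?B x * indicator ?B (x + h) * ennreal \<bar>f (x + h) - f x\<bar>) \<partial>lborel) \<partial>lborel)"
    by (rule lborel_pair.Fubini') measurable
  also have "\<dots> \<le> (\<integral>\<^sup>+h. (ennreal (2 * r) * I) * indicator ?D h \<partial>lborel)"
  proof (rule nn_integral_mono)
    fix h :: 'a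
    have "(\<integral>\<^sup>+x. indicator ?D h * (indicator ?B x * indicator ?B (x + h) * ennreal \<bar>f (x + h) - f x\<bar>) \<partial>lborel)
       = indicator ?D h * (\<integral>\<^sup>+x. indicator ?B x * indicator ?B (x + h) * ennreal \<bar>f (x + h) - f x\<bar> \<partial>lborel)"
      by (rule nn_integral_cmult) measurable
    also have "\<dots> \<le> indicator ?D h * (ennreal (norm h) * I)"
      by (rule mult_left_mono[OF T]) simp
    also have "\<dots> \<le> (ennreal (2 * r) * I) * indicator ?D h"
      by (auto simp: indicator_def intro!: mult_right_mono ennreal_leI)
    finally show "(\<integral>\<^sup>+x. indicator ?D h * (indicator ?B x * indicator ?B (x + h) * ennreal \<bar>f (x + h) - f x\<bar>) \<partial>lborel)
       \<le> (ennreal (2 * r) * I) * indicator ?D h" .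
  qed
  also have "\<dots> = emeasure lborel ?D * (ennreal (2 * r) * I)"
    by (subst nn_integral_cmult_indicator) (auto simp: mult.commute)
  finally show ?thesis .
qed

subsection \<open>De Giorgi iteration\<close>

text \<open>The superlinear power beats the geometric factor. The bound
  \<open>y j \<le> y 0 * b powr (- j / a)\<close> reproduces itself: its extra power
  \<open>a\<close> yields \<open>b powr (- j)\<close>, cancelling \<open>b powr j\<close>, and the
  remaining factor \<open>C * y 0 powr a\<close> is at most \<open>b powr (- 1 / a)\<close> by the
  smallness of \<open>y 0\<close>.\<close>

lemma fast_geometric_convergence:
  fixes y :: "nat \<Rightarrow> real"
  assumes nn: "\<And>j. 0 \<le> y j" and C: "C > 0" and b: "b > 1" and a: "a > 0"
    and step: "\<And>j. y (Suc j) \<le> C * b powr real j * y j powr (1 + a)"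
    and y0: "y 0 \<le> C powr (- 1 / a) * b powr (- 1 / a\<^sup>2)"
  shows "y \<longlonglongrightarrow> 0"
proof -
  have c0: "C * y 0 powr a \<le> b powr (- 1 / a)"
  proof -
    have "y 0 powr a \<le> (C powr (- 1 / a) * b powr (- 1 / a\<^sup>2)) powr a"
      using y0 nn a by (intro powr_mono2) auto
    also have "\<dots> = C powr - 1 * b powr (- 1 / a)"
      using C b a by (simp add: powr_mult powr_powr power2_eq_square)
    finally have "C * y 0 powr a \<le> C * (C powr - 1 * b powr (- 1 / a))" using C by (intro mult_left_mono) auto
    also have "\<dots> = b powr (- 1 / a)" using C by (simp add: powr_minus)
    finally show ?thesis .
  qed
  have bound: "y j \<le> y 0 * b powr (- real j / a)" for j
  proof (induction j)
    case 0
    then show ?case using b by simp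
  next
    case (Suc j)
    have "y (Suc j) \<le> C * b powr real j * y j powr (1 + a)" by (rule step)
    also have "\<dots> \<le> C * b powr real j * (y 0 * b powr (- real j / a)) powr (1 + a)"
      using Suc nn a C by (intro mult_left_mono powr_mono2) auto
    also have "\<dots> = C * b powr real j * (y 0 * y 0 powr a * (b powr (- real j / a) * b powr (- real j)))"
    proof -
      have "(y 0 * b powr (- real j / a)) powr (1 + a) = y 0 powr (1 + a) * b powr (- real j / a * (1 + a))"
        using nn by (simp add: powr_mult powr_powr)
      moreover have "- real j / a * (1 + a) = - real j / a + - real j" using a by (simp add: field_simps)
      moreover have "y 0 powr (1 + a) = y 0 * y 0 powr a" using nn[of 0] a
        by (cases "y 0 = 0") (auto simp: powr_add)
      moreover have "b powr (- real j / a + - real j) = b powr (- real j / a) * b powr (- real j)"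
        by (rule powr_add)
      ultimately show ?thesis by (simp only:)
    qed
    also have "\<dots> = (C * y 0 powr a) * (y 0 * b powr (- real j / a)) * (b powr real j * b powr (- real j))"
      by (simp only: ac_simps)
    also have "b powr real j * b powr (- real j) = 1" using b by (simp add: powr_minus)
    also have "(C * y 0 powr a) * (y 0 * b powr (- real j / a)) * 1 \<le> b powr (- 1 / a) * (y 0 * b powr (- real j / a))"
      using mult_right_mono[OF c0, of "y 0 * b powr (- real j / a)"] nn by simp
    also have "\<dots> = y 0 * b powr (- real (Suc j) / a)"
    proof -
      have "- real (Suc j) / a = - 1 / a + - real j / a" using a by (simp add: field_simps)
      then have "b powr (- real (Suc j) / a) = b powr (- 1 / a) * b powr (- real j / a)" by (simp only: powr_add)
      then show ?thesis by simp
    qed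
    finally show ?case .
  qed
  have eq: "b powr (- real j / a) = (b powr (- 1 / a)) ^ j" for j
    using b by (simp add: powr_powr flip: powr_realpow)
  have "b powr (- 1 / a) < 1" using b a by (simp add: powr_less_one)
  then have "(\<lambda>j. y 0 * (b powr (- 1 / a)) ^ j) \<longlonglongrightarrow> y 0 * 0"
    by (intro tendsto_mult tendsto_const LIMSEQ_realpow_zero) auto
  then show ?thesis
    by (intro tendsto_sandwich[OF _ _ tendsto_const, of _ y _ "\<lambda>j. y 0 * (b powr (- 1 / a)) ^ j"])
      (use nn bound eq in auto)
qed

text \<open>A De Giorgi class phrased in \<open>L1\<close>. The level gap \<open>\<delta>\<close>
  leaves room for a C1 substitute of the positive part, the power \<open>1 / DIM('a)\<close> of the
  measure comes from \<open>faber_krahn_L1\<close>, and the term \<open>measure / r\<close> is the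
  price of bounding the \<open>L1\<close> norm of a gradient by its energy.\<close>

definition dg_ineq :: "real \<Rightarrow> real \<Rightarrow> 'a::euclidean_space \<Rightarrow> real \<Rightarrow> real \<Rightarrow> ('a \<Rightarrow> real) \<Rightarrow> bool" where
  "dg_ineq C q x0 r k0 f \<longleftrightarrow> (\<forall>k \<delta> \<rho> \<sigma>. k0 \<le> k \<and> 0 < \<delta> \<and> r / 2 \<le> \<rho> \<and> \<rho> < \<sigma> \<and> \<sigma> \<le> r \<longrightarrow>
     (\<integral>x. indicator (ball x0 \<rho>) x * max 0 (f x - k - \<delta>) \<partial>lborel) \<le>
       C * measure lborel {x \<in> ball x0 \<sigma>. k < f x} powr (1 / real DIM('a)) *
       (r powr (q - 1) * (\<sigma> - \<rho>) powr (- q) * (\<integral>x. indicator (ball x0 \<sigma>) x * max 0 (f x - k) \<partial>lborel)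
         + measure lborel {x \<in> ball x0 \<sigma>. k < f x} / r))"

lemma integrable_on_ball:
  fixes f :: "'a::euclidean_space \<Rightarrow> real"
  assumes [measurable]: "f \<in> borel_measurable borel" and b: "\<And>x. \<bar>f x\<bar> \<le> Mb"
  shows "integrable lborel (\<lambda>x. indicator (ball x0 r) x * f x)"
proof -
  have [measurable]: "ball x0 r \<in> sets borel" by simp
  have "integrable lborel (\<lambda>x. Mb * indicator (ball x0 r) x)"
    by (intro integrable_mult_right integrable_real_indicator) (use emeasure_lborel_ball_finite[of x0 r] in auto)
  then show ?thesis
    by (rule Bochner_Integration.integrable_bound)
      (auto simp: indicator_def intro!: b[THEN order_trans])
qed

text \<open>Levels rise to \<open>k0 + K\<close> while radii shrink to \<open>r / 2\<close>. The
  excess \<open>Y j\<close>, divided by \<open>K * r powr N\<close>, obeys a recursion with exponent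
  \<open>1 + 1 / N\<close>, so a small start forces it to 0. The threshold \<open>\<nu>\<close>
  depends on \<open>q\<close>, \<open>C\<close> and the dimension, not on the bound
  \<open>Mb\<close>, which serves integrability.\<close>

lemma de_giorgi_bounded:
  fixes q C :: real
  assumes q: "q > 1" and C: "C > 0"
  shows "\<exists>\<nu>>0. \<forall>(x0::'a::euclidean_space) r f k0 K Mb. r > 0 \<and> K \<ge> 1 \<and> f \<in> borel_measurable borel \<and>
     (\<forall>x. \<bar>f x\<bar> \<le> Mb) \<and> dg_ineq C q x0 r k0 f \<and>
     (\<integral>x. indicator (ball x0 r) x * max 0 (f x - k0) \<partial>lborel) \<le> \<nu> * K * r ^ DIM('a) \<longrightarrow>
     (AE x in lborel. x \<in> ball x0 (r / 2) \<longrightarrow> f x \<le> k0 + K)"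
proof -
  define N where "N = real DIM('a)"
  have N: "N \<ge> 1" by (simp add: N_def DIM_positive Suc_le_eq)
  define C1 where "C1 = C * 2 * 4 powr (q + 1)"
  define b where "b = (2::real) powr (q + 1)"
  have C1: "C1 > 0" and b: "b > 1" using C q by (auto simp: C1_def b_def)
  define \<nu> where "\<nu> = C1 powr (- 1 / (1 / N)) * b powr (- 1 / (1 / N)\<^sup>2)"
  have \<nu>: "\<nu> > 0" using C1 b by (simp add: \<nu>_def)
  have "AE x in lborel. x \<in> ball x0 (r / 2) \<longrightarrow> f x \<le> k0 + K"
    if r: "r > 0" and K: "K \<ge> 1" and fm [measurable]: "f \<in> borel_measurable borel" and Mb: "\<And>x. \<bar>f x\<bar> \<le> Mb"
      and dg: "dg_ineq C q x0 r k0 f"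
      and init: "(\<integral>x. indicator (ball x0 r) x * max 0 (f x - k0) \<partial>lborel) \<le> \<nu> * K * r ^ DIM('a)"
    for x0 :: 'a and r f k0 K Mb
  proof -
    have [measurable]: "ball x0 s \<in> sets borel" for s by simp
    define \<kappa> where "\<kappa> j = k0 + K * (1 - (1/2) ^ j)" for j
    define R where "R j = r / 2 * (1 + (1/2) ^ j)" for j :: nat
    define Y where "Y j = (\<integral>x. indicator (ball x0 (R j)) x * max 0 (f x - \<kappa> j) \<partial>lborel)" for j
    have int: "integrable lborel (\<lambda>x. indicator (ball x0 s) x * max 0 (f x - c))" for s c
    proof (rule integrable_on_ball)
      show "\<bar>max 0 (f x - c)\<bar> \<le> Mb + \<bar>c\<bar>" for x using Mb[of x] by linarith
    qed measurable
    have Y0: "Y j \<ge> 0" for j unfolding Y_def by (rule Bochner_Integration.integral_nonneg) auto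
    define y where "y j = Y j / (K * r powr N)" for j
    have rN: "r powr N = r ^ DIM('a)" using r by (simp add: N_def powr_realpow)
    have y0: "y j \<ge> 0" for j unfolding y_def using Y0 K r by simp
    have step: "y (Suc j) \<le> C1 * b powr real j * y j powr (1 + 1 / N)" for j
    proof -
      \<comment> \<open>The step from \<open>\<kappa> j\<close> to \<open>\<kappa> (Suc j)\<close>
        is \<open>g\<close>. Its first half pays, by Chebyshev's inequality, for the measure of the
        superlevel set; its second half is the gap \<open>\<delta>\<close> of
        \<open>dg_ineq\<close>.\<close>
      define g where "g = K * (1/2) ^ (j + 1)"
      define k where "k = \<kappa> j + g / 2"
      define m where "m = measure lborel {x \<in> ball x0 (R j). k < f x}"
      define t where "t = (2::real) powr (real j + 2)"
      have t: "t > 0" "t \<ge> 4"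
      proof -
        have "(2::real) powr 2 \<le> 2 powr (real j + 2)" by (intro powr_mono) auto
        then show "t \<ge> 4" by (simp add: t_def)
      qed (simp add: t_def)
      have t': "t = 2 ^ (j + 2)" unfolding t_def by (simp flip: powr_realpow add: powr_add)
      have g: "g > 0" "g / 2 = K / t" using K by (auto simp: g_def t' field_simps)
      have kp: "k + g / 2 = \<kappa> (Suc j)" by (simp add: k_def \<kappa>_def g_def algebra_simps)
      have k0k: "k0 \<le> k"
      proof -
        have "(1/2::real) ^ j \<le> 1" by (simp add: power_le_one)
        then have "0 \<le> K * (1 - (1/2) ^ j)" using K by (intro mult_nonneg_nonneg) auto
        then show ?thesis using g(1) unfolding k_def \<kappa>_def by linarith
      qed
      have Rd: "R j - R (Suc j) = r / t" by (simp add: R_def t' field_simps)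
      have "R (Suc j) < R j" using Rd r t by (smt (verit) divide_pos_pos)
      have Rle: "R j \<le> r" using r power_le_one[of "1/2::real" j] by (simp add: R_def)
      have Rge: "r / 2 \<le> R (Suc j)" using r by (simp add: R_def)
      have "m * (g / 2) = (\<integral>x. (g / 2) * indicator {x \<in> ball x0 (R j). k < f x} x \<partial>lborel)"
        by (simp add: m_def)
      also have "\<dots> \<le> Y j"
        unfolding Y_def
      proof (rule integral_mono[OF _ int])
        have "emeasure lborel {x \<in> ball x0 (R j). k < f x} \<le> emeasure lborel (ball x0 (R j))"
          by (rule emeasure_mono) auto
        then have "emeasure lborel {x \<in> ball x0 (R j). k < f x} < \<infinity>"
          using emeasure_lborel_ball_finite by (rule le_less_trans)
        then show "integrable lborel (\<lambda>x. g / 2 * indicator {x \<in> ball x0 (R j). k < f x} x)"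
          by (intro integrable_mult_right) (auto intro!: integrable_real_indicator)
      qed (use g in \<open>auto simp: indicator_def k_def\<close>)
      finally have mY: "m \<le> Y j * t / K" using g K t by (simp add: field_simps)
      have m0: "m \<ge> 0" by (simp add: m_def)
      have Yk: "(\<integral>x. indicator (ball x0 (R j)) x * max 0 (f x - k) \<partial>lborel) \<le> Y j"
        unfolding Y_def by (rule integral_mono[OF int int]) (use g in \<open>auto simp: indicator_def k_def\<close>)
      have "Y (Suc j) = (\<integral>x. indicator (ball x0 (R (Suc j))) x * max 0 (f x - k - g / 2) \<partial>lborel)"
        unfolding Y_def kp[symmetric] by (simp add: algebra_simps)
      also have "\<dots> \<le> C * m powr (1 / N) * (r powr (q - 1) * (r / t) powr (- q) *
          (\<integral>x. indicator (ball x0 (R j)) x * max 0 (f x - k) \<partial>lborel) + m / r)"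
        using dg[unfolded dg_ineq_def, rule_format, of k "g / 2" "R (Suc j)" "R j"] k0k g Rge Rle \<open>R (Suc j) < R j\<close>
        unfolding Rd m_def N_def by simp
      also have "\<dots> \<le> C * (Y j * t / K) powr (1 / N) * (r powr (q - 1) * (r / t) powr (- q) * Y j + (Y j * t / K) / r)"
        using C m0 mY r Yk N by (intro mult_mono add_mono powr_mono2 divide_right_mono mult_left_mono order_refl)
          (auto intro!: Bochner_Integration.integral_nonneg add_nonneg_nonneg)
      also have "\<dots> \<le> C * (Y j / K) powr (1 / N) * t powr (1 / N) * (Y j / r * (t powr q + t))"
      proof -
        have "(Y j * t / K) powr (1 / N) = (Y j / K) powr (1 / N) * t powr (1 / N)"
          using Y0[of j] K t by (simp flip: powr_mult)
        moreover have "r powr (q - 1) * (r / t) powr (- q) = t powr q / r"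
          using r t by (simp add: powr_divide powr_minus powr_diff field_simps)
        \<comment> \<open>The term coming from \<open>m / r\<close> carries an extra factor
          \<open>1 / K\<close>; discarding it uses \<open>K \<ge> 1\<close>.\<close>
        moreover have "Y j * t / K / r \<le> Y j * t / r"
          using Y0[of j] K t r mult_right_mono[OF K Y0[of j]]
          by (intro divide_right_mono) (auto simp: field_simps)
        ultimately have in_le: "r powr (q - 1) * (r / t) powr (- q) * Y j + (Y j * t / K) / r \<le> Y j / r * (t powr q + t)"
          and eq: "(Y j * t / K) powr (1 / N) = (Y j / K) powr (1 / N) * t powr (1 / N)"
          by (simp_all add: algebra_simps)
        have "C * (Y j * t / K) powr (1 / N) * (r powr (q - 1) * (r / t) powr (- q) * Y j + (Y j * t / K) / r)
           \<le> C * (Y j * t / K) powr (1 / N) * (Y j / r * (t powr q + t))"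
          using C by (intro mult_left_mono[OF in_le]) auto
        then show ?thesis unfolding eq by (simp add: mult.assoc)
      qed
      also have "\<dots> \<le> C * (Y j / K) powr (1 / N) * t * (Y j / r * (2 * t powr q))"
      proof -
        have "t powr (1 / N) \<le> t powr 1" using t N by (intro powr_mono) (auto simp: field_simps)
        moreover have "t powr 1 \<le> t powr q" using t q by (intro powr_mono) auto
        ultimately show ?thesis using t Y0[of j] r C
          by (intro mult_mono mult_left_mono) (auto intro!: divide_nonneg_nonneg mult_nonneg_nonneg)
      qed
      finally have 1: "Y (Suc j) \<le> C * (Y j / K) powr (1 / N) * t * (Y j / r * (2 * t powr q))" .
      have Yy: "Y i = y i * K * r powr N" for i using K r by (simp add: y_def)
      have "(Y j / K) powr (1 / N) = y j powr (1 / N) * r"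
        using y0[of j] K r N by (simp add: Yy powr_mult powr_powr)
      then have "Y (Suc j) \<le> C * (y j powr (1 / N) * r) * t * (Y j / r * (2 * t powr q))"
        using 1 by simp
      also have "\<dots> = C * 2 * (t * t powr q) * y j powr (1 / N) * Y j" using r by simp
      also have "t * t powr q = 4 powr (q + 1) * b powr real j"
      proof -
        have "t * t powr q = t powr (q + 1)" using t by (simp add: powr_add)
        also have "\<dots> = 2 powr (2 * (q + 1)) * 2 powr (real j * (q + 1))"
          by (simp add: t_def powr_powr algebra_simps flip: powr_add)
        also have "2 powr (2 * (q + 1)) = (4::real) powr (q + 1)"
          using powr_powr[of "2::real" 2 "q + 1"] by simp
        finally show ?thesis by (simp add: b_def powr_powr mult.commute)
      qed
      finally have "Y (Suc j) \<le> C1 * b powr real j * y j powr (1 / N) * (y j * K * r powr N)"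
        by (simp add: C1_def Yy[of j] algebra_simps)
      then have "y (Suc j) \<le> C1 * b powr real j * y j powr (1 / N) * (y j * K * r powr N) / (K * r powr N)"
        unfolding y_def[of "Suc j"] using K r by (intro divide_right_mono) auto
      also have "\<dots> = C1 * b powr real j * (y j * y j powr (1 / N))" using K r by simp
      also have "y j * y j powr (1 / N) = y j powr (1 + 1 / N)"
        using y0[of j] N by (cases "y j = 0") (auto simp: powr_add)
      finally show ?thesis .
    qed
    have "y 0 \<le> \<nu>"
    proof -
      have "Y 0 \<le> \<nu> * K * r powr N" using init unfolding Y_def R_def \<kappa>_def rN by simp
      then show ?thesis using K r by (simp add: y_def field_simps)
    qed
    then have "y \<longlonglongrightarrow> 0"
      unfolding \<nu>_def by (intro fast_geometric_convergence[OF y0 C1 b _ step]) (use N in auto)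
    then have "(\<lambda>j. y j * (K * r powr N)) \<longlonglongrightarrow> 0 * (K * r powr N)" by (intro tendsto_mult tendsto_const)
    then have Ylim: "Y \<longlonglongrightarrow> 0" using K r by (simp add: y_def)
    define Z where "Z = (\<integral>x. indicator (ball x0 (r / 2)) x * max 0 (f x - (k0 + K)) \<partial>lborel)"
    have "Z \<le> Y j" for j
      unfolding Z_def Y_def
    proof (rule integral_mono[OF int int])
      fix x
      have "\<kappa> j \<le> k0 + K" "r / 2 \<le> R j" using K r by (auto simp: \<kappa>_def R_def)
      then show "indicator (ball x0 (r / 2)) x * max 0 (f x - (k0 + K)) \<le> indicator (ball x0 (R j)) x * max 0 (f x - \<kappa> j)"
        by (auto simp: indicator_def)
    qed
    then have "Z \<le> 0" using LIMSEQ_le_const[OF Ylim] by blast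
    moreover have "Z \<ge> 0" unfolding Z_def by (rule Bochner_Integration.integral_nonneg) auto
    ultimately have "Z = 0" by simp
    then have "AE x in lborel. indicator (ball x0 (r / 2)) x * max 0 (f x - (k0 + K)) = 0"
      unfolding Z_def by (subst (asm) integral_nonneg_eq_0_iff_AE[OF int]) auto
    then show ?thesis by eventually_elim (auto simp: indicator_def split: if_splits)
  qed
  then show ?thesis using \<nu> by blast
qed

subsection \<open>Weak solutions\<close>

text \<open>Test functions are closed under composition with polynomials vanishing at 0, so a nonlinear
  function of the approximating test functions enters the weak equation through polynomials.\<close>

lemma C1_polynomial_approx:
  fixes K k :: "real \<Rightarrow> real"
  assumes K: "\<And>t. (K has_real_derivative k t) (at t)" and k: "continuous_on UNIV k" and e: "e > 0"
  shows "\<exists>P p. (\<forall>t. (P has_real_derivative p t) (at t)) \<and> P 0 = K 0 \<and> continuous_on UNIV p \<and>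
    (\<forall>t. \<bar>t\<bar> \<le> R \<longrightarrow> \<bar>p t - k t\<bar> \<le> e \<and> \<bar>P t - K t\<bar> \<le> e * \<bar>t\<bar>) \<and>
    (\<forall>f::'a::euclidean_space \<Rightarrow> real. smooth_fun f \<longrightarrow> smooth_fun (\<lambda>x. P (f x)))"
proof -
  obtain g where g: "real_polynomial_function g" "\<And>x. x \<in> {-R..R} \<Longrightarrow> \<bar>k x - g x\<bar> < e"
    using Stone_Weierstrass_real_polynomial_function[of "{-R..R}" k e] continuous_on_subset[OF k] e
    by (metis compact_Icc subset_UNIV)
  obtain a n where g_eq: "g = (\<lambda>x. \<Sum>i\<le>n. a i * x ^ i)"
    using g(1) real_polynomial_function_iff_sum by auto
  \<comment> \<open>The approximant of the derivative is integrated, so values and derivatives are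
    close simultaneously and \<open>P 0 = K 0\<close> holds exactly. The latter preserves the
    support of the composed test function.\<close>
  define P where "P t = K 0 + (\<Sum>i\<le>n. a i / real (Suc i) * t ^ Suc i)" for t
  have P: "(P has_real_derivative g t) (at t)" for t
    unfolding P_def g_eq
    by (auto intro!: derivative_eq_intros sum.cong simp del: power_Suc of_nat_Suc)
  have le: "\<bar>P t - K t\<bar> \<le> e * \<bar>t\<bar>" if "\<bar>t\<bar> \<le> R" for t
  proof -
    have "norm ((P t - K t) - (P 0 - K 0)) \<le> e * norm (t - 0)"
    proof (rule field_differentiable_bound[of "{-R..R}"])
      show "((\<lambda>t. P t - K t) has_field_derivative g z - k z) (at z within {-R..R})" for z
        using DERIV_diff[OF P K] has_field_derivative_at_within by blast
      show "norm (g z - k z) \<le> e" if "z \<in> {-R..R}" for z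
        using g(2)[OF that] by simp
    qed (use that in auto)
    then show ?thesis by (simp add: P_def)
  qed
  have cg: "continuous_on UNIV g" unfolding g_eq by (intro continuous_intros)
  have sm: "smooth_fun (\<lambda>x. P (f x))" if "smooth_fun f" for f :: "'a \<Rightarrow> real"
    unfolding P_def by (intro smooth_fun_add smooth_fun_const smooth_fun_sum smooth_fun_mult smooth_fun_power that) auto
  show ?thesis
  proof (rule exI[of _ P], rule exI[of _ g], intro conjI allI impI P le cg sm)
    show "P 0 = K 0" by (simp add: P_def)
    show "\<bar>g t - k t\<bar> \<le> e" if "\<bar>t\<bar> \<le> R" for t using g(2)[of t] that abs_minus_commute[of "g t"] by (auto simp: abs_le_iff)
  qed auto
qed

text \<open>The solution takes values in the unit interval but its approximating test functions need
  not, so \<open>K\<close> must be available on the whole line with a bounded derivative. The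
  derivative is frozen at its endpoint values and integrated.\<close>

lemma extend_C1_unit_interval:
  fixes K k :: "real \<Rightarrow> real"
  assumes K: "\<And>t. t \<in> {0..1} \<Longrightarrow> (K has_real_derivative k t) (at t within {0..1})"
    and k: "continuous_on {0..1} k"
  obtains K' k' C where "\<And>t. (K' has_real_derivative k' t) (at t)" "continuous_on UNIV k'"
    "\<And>t. \<bar>k' t\<bar> \<le> C" "\<And>t. t \<in> {0..1} \<Longrightarrow> K' t = K t" "\<And>t. t \<in> {0..1} \<Longrightarrow> k' t = k t"
proof -
  define k' where "k' t = k (max 0 (min 1 t))" for t
  have ck: "continuous_on UNIV k'" unfolding k'_def
    by (intro continuous_on_compose2[OF k] continuous_intros) auto
  have "bounded (k ` {0..1})" using k by (intro compact_imp_bounded compact_continuous_image) auto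
  then obtain C where "\<forall>t\<in>{0..1}. \<bar>k t\<bar> \<le> C" unfolding bounded_iff by auto
  then have C: "\<bar>k' t\<bar> \<le> C" for t unfolding k'_def by auto
  obtain F where F: "\<And>t. (F has_real_derivative k' t) (at t)"
    using einterval_antiderivative[of "-\<infinity>" "\<infinity>" k'] ck
    by (auto simp: continuous_on_eq_continuous_at has_real_derivative_iff_has_vector_derivative)
  define K' where "K' t = F t - F 0 + K 0" for t
  have K': "(K' has_real_derivative k' t) (at t)" for t
    unfolding K'_def by (auto intro!: derivative_eq_intros F)
  have "\<exists>c. \<forall>t\<in>{0..1::real}. K' t - K t = c"
  proof (rule has_field_derivative_zero_constant)
    fix t :: real assume t: "t \<in> {0..1}"
    show "((\<lambda>t. K' t - K t) has_field_derivative 0) (at t within {0..1})"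
      using DERIV_diff[OF has_field_derivative_at_within[OF K'] K[OF t]] t by (simp add: k'_def)
  qed auto
  then obtain c where c: "\<And>t. t \<in> {0..1} \<Longrightarrow> K' t - K t = c" by blast
  have "c = 0" using c[of 0] by (simp add: K'_def)
  show ?thesis
    by (rule that[OF K' ck C]) (use c \<open>c = 0\<close> in \<open>auto simp: k'_def\<close>)
qed

section \<open>Young's inequality and limits of integrals\<close>

lemma young_powr:
  fixes a b \<epsilon> p :: real
  assumes "a \<ge> 0" "b \<ge> 0" "\<epsilon> > 0" "p > 1"
  shows "a powr (p - 1) * b \<le> \<epsilon> * a powr p + \<epsilon> powr (1 - p) * b powr p"
\<comment> \<open>Comparing \<open>b\<close> with \<open>\<epsilon> * a\<close> gives the inequality
  directly, with constants that are not sharp: in either case one summand alone dominates.\<close>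
proof (cases "b \<le> \<epsilon> * a")
  case True
  have "a powr (p - 1) * b \<le> a powr (p - 1) * (\<epsilon> * a)" using True by (intro mult_left_mono) auto
  also have "\<dots> = \<epsilon> * a powr p" using assms by (cases "a = 0") (auto simp: powr_diff)
  also have "\<dots> \<le> \<epsilon> * a powr p + \<epsilon> powr (1 - p) * b powr p" by simp
  finally show ?thesis .
next
  case False
  have "\<epsilon> * a \<ge> 0" using assms by simp
  with False have "b > 0" by linarith
  have "a \<le> b / \<epsilon>" using False assms by (auto simp: field_simps)
  have "a powr (p - 1) * b \<le> (b / \<epsilon>) powr (p - 1) * b"
    using \<open>a \<le> b / \<epsilon>\<close> assms by (intro mult_right_mono powr_mono2) auto
  also have "\<dots> = \<epsilon> powr (1 - p) * b powr p"
    using \<open>b > 0\<close> assms by (simp add: powr_divide powr_diff)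
  also have "\<dots> \<le> \<epsilon> * a powr p + \<epsilon> powr (1 - p) * b powr p" using assms by simp
  finally show ?thesis .
qed

lemma powr_add_le:
  fixes a b p :: real
  assumes "a \<ge> 0" "b \<ge> 0" "p > 0"
  shows "(a + b) powr p \<le> 2 powr p * (a powr p + b powr p)"
proof -
  have "(a + b) powr p \<le> (2 * max a b) powr p" using assms by (intro powr_mono2) auto
  also have "\<dots> = 2 powr p * max a b powr p" using assms by (intro powr_mult)
  also have "\<dots> \<le> 2 powr p * (a powr p + b powr p)" by (intro mult_left_mono) (auto simp: max_def)
  finally show ?thesis .
qed

text \<open>This takes the place of Hoelder's inequality with exponents \<open>p / (p - 1)\<close>
  and \<open>p\<close>: Young's parameter is first fixed against the finite integral of
  \<open>f powr p\<close>, and only then is \<open>n\<close> taken large.\<close>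

lemma tendsto_nn_integral_young:
  fixes f :: "'b \<Rightarrow> real" and a :: "nat \<Rightarrow> 'b \<Rightarrow> real"
  assumes p: "p > 1" and f: "integrable M (\<lambda>x. f x powr p)" "\<And>x. 0 \<le> f x" "f \<in> borel_measurable M"
    and [measurable]: "\<And>n. a n \<in> borel_measurable M" and a: "\<And>n x. 0 \<le> a n x"
    and lim: "(\<lambda>n. \<integral>\<^sup>+x. ennreal (a n x powr p) \<partial>M) \<longlonglongrightarrow> 0"
  shows "(\<lambda>n. \<integral>\<^sup>+x. ennreal (f x powr (p - 1) * a n x) \<partial>M) \<longlonglongrightarrow> 0"
proof -
  note [measurable] = f(3)
  define F where "F = (\<integral>x. f x powr p \<partial>M)"
  have F: "F \<ge> 0" "(\<integral>\<^sup>+x. ennreal (f x powr p) \<partial>M) = ennreal F"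
    unfolding F_def by (auto intro!: Bochner_Integration.integral_nonneg nn_integral_eq_integral f)
  have bound: "(\<integral>\<^sup>+x. ennreal (f x powr (p - 1) * a n x) \<partial>M)
      \<le> ennreal (\<epsilon> * F) + ennreal (\<epsilon> powr (1 - p)) * (\<integral>\<^sup>+x. ennreal (a n x powr p) \<partial>M)" if "\<epsilon> > 0" for n \<epsilon>
  proof -
    have "(\<integral>\<^sup>+x. ennreal (f x powr (p - 1) * a n x) \<partial>M)
      \<le> (\<integral>\<^sup>+x. ennreal \<epsilon> * ennreal (f x powr p) + ennreal (\<epsilon> powr (1 - p)) * ennreal (a n x powr p) \<partial>M)"
      using that by (intro nn_integral_mono)
        (auto simp flip: ennreal_mult' ennreal_plus intro!: ennreal_leI young_powr f a p)
    also have "\<dots> = ennreal \<epsilon> * ennreal F + ennreal (\<epsilon> powr (1 - p)) * (\<integral>\<^sup>+x. ennreal (a n x powr p) \<partial>M)"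
      by (subst nn_integral_add) (auto simp: nn_integral_cmult F)
    finally show ?thesis using that by (simp add: ennreal_mult')
  qed
  show ?thesis
  proof (rule order_tendstoI)
    fix y :: ennreal assume "0 < y"
    then obtain z' where z': "0 < z'" "z' < y" using dense by blast
    then have "z' < top" using less_le_trans top_greatest by blast
    then obtain z where z_eq: "z' = ennreal z" using less_top_ennreal by blast
    have z: "z > 0" "ennreal z < y" using z' unfolding z_eq by (simp_all add: ennreal_less_zero_iff)
    define \<epsilon> where "\<epsilon> = z / (2 * (F + 1))"
    have \<epsilon>: "\<epsilon> > 0" using F z by (simp add: \<epsilon>_def)
    have \<epsilon>F: "\<epsilon> * F \<le> z / 2"
    proof -
      have "\<epsilon> * F \<le> \<epsilon> * (F + 1)" using \<epsilon> by simp
      also have "\<dots> = z / 2" using F(1) by (simp add: \<epsilon>_def field_simps)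
      finally show ?thesis .
    qed
    have "(\<lambda>n. ennreal (\<epsilon> powr (1 - p)) * (\<integral>\<^sup>+x. ennreal (a n x powr p) \<partial>M)) \<longlonglongrightarrow> ennreal (\<epsilon> powr (1 - p)) * 0"
      by (rule ennreal_tendsto_cmult[OF _ lim]) simp
    then have "\<forall>\<^sub>F n in sequentially. ennreal (\<epsilon> powr (1 - p)) * (\<integral>\<^sup>+x. ennreal (a n x powr p) \<partial>M) < ennreal (z / 2)"
      using z by (intro order_tendstoD(2)) auto
    then show "\<forall>\<^sub>F n in sequentially. (\<integral>\<^sup>+x. ennreal (f x powr (p - 1) * a n x) \<partial>M) < y"
    proof eventually_elim
      case (elim n)
      have "(\<integral>\<^sup>+x. ennreal (f x powr (p - 1) * a n x) \<partial>M) \<le> ennreal (z / 2) + ennreal (z / 2)"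
        by (rule order_trans[OF bound[OF \<epsilon>]]) (use \<epsilon>F elim in \<open>intro add_mono ennreal_leI, auto\<close>)
      also have "\<dots> = ennreal z" using z by (simp flip: ennreal_plus)
      finally show ?case using z by simp
    qed
  qed auto
qed

text \<open>The majorant varies with \<open>n\<close> and bounds the difference itself, so the
  vanishing of its integrals replaces pointwise convergence.\<close>

lemma tendsto_integral_of_dominated_diff:
  fixes F :: "'b \<Rightarrow> real"
  assumes F: "integrable M F" and [measurable]: "\<And>n. Fn n \<in> borel_measurable M"
    and H: "\<And>n. integrable M (H n)" "(\<lambda>n. \<integral>x. H n x \<partial>M) \<longlonglongrightarrow> 0"
    and le: "\<And>n x. \<bar>Fn n x - F x\<bar> \<le> H n x"
  shows "(\<lambda>n. \<integral>x. Fn n x \<partial>M) \<longlonglongrightarrow> (\<integral>x. F x \<partial>M)"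
proof -
  have [measurable]: "F \<in> borel_measurable M" using F by (rule borel_measurable_integrable)
  have d: "integrable M (\<lambda>x. Fn n x - F x)" for n
    by (rule Bochner_Integration.integrable_bound[OF H(1)[of n]]) (use le[of n] in \<open>auto intro!: AE_I2 intro: order_trans[OF _ abs_ge_self]\<close>)
  have iFn: "integrable M (Fn n)" for n using Bochner_Integration.integrable_add[OF d[of n] F] by simp
  have "\<bar>(\<integral>x. Fn n x \<partial>M) - (\<integral>x. F x \<partial>M)\<bar> \<le> (\<integral>x. H n x \<partial>M)" for n
  proof -
    have "\<bar>\<integral>x. Fn n x - F x \<partial>M\<bar> \<le> (\<integral>x. \<bar>Fn n x - F x\<bar> \<partial>M)" by (rule integral_abs_bound)
    also have "\<dots> \<le> (\<integral>x. H n x \<partial>M)" by (rule integral_mono[OF _ H(1)]) (use d le in auto)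
    finally show ?thesis by (simp add: Bochner_Integration.integral_diff[OF iFn F])
  qed
  then have "(\<lambda>n. (\<integral>x. Fn n x \<partial>M) - (\<integral>x. F x \<partial>M)) \<longlonglongrightarrow> 0"
    by (intro Lim_null_comparison[OF _ H(2)] always_eventually) auto
  then show ?thesis by (simp add: LIM_zero_iff)
qed

section \<open>Test functions and their gradients\<close>

lemma smooth_fun_measurable: "smooth_fun f \<Longrightarrow> f \<in> borel_measurable borel"
  by (intro borel_measurable_continuous_onI smooth_fun_continuous)

lemma grad_measurable: "smooth_fun f \<Longrightarrow> grad f \<in> borel_measurable borel"
  by (intro borel_measurable_continuous_onI continuous_on_grad)

lemma grad_zero_outside_support:
  assumes "x \<notin> closure {x. f x \<noteq> 0}"
  shows "grad f x = 0"
proof (rule grad_eqI)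
  have "((\<lambda>_. 0) has_derivative (\<lambda>h. 0)) (at x)" by simp
  then have "(f has_derivative (\<lambda>h. 0)) (at x)"
    by (rule has_derivative_transform_within_open[of _ _ _ _ "- closure {x. f x \<noteq> 0}"])
      (use assms closure_subset[of "{x. f x \<noteq> 0}"] in auto)
  then show "(f has_derivative (\<lambda>h. 0 \<bullet> h)) (at x)" by simp
qed

lemma bounded_of_compact_support:
  fixes f :: "'a::euclidean_space \<Rightarrow> 'b::real_normed_vector"
  assumes "continuous_on UNIV f" "compact S" "\<And>x. x \<notin> S \<Longrightarrow> f x = 0"
  obtains R where "R \<ge> 0" "\<And>x. norm (f x) \<le> R"
proof -
  have "bounded (f ` S)"
    by (intro compact_imp_bounded compact_continuous_image continuous_on_subset[OF assms(1)] assms(2)) auto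
  then obtain R where "\<And>x. x \<in> S \<Longrightarrow> norm (f x) \<le> R" unfolding bounded_iff by auto
  then have "norm (f x) \<le> max R 0" for x using assms(3) by (cases "x \<in> S") (auto simp: max.coboundedI1)
  then show ?thesis by (intro that[of "max R 0"]) auto
qed

lemma test_fun_bounded:
  assumes "test_fun \<Omega> f"
  obtains R where "R \<ge> 0" "\<And>x. \<bar>f x\<bar> \<le> R" "\<And>x. norm (grad f x) \<le> R"
proof -
  let ?S = "closure {x. f x \<noteq> 0}"
  have f: "smooth_fun f" "compact ?S" using assms by (auto simp: test_fun_def)
  have z: "f x = 0" if "x \<notin> ?S" for x
    using that closure_subset[of "{x. f x \<noteq> 0}"] by auto
  obtain R1 where R1: "R1 \<ge> 0" "\<And>x. norm (f x) \<le> R1"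
    by (rule bounded_of_compact_support[OF smooth_fun_continuous[OF f(1)] f(2) z]) (assumption, rule that)
  obtain R2 where R2: "R2 \<ge> 0" "\<And>x. norm (grad f x) \<le> R2"
    by (rule bounded_of_compact_support[OF continuous_on_grad[OF f(1)] f(2) grad_zero_outside_support])
      (assumption, rule that)
  show ?thesis by (rule that[of "max R1 R2"]) (use R1 R2 in \<open>auto simp: max.coboundedI1 max.coboundedI2\<close>)
qed

lemma test_fun_of_subset:
  assumes "smooth_fun f" "{x. f x \<noteq> 0} \<subseteq> S" "compact (closure S)" "closure S \<subseteq> \<Omega>"
  shows "test_fun \<Omega> f"
proof -
  have "closure {x. f x \<noteq> 0} \<subseteq> closure S" by (rule closure_mono[OF assms(2)])
  moreover have "compact (closure {x. f x \<noteq> 0})"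
    using compact_Int_closed[OF assms(3) closed_closure, of "{x. f x \<noteq> 0}"] calculation by (simp add: Int_absorb1 Int_commute)
  ultimately show ?thesis using assms by (auto simp: test_fun_def)
qed

lemma has_derivative_cutoff_comp:
  assumes "smooth_fun \<eta>" "smooth_fun f" "\<And>t. (P has_real_derivative p t) (at t)"
  shows "((\<lambda>x. \<eta> x * P (f x)) has_derivative (\<lambda>h. (P (f x) *\<^sub>R grad \<eta> x + (\<eta> x * p (f x)) *\<^sub>R grad f x) \<bullet> h)) (at x)"
proof -
  have "((\<lambda>x. P (f x)) has_derivative (\<lambda>h. p (f x) * (grad f x \<bullet> h))) (at x)"
    using has_derivative_compose[OF smooth_fun_has_derivative[OF assms(2)] assms(3)[unfolded has_field_derivative_def]] .
  from has_derivative_mult[OF smooth_fun_has_derivative[OF assms(1)] this]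
  show ?thesis by (simp add: algebra_simps inner_add_left)
qed

text \<open>\<open>M\<close> is the weighted measure on \<open>\<Omega>\<close>. The weight \<open>(1 + |g|) powr (p - 1)\<close> in the convergence assumptions
  allows to pass to the limit both in the flux \<open>|g| powr (p - 2) * g\<close> and in \<open>L\<^sup>1\<close>.\<close>

locale weak_solution =
  fixes M :: "'a::euclidean_space measure" and \<Omega> :: "'a set" and p lam :: real
    and u :: "'a \<Rightarrow> real" and g :: "'a \<Rightarrow> 'a" and \<phi> :: "nat \<Rightarrow> 'a \<Rightarrow> real"
  assumes finite_M: "finite_measure M" and sets_M [measurable_cong]: "sets M = sets borel" and p: "1 < p"
    and u_measurable [measurable]: "u \<in> borel_measurable borel"
    and g_measurable [measurable]: "g \<in> borel_measurable borel"
    and u_nonneg: "\<And>x. 0 \<le> u x" and u_le_1: "\<And>x. u x \<le> 1"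
    and g_integrable: "integrable M (\<lambda>x. (1 + norm (g x)) powr p)"
    and test: "\<And>n. test_fun \<Omega> (\<phi> n)"
    and lim_u: "(\<lambda>n. \<integral>\<^sup>+x. ennreal ((1 + norm (g x)) powr (p - 1) * \<bar>\<phi> n x - u x\<bar>) \<partial>M) \<longlonglongrightarrow> 0"
    and lim_g: "(\<lambda>n. \<integral>\<^sup>+x. ennreal ((1 + norm (g x)) powr (p - 1) * norm (grad (\<phi> n) x - g x)) \<partial>M) \<longlonglongrightarrow> 0"
    and lim_AE: "AE x in M. (\<lambda>n. \<phi> n x) \<longlonglongrightarrow> u x"
    and weak_eq: "\<And>\<psi>. test_fun \<Omega> \<psi> \<Longrightarrow>
      (\<integral>x. norm (g x) powr (p - 2) * (g x \<bullet> grad \<psi> x) \<partial>M) = lam * (\<integral>x. u x powr (p - 1) * \<psi> x \<partial>M)"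
begin

definition \<omega> :: "'a \<Rightarrow> real" where "\<omega> x = (1 + norm (g x)) powr (p - 1)"

lemma \<omega>_measurable [measurable]: "\<omega> \<in> borel_measurable borel"
  unfolding \<omega>_def by measurable

lemma \<omega>_ge_1: "\<omega> x \<ge> 1"
  using p powr_mono2[of "p - 1" 1 "1 + norm (g x)"] by (simp add: \<omega>_def)

lemma \<omega>_mult: "\<omega> x * (1 + norm (g x)) = (1 + norm (g x)) powr p"
proof -
  have "1 + norm (g x) > 0" by (simp add: add_pos_nonneg)
  then show ?thesis by (simp add: \<omega>_def powr_diff)
qed

lemma \<omega>_le: "\<omega> x \<le> (1 + norm (g x)) powr p"
  using mult_left_mono[of 1 "1 + norm (g x)" "\<omega> x"] \<omega>_ge_1[of x] by (simp add: \<omega>_mult)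

lemma powr_norm_g_le_\<omega>: "norm (g x) powr (p - 1) \<le> \<omega> x"
  unfolding \<omega>_def using p by (intro powr_mono2) auto

lemma \<phi>_smooth: "smooth_fun (\<phi> n)"
  using test by (simp add: test_fun_def)

lemma \<phi>_measurable [measurable]: "\<phi> n \<in> borel_measurable borel"
  by (rule smooth_fun_measurable[OF \<phi>_smooth])

lemma grad_\<phi>_measurable [measurable]: "grad (\<phi> n) \<in> borel_measurable borel"
  by (rule grad_measurable[OF \<phi>_smooth])

lemma integrable_dominated:
  assumes [measurable]: "f \<in> borel_measurable borel" and "\<And>x. \<bar>f x\<bar> \<le> C * (1 + norm (g x))"
  shows "integrable M (\<lambda>x. \<omega> x * f x)"
proof (rule Bochner_Integration.integrable_bound)
  show "integrable M (\<lambda>x. C * (1 + norm (g x)) powr p)" using g_integrable by simp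
  show "AE x in M. norm (\<omega> x * f x) \<le> norm (C * (1 + norm (g x)) powr p)"
  proof (rule AE_I2)
    fix x
    have "norm (\<omega> x * f x) \<le> \<omega> x * (C * (1 + norm (g x)))"
      using assms(2)[of x] \<omega>_ge_1[of x] by (simp add: abs_mult mult_left_mono)
    also have "\<dots> = C * (1 + norm (g x)) powr p" by (simp add: \<omega>_mult[symmetric] algebra_simps)
    finally show "norm (\<omega> x * f x) \<le> norm (C * (1 + norm (g x)) powr p)" by simp
  qed
qed measurable

text \<open>One majorant for the errors in values and in gradients when \<open>K (u x)\<close> is
  replaced by an approximation of \<open>K\<close> at \<open>\<phi> n x\<close>. The first term is
  the accuracy \<open>1 / (n + 1)\<close> of the approximation, \<open>C\<close> stands for a bound
  on \<open>k\<close>, and the last term compares derivatives at \<open>\<phi> n x\<close> and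
  \<open>u x\<close>.\<close>

definition err :: "(real \<Rightarrow> real) \<Rightarrow> real \<Rightarrow> nat \<Rightarrow> 'a \<Rightarrow> real" where
  "err k C n x = 1 / real (Suc n) * (1 + norm (g x)) + (1 + C) * \<bar>\<phi> n x - u x\<bar>
     + (1 + C) * norm (grad (\<phi> n) x - g x) + \<bar>k (\<phi> n x) - k (u x)\<bar> * norm (g x)"

lemma err_nonneg: "C \<ge> 0 \<Longrightarrow> 0 \<le> err k C n x"
  unfolding err_def by (intro add_nonneg_nonneg mult_nonneg_nonneg) auto

text \<open>The differences of values and of gradients vanish by \<open>lim_u\<close> and
  \<open>lim_g\<close>, whose weight is \<open>\<omega>\<close>. As \<open>k\<close> is merely
  continuous, its change is not controlled by these integrals; it vanishes by dominated convergence
  along \<open>lim_AE\<close>.\<close>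

lemma err_tendsto_0:
  assumes k: "continuous_on UNIV k" "\<And>t. \<bar>k t\<bar> \<le> C"
  shows "integrable M (\<lambda>x. \<omega> x * err k C n x)" "(\<lambda>n. \<integral>x. \<omega> x * err k C n x \<partial>M) \<longlonglongrightarrow> 0"
proof -
  have [measurable]: "k \<in> borel_measurable borel" using k by (simp add: borel_measurable_continuous_onI)
  have C0: "C \<ge> 0" using k(2)[of 0] by linarith
  have i1: "integrable M (\<lambda>x. \<omega> x * (1 + norm (g x)))"
    by (rule integrable_dominated[of _ 1]) auto
  have i2: "integrable M (\<lambda>x. \<omega> x * \<bar>\<phi> n x - u x\<bar>)" for n
  proof -
    obtain R where R: "R \<ge> 0" "\<And>x. \<bar>\<phi> n x\<bar> \<le> R" using test_fun_bounded[OF test[of n]] by metis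
    show ?thesis
    proof (rule integrable_dominated)
      show "\<bar>\<bar>\<phi> n x - u x\<bar>\<bar> \<le> (R + 1) * (1 + norm (g x))" for x
      proof -
        have "\<bar>\<phi> n x - u x\<bar> \<le> (R + 1) * 1" using R(2)[of x] u_nonneg[of x] u_le_1[of x] by simp
        also have "\<dots> \<le> (R + 1) * (1 + norm (g x))" using R by (intro mult_left_mono) auto
        finally show ?thesis by simp
      qed
    qed measurable
  qed
  have i3: "integrable M (\<lambda>x. \<omega> x * norm (grad (\<phi> n) x - g x))" for n
  proof -
    obtain R where R: "R \<ge> 0" "\<And>x. norm (grad (\<phi> n) x) \<le> R" using test_fun_bounded[OF test[of n]] by metis
    show ?thesis
    proof (rule integrable_dominated)
      show "\<bar>norm (grad (\<phi> n) x - g x)\<bar> \<le> (R + 1) * (1 + norm (g x))" for x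
      proof -
        have "norm (grad (\<phi> n) x - g x) \<le> R + norm (g x)"
          using R(2)[of x] norm_triangle_ineq4[of "grad (\<phi> n) x" "g x"] by linarith
        also have "\<dots> \<le> (R + 1) * (1 + norm (g x))" using R by (simp add: algebra_simps)
        finally show ?thesis by simp
      qed
    qed measurable
  qed
  have i4: "integrable M (\<lambda>x. \<omega> x * (\<bar>k (\<phi> n x) - k (u x)\<bar> * norm (g x)))" for n
  proof (rule integrable_dominated)
    show "\<bar>\<bar>k (\<phi> n x) - k (u x)\<bar> * norm (g x)\<bar> \<le> (2 * C) * (1 + norm (g x))" for x
      using k(2)[of "\<phi> n x"] k(2)[of "u x"] C0 by (auto simp: abs_mult intro!: mult_mono)
  qed measurable
  have nn: "(\<lambda>n. \<integral>x. f n x \<partial>M) \<longlonglongrightarrow> 0"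
    if "\<And>n. f n \<in> borel_measurable M" "\<And>n x. 0 \<le> f n x" "(\<lambda>n. \<integral>\<^sup>+x. ennreal (f n x) \<partial>M) \<longlonglongrightarrow> 0" for f :: "nat \<Rightarrow> 'a \<Rightarrow> real"
  proof -
    have "(\<lambda>n. enn2real (\<integral>\<^sup>+x. ennreal (f n x) \<partial>M)) \<longlonglongrightarrow> enn2real 0"
      using that(3) by (intro tendsto_enn2real) auto
    then show ?thesis using that by (simp add: integral_eq_nn_integral)
  qed
  have l2: "(\<lambda>n. \<integral>x. \<omega> x * \<bar>\<phi> n x - u x\<bar> \<partial>M) \<longlonglongrightarrow> 0"
    using lim_u \<omega>_ge_1 by (intro nn) (auto simp: \<omega>_def)
  have l3: "(\<lambda>n. \<integral>x. \<omega> x * norm (grad (\<phi> n) x - g x) \<partial>M) \<longlonglongrightarrow> 0"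
    using lim_g \<omega>_ge_1 by (intro nn) (auto simp: \<omega>_def)
  have l4: "(\<lambda>n. \<integral>x. \<omega> x * (\<bar>k (\<phi> n x) - k (u x)\<bar> * norm (g x)) \<partial>M) \<longlonglongrightarrow> (\<integral>x. 0 \<partial>M)"
  proof (rule integral_dominated_convergence)
    show "integrable M (\<lambda>x. 2 * C * (1 + norm (g x)) powr p)" using g_integrable by simp
    show "AE x in M. (\<lambda>n. \<omega> x * (\<bar>k (\<phi> n x) - k (u x)\<bar> * norm (g x))) \<longlonglongrightarrow> 0"
      using lim_AE
    proof eventually_elim
      case (elim x)
      have "isCont k (u x)" using k(1) by (simp add: continuous_on_eq_continuous_at)
      then have "(\<lambda>n. k (\<phi> n x)) \<longlonglongrightarrow> k (u x)" using elim by (rule isCont_tendsto_compose)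
      then have "(\<lambda>n. \<omega> x * (\<bar>k (\<phi> n x) - k (u x)\<bar> * norm (g x))) \<longlonglongrightarrow> \<omega> x * (\<bar>k (u x) - k (u x)\<bar> * norm (g x))"
        by (intro tendsto_intros)
      then show ?case by simp
    qed
    show "AE x in M. norm (\<omega> x * (\<bar>k (\<phi> n x) - k (u x)\<bar> * norm (g x))) \<le> 2 * C * (1 + norm (g x)) powr p" for n
    proof (rule AE_I2)
      fix x
      have "\<bar>k (\<phi> n x) - k (u x)\<bar> * norm (g x) \<le> (2 * C) * (1 + norm (g x))"
        using k(2)[of "\<phi> n x"] k(2)[of "u x"] C0 by (intro mult_mono) auto
      then have "\<omega> x * (\<bar>k (\<phi> n x) - k (u x)\<bar> * norm (g x)) \<le> \<omega> x * ((2 * C) * (1 + norm (g x)))"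
        using \<omega>_ge_1[of x] by (intro mult_left_mono) auto
      also have "\<dots> = 2 * C * (1 + norm (g x)) powr p" by (simp add: \<omega>_mult[symmetric] algebra_simps)
      finally show "norm (\<omega> x * (\<bar>k (\<phi> n x) - k (u x)\<bar> * norm (g x))) \<le> 2 * C * (1 + norm (g x)) powr p"
        using \<omega>_ge_1[of x] by (simp add: abs_mult)
    qed
  qed measurable
  have eq: "\<omega> x * err k C n x = 1 / real (Suc n) * (\<omega> x * (1 + norm (g x))) + (1 + C) * (\<omega> x * \<bar>\<phi> n x - u x\<bar>)
     + (1 + C) * (\<omega> x * norm (grad (\<phi> n) x - g x)) + \<omega> x * (\<bar>k (\<phi> n x) - k (u x)\<bar> * norm (g x))" for n x
    unfolding err_def by (simp only: distrib_left mult.left_commute)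
  show "integrable M (\<lambda>x. \<omega> x * err k C n x)"
    unfolding eq using i1 i2 i3 i4 by (intro Bochner_Integration.integrable_add integrable_mult_right)
  have "(\<integral>x. \<omega> x * err k C n x \<partial>M) = 1 / real (Suc n) * (\<integral>x. \<omega> x * (1 + norm (g x)) \<partial>M)
     + (1 + C) * (\<integral>x. \<omega> x * \<bar>\<phi> n x - u x\<bar> \<partial>M) + (1 + C) * (\<integral>x. \<omega> x * norm (grad (\<phi> n) x - g x) \<partial>M)
     + (\<integral>x. \<omega> x * (\<bar>k (\<phi> n x) - k (u x)\<bar> * norm (g x)) \<partial>M)" for n
    unfolding eq using i1 i2[of n] i3[of n] i4[of n]
    by (simp del: of_nat_Suc add: Bochner_Integration.integral_add Bochner_Integration.integrable_add)
  moreover have "(\<lambda>n. 1 / real (Suc n) * (\<integral>x. \<omega> x * (1 + norm (g x)) \<partial>M)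
     + (1 + C) * (\<integral>x. \<omega> x * \<bar>\<phi> n x - u x\<bar> \<partial>M) + (1 + C) * (\<integral>x. \<omega> x * norm (grad (\<phi> n) x - g x) \<partial>M)
     + (\<integral>x. \<omega> x * (\<bar>k (\<phi> n x) - k (u x)\<bar> * norm (g x)) \<partial>M))
     \<longlonglongrightarrow> 0 * (\<integral>x. \<omega> x * (1 + norm (g x)) \<partial>M) + (1 + C) * 0 + (1 + C) * 0 + (\<integral>x. 0 \<partial>M)"
    by (intro tendsto_add tendsto_mult tendsto_const l2 l3 l4 LIMSEQ_Suc[OF lim_inverse_n'])
  ultimately show "(\<lambda>n. \<integral>x. \<omega> x * err k C n x \<partial>M) \<longlonglongrightarrow> 0" by simp
qed

text \<open>\<open>P\<close> and \<open>pn\<close> stay abstract because two choices are made: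
  polynomials, to obtain admissible test functions, and \<open>K\<close>, \<open>k\<close>
  themselves, to obtain C1 functions for the translation estimate.\<close>

lemma approx_bounds:
  assumes P: "\<bar>P (\<phi> n x) - K (\<phi> n x)\<bar> \<le> 1 / real (Suc n) * \<bar>\<phi> n x\<bar>"
    and pk: "\<bar>pn (\<phi> n x) - k (\<phi> n x)\<bar> \<le> 1 / real (Suc n)"
    and K: "\<And>t. (K has_real_derivative k t) (at t)" and k: "\<And>t. \<bar>k t\<bar> \<le> C"
    and \<eta>: "\<bar>\<eta> x\<bar> \<le> C\<eta>" "norm (G x) \<le> C\<eta>"
  shows "\<bar>\<eta> x * P (\<phi> n x) - \<eta> x * K (u x)\<bar> \<le> C\<eta> * err k C n x"
    and "norm ((P (\<phi> n x) *\<^sub>R G x + (\<eta> x * pn (\<phi> n x)) *\<^sub>R grad (\<phi> n) x)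
        - (K (u x) *\<^sub>R G x + (\<eta> x * k (u x)) *\<^sub>R g x)) \<le> C\<eta> * err k C n x"
proof -
  define \<epsilon> where "\<epsilon> = 1 / real (Suc n)"
  have \<epsilon>: "0 \<le> \<epsilon>" "\<epsilon> \<le> 1" by (auto simp: \<epsilon>_def)
  have C0: "C \<ge> 0" "C\<eta> \<ge> 0" using k[of 0] \<eta> by linarith+
  have "norm (K (\<phi> n x) - K (u x)) \<le> C * norm (\<phi> n x - u x)"
    by (rule field_differentiable_bound[of UNIV K k]) (use K k in auto)
  then have 1: "\<bar>K (\<phi> n x) - K (u x)\<bar> \<le> C * \<bar>\<phi> n x - u x\<bar>" by simp
  have "\<bar>\<phi> n x\<bar> \<le> 1 + \<bar>\<phi> n x - u x\<bar>" using u_nonneg[of x] u_le_1[of x] by linarith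
  then have "\<epsilon> * \<bar>\<phi> n x\<bar> \<le> \<epsilon> * (1 + \<bar>\<phi> n x - u x\<bar>)" using \<epsilon> by (intro mult_left_mono) auto
  also have "\<dots> \<le> \<epsilon> + 1 * \<bar>\<phi> n x - u x\<bar>" using \<epsilon> mult_right_mono[of \<epsilon> 1 "\<bar>\<phi> n x - u x\<bar>"]
    by (simp add: algebra_simps)
  finally have 2: "\<bar>P (\<phi> n x) - K (u x)\<bar> \<le> \<epsilon> + (1 + C) * \<bar>\<phi> n x - u x\<bar>"
    using P 1 unfolding \<epsilon>_def[symmetric] by (simp add: algebra_simps)
  have "norm (pn (\<phi> n x) *\<^sub>R grad (\<phi> n) x - k (u x) *\<^sub>R g x)
     = norm ((pn (\<phi> n x) - k (\<phi> n x)) *\<^sub>R g x + pn (\<phi> n x) *\<^sub>R (grad (\<phi> n) x - g x) + (k (\<phi> n x) - k (u x)) *\<^sub>R g x)"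
    by (simp add: algebra_simps)
  also have "\<dots> \<le> \<bar>pn (\<phi> n x) - k (\<phi> n x)\<bar> * norm (g x) + \<bar>pn (\<phi> n x)\<bar> * norm (grad (\<phi> n) x - g x)
      + \<bar>k (\<phi> n x) - k (u x)\<bar> * norm (g x)"
    by (intro norm_triangle_mono order_refl) auto
  also have "\<dots> \<le> \<epsilon> * norm (g x) + (1 + C) * norm (grad (\<phi> n) x - g x) + \<bar>k (\<phi> n x) - k (u x)\<bar> * norm (g x)"
    using pk k[of "\<phi> n x"] \<epsilon> unfolding \<epsilon>_def[symmetric] by (intro add_mono mult_right_mono) auto
  finally have 3: "norm (pn (\<phi> n x) *\<^sub>R grad (\<phi> n) x - k (u x) *\<^sub>R g x)
    \<le> \<epsilon> * norm (g x) + (1 + C) * norm (grad (\<phi> n) x - g x) + \<bar>k (\<phi> n x) - k (u x)\<bar> * norm (g x)" .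
  have err: "err k C n x = (\<epsilon> + (1 + C) * \<bar>\<phi> n x - u x\<bar>) + (\<epsilon> * norm (g x) + (1 + C) * norm (grad (\<phi> n) x - g x)
     + \<bar>k (\<phi> n x) - k (u x)\<bar> * norm (g x))"
    unfolding err_def \<epsilon>_def[symmetric] by (simp add: algebra_simps)
  have "\<epsilon> * norm (g x) + (1 + C) * norm (grad (\<phi> n) x - g x) + \<bar>k (\<phi> n x) - k (u x)\<bar> * norm (g x) \<ge> 0"
    using \<epsilon> C0 by auto
  then have "\<bar>P (\<phi> n x) - K (u x)\<bar> \<le> err k C n x" using 2 unfolding err by linarith
  then have "\<bar>\<eta> x\<bar> * \<bar>P (\<phi> n x) - K (u x)\<bar> \<le> C\<eta> * err k C n x" using \<eta> C0 by (intro mult_mono) auto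
  then show "\<bar>\<eta> x * P (\<phi> n x) - \<eta> x * K (u x)\<bar> \<le> C\<eta> * err k C n x"
    by (simp add: abs_mult[symmetric] right_diff_distrib)
  have "norm ((P (\<phi> n x) *\<^sub>R G x + (\<eta> x * pn (\<phi> n x)) *\<^sub>R grad (\<phi> n) x) - (K (u x) *\<^sub>R G x + (\<eta> x * k (u x)) *\<^sub>R g x))
    = norm ((P (\<phi> n x) - K (u x)) *\<^sub>R G x + \<eta> x *\<^sub>R (pn (\<phi> n x) *\<^sub>R grad (\<phi> n) x - k (u x) *\<^sub>R g x))"
    by (simp add: algebra_simps)
  also have "\<dots> \<le> \<bar>P (\<phi> n x) - K (u x)\<bar> * norm (G x) + \<bar>\<eta> x\<bar> * norm (pn (\<phi> n x) *\<^sub>R grad (\<phi> n) x - k (u x) *\<^sub>R g x)"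
    by (intro norm_triangle_mono) auto
  also have "\<dots> \<le> (\<epsilon> + (1 + C) * \<bar>\<phi> n x - u x\<bar>) * C\<eta> + C\<eta> * (\<epsilon> * norm (g x) + (1 + C) * norm (grad (\<phi> n) x - g x)
     + \<bar>k (\<phi> n x) - k (u x)\<bar> * norm (g x))"
    using 2 3 \<eta> C0 \<epsilon> by (intro add_mono mult_mono) auto
  also have "\<dots> = C\<eta> * err k C n x" unfolding err by (simp add: algebra_simps)
  finally show "norm ((P (\<phi> n x) *\<^sub>R G x + (\<eta> x * pn (\<phi> n x)) *\<^sub>R grad (\<phi> n) x)
        - (K (u x) *\<^sub>R G x + (\<eta> x * k (u x)) *\<^sub>R g x)) \<le> C\<eta> * err k C n x" .
qed

text \<open>The test functions are \<open>\<eta> * P n (\<phi> n)\<close> with polynomials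
  \<open>P n\<close>. Their support is compact either through \<open>\<phi> n\<close>, which
  requires the value 0 at 0, or through \<open>\<eta>\<close>. The first alternative permits cutoffs
  that reach across the boundary of \<open>\<Omega>\<close>.\<close>

lemma test_identity_UNIV:
  assumes K: "\<And>t. (K has_real_derivative k t) (at t)" and k: "continuous_on UNIV k" "\<And>t. \<bar>k t\<bar> \<le> C"
    and \<eta>: "smooth_fun \<eta>" "\<And>x. \<bar>\<eta> x\<bar> \<le> C\<eta>" "\<And>x. norm (grad \<eta> x) \<le> C\<eta>"
    and supp: "K 0 = 0 \<or> (compact (closure {x. \<eta> x \<noteq> 0}) \<and> closure {x. \<eta> x \<noteq> 0} \<subseteq> \<Omega>)"
  shows "(\<integral>x. norm (g x) powr (p - 2) * (g x \<bullet> (K (u x) *\<^sub>R grad \<eta> x + (\<eta> x * k (u x)) *\<^sub>R g x)) \<partial>M)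
     = lam * (\<integral>x. u x powr (p - 1) * (\<eta> x * K (u x)) \<partial>M)"
    and "integrable M (\<lambda>x. norm (g x) powr (p - 2) * (g x \<bullet> (K (u x) *\<^sub>R grad \<eta> x + (\<eta> x * k (u x)) *\<^sub>R g x)))"
proof -
  have "\<exists>P pn. (\<forall>t. (P has_real_derivative pn t) (at t)) \<and> P 0 = K 0 \<and> continuous_on UNIV pn \<and>
    (\<forall>x. \<bar>pn (\<phi> n x) - k (\<phi> n x)\<bar> \<le> 1 / real (Suc n) \<and> \<bar>P (\<phi> n x) - K (\<phi> n x)\<bar> \<le> 1 / real (Suc n) * \<bar>\<phi> n x\<bar>) \<and>
    (\<forall>f::'a \<Rightarrow> real. smooth_fun f \<longrightarrow> smooth_fun (\<lambda>x. P (f x)))" for n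
  proof -
    obtain R where "\<And>x. \<bar>\<phi> n x\<bar> \<le> R" using test_fun_bounded[OF test[of n]] by metis
    note R = this
    obtain P pn where Q: "\<forall>t. (P has_real_derivative pn t) (at t)" "P 0 = K 0" "continuous_on UNIV pn"
      "\<forall>t. \<bar>t\<bar> \<le> R \<longrightarrow> \<bar>pn t - k t\<bar> \<le> 1 / real (Suc n) \<and> \<bar>P t - K t\<bar> \<le> 1 / real (Suc n) * \<bar>t\<bar>"
      "\<forall>f::'a \<Rightarrow> real. smooth_fun f \<longrightarrow> smooth_fun (\<lambda>x. P (f x))"
      using C1_polynomial_approx[OF K k(1), of "1 / real (Suc n)" R, where 'a = 'a] by auto
    show ?thesis
      by (rule exI[of _ P], rule exI[of _ pn]) (use Q R in blast)
  qed
  then obtain P pn where P: "\<And>n t. (P n has_real_derivative pn n t) (at t)" "\<And>n. P n 0 = K 0"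
      "\<And>n. continuous_on UNIV (pn n)"
      "\<And>n x. \<bar>pn n (\<phi> n x) - k (\<phi> n x)\<bar> \<le> 1 / real (Suc n)"
      "\<And>n x. \<bar>P n (\<phi> n x) - K (\<phi> n x)\<bar> \<le> 1 / real (Suc n) * \<bar>\<phi> n x\<bar>"
      "\<And>n f. smooth_fun (f::'a \<Rightarrow> real) \<Longrightarrow> smooth_fun (\<lambda>x. P n (f x))"
    by metis
  define \<psi> where "\<psi> n x = \<eta> x * P n (\<phi> n x)" for n x
  have smooth: "smooth_fun (\<psi> n)" for n
    unfolding \<psi>_def by (intro smooth_fun_mult \<eta> P(6) \<phi>_smooth)
  have tst: "test_fun \<Omega> (\<psi> n)" for n
    using supp
  proof
    assume "K 0 = 0"
    then show ?thesis using test[of n] P(2)[of n]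
      by (intro test_fun_of_subset[of _ "{x. \<phi> n x \<noteq> 0}"] smooth) (auto simp: \<psi>_def test_fun_def)
  next
    assume "compact (closure {x. \<eta> x \<noteq> 0}) \<and> closure {x. \<eta> x \<noteq> 0} \<subseteq> \<Omega>"
    then show ?thesis
      by (intro test_fun_of_subset[of _ "{x. \<eta> x \<noteq> 0}"] smooth) (auto simp: \<psi>_def)
  qed
  have gr: "grad (\<psi> n) x = P n (\<phi> n x) *\<^sub>R grad \<eta> x + (\<eta> x * pn n (\<phi> n x)) *\<^sub>R grad (\<phi> n) x" for n x
    unfolding \<psi>_def by (rule grad_eqI[OF has_derivative_cutoff_comp[OF \<eta>(1) \<phi>_smooth P(1)]])
  have [measurable]: "k \<in> borel_measurable borel" using k by (simp add: borel_measurable_continuous_onI)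
  have "continuous_on UNIV K"
    by (rule DERIV_continuous_on[OF has_field_derivative_at_within[OF K]])
  then have [measurable]: "K \<in> borel_measurable borel" by (rule borel_measurable_continuous_onI)
  have [measurable]: "\<eta> \<in> borel_measurable borel" "grad \<eta> \<in> borel_measurable borel"
    using \<eta>(1) smooth_fun_measurable grad_measurable by auto
  have [measurable]: "\<psi> n \<in> borel_measurable borel" "grad (\<psi> n) \<in> borel_measurable borel" for n
    using smooth smooth_fun_measurable grad_measurable by auto
  have C0: "C \<ge> 0" "C\<eta> \<ge> 0" using k(2)[of 0] \<eta>(2)[of undefined] by linarith+
  define D where "D x = K (u x) *\<^sub>R grad \<eta> x + (\<eta> x * k (u x)) *\<^sub>R g x" for x
  have [measurable]: "D \<in> borel_measurable borel" unfolding D_def by measurable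
  have diff1: "\<bar>\<psi> n x - \<eta> x * K (u x)\<bar> \<le> C\<eta> * err k C n x" for n x
    unfolding \<psi>_def by (rule approx_bounds(1)[where P = "P n" and pn = "pn n" and G = "grad \<eta>", OF P(5) P(4) K k(2) \<eta>(2) \<eta>(3)])
  have diff2: "norm (grad (\<psi> n) x - D x) \<le> C\<eta> * err k C n x" for n x
    unfolding gr D_def by (rule approx_bounds(2)[where P = "P n" and pn = "pn n" and G = "grad \<eta>", OF P(5) P(4) K k(2) \<eta>(2) \<eta>(3)])
  have Kb: "\<bar>K (u x)\<bar> \<le> \<bar>K 0\<bar> + C" for x
  proof -
    have "norm (K (u x) - K 0) \<le> C * norm (u x - 0)"
      by (rule field_differentiable_bound[of UNIV K k]) (use K k in auto)
    also have "\<dots> \<le> C * 1" using u_nonneg[of x] u_le_1[of x] C0 by (intro mult_left_mono) auto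
    finally show ?thesis by simp
  qed
  define C2 where "C2 = C\<eta> * (\<bar>K 0\<bar> + C)"
  have nD: "norm (D x) \<le> C2 * (1 + norm (g x))" for x
  proof -
    have "norm (D x) \<le> \<bar>K (u x)\<bar> * norm (grad \<eta> x) + \<bar>\<eta> x\<bar> * \<bar>k (u x)\<bar> * norm (g x)"
      unfolding D_def by (intro norm_triangle_mono) (auto simp: abs_mult)
    also have "\<dots> \<le> (\<bar>K 0\<bar> + C) * C\<eta> + C\<eta> * (\<bar>K 0\<bar> + C) * norm (g x)"
      using Kb[of x] \<eta>(2,3)[of x] k(2)[of "u x"] C0 by (intro add_mono mult_mono) auto
    finally show ?thesis by (simp add: C2_def algebra_simps)
  qed
  have gp: "\<bar>norm (g x) powr (p - 2) * (g x \<bullet> W)\<bar> \<le> \<omega> x * norm W" for x W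
  proof -
    have "\<bar>norm (g x) powr (p - 2) * (g x \<bullet> W)\<bar> \<le> norm (g x) powr (p - 2) * (norm (g x) * norm W)"
      unfolding abs_mult by (simp add: mult_left_mono Cauchy_Schwarz_ineq2)
    also have "\<dots> = norm (g x) powr (p - 1) * norm W"
    proof (cases "g x = 0")
      case False
      have "norm (g x) powr ((p - 2) + 1) = norm (g x) powr (p - 2) * norm (g x) powr 1"
        by (rule powr_add)
      then show ?thesis using False by simp
    qed simp
    also have "\<dots> \<le> \<omega> x * norm W" by (intro mult_right_mono powr_norm_g_le_\<omega>) auto
    finally show ?thesis .
  qed
  have iH: "integrable M (\<lambda>x. C\<eta> * (\<omega> x * err k C n x))" for n
    using err_tendsto_0(1)[OF k] by simp
  have lH: "(\<lambda>n. \<integral>x. C\<eta> * (\<omega> x * err k C n x) \<partial>M) \<longlonglongrightarrow> 0"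
    using tendsto_mult_right_zero[OF err_tendsto_0(2)[OF k], of C\<eta>] by simp
  show iD: "integrable M (\<lambda>x. norm (g x) powr (p - 2) * (g x \<bullet> (K (u x) *\<^sub>R grad \<eta> x + (\<eta> x * k (u x)) *\<^sub>R g x)))"
    unfolding D_def[symmetric]
  proof (rule Bochner_Integration.integrable_bound)
    show "integrable M (\<lambda>x. \<omega> x * norm (D x))" by (rule integrable_dominated[of _ C2]) (use nD in auto)
    show "AE x in M. norm (norm (g x) powr (p - 2) * (g x \<bullet> D x)) \<le> norm (\<omega> x * norm (D x))"
      using gp \<omega>_ge_1 by (intro AE_I2) (auto intro: order_trans[OF _ abs_ge_self])
  qed measurable
  have "(\<lambda>n. \<integral>x. norm (g x) powr (p - 2) * (g x \<bullet> grad (\<psi> n) x) \<partial>M)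
     \<longlonglongrightarrow> (\<integral>x. norm (g x) powr (p - 2) * (g x \<bullet> D x) \<partial>M)"
  proof (rule tendsto_integral_of_dominated_diff[OF _ _ iH lH])
    show "integrable M (\<lambda>x. norm (g x) powr (p - 2) * (g x \<bullet> D x))" using iD by (simp add: D_def)
    fix n x
    have "\<bar>norm (g x) powr (p - 2) * (g x \<bullet> grad (\<psi> n) x) - norm (g x) powr (p - 2) * (g x \<bullet> D x)\<bar>
      = \<bar>norm (g x) powr (p - 2) * (g x \<bullet> (grad (\<psi> n) x - D x))\<bar>"
      by (simp add: inner_diff_right right_diff_distrib)
    also have "\<dots> \<le> \<omega> x * norm (grad (\<psi> n) x - D x)" by (rule gp)
    also have "\<dots> \<le> \<omega> x * (C\<eta> * err k C n x)" using \<omega>_ge_1[of x] by (intro mult_left_mono diff2) auto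
    finally show "\<bar>norm (g x) powr (p - 2) * (g x \<bullet> grad (\<psi> n) x) - norm (g x) powr (p - 2) * (g x \<bullet> D x)\<bar>
      \<le> C\<eta> * (\<omega> x * err k C n x)" by (simp add: algebra_simps)
  qed measurable
  moreover have "(\<lambda>n. \<integral>x. u x powr (p - 1) * \<psi> n x \<partial>M) \<longlonglongrightarrow> (\<integral>x. u x powr (p - 1) * (\<eta> x * K (u x)) \<partial>M)"
  proof (rule tendsto_integral_of_dominated_diff[OF _ _ iH lH])
    have u1: "u x powr (p - 1) \<le> 1" for x
      using powr_mono2[of "p - 1" "u x" 1] p u_nonneg[of x] u_le_1[of x] by simp
    have "\<bar>u x powr (p - 1) * (\<eta> x * K (u x))\<bar> \<le> C2" for x
    proof -
      have "\<bar>u x powr (p - 1) * (\<eta> x * K (u x))\<bar> \<le> 1 * (C\<eta> * (\<bar>K 0\<bar> + C))"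
        unfolding abs_mult using u1[of x] \<eta>(2)[of x] Kb[of x] C0 by (intro mult_mono) auto
      then show ?thesis by (simp add: C2_def)
    qed
    then show "integrable M (\<lambda>x. u x powr (p - 1) * (\<eta> x * K (u x)))"
      by (intro finite_measure.integrable_const_bound[OF finite_M, of _ C2]) auto
    fix n x
    have "\<bar>u x powr (p - 1) * \<psi> n x - u x powr (p - 1) * (\<eta> x * K (u x))\<bar> = u x powr (p - 1) * \<bar>\<psi> n x - \<eta> x * K (u x)\<bar>"
      by (simp add: abs_mult flip: right_diff_distrib)
    also have "\<dots> \<le> \<omega> x * (C\<eta> * err k C n x)"
      using u1[of x] \<omega>_ge_1[of x] by (intro mult_mono diff1) auto
    finally show "\<bar>u x powr (p - 1) * \<psi> n x - u x powr (p - 1) * (\<eta> x * K (u x))\<bar> \<le> C\<eta> * (\<omega> x * err k C n x)"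
      by (simp add: algebra_simps)
  qed measurable
  then have "(\<lambda>n. lam * (\<integral>x. u x powr (p - 1) * \<psi> n x \<partial>M)) \<longlonglongrightarrow> lam * (\<integral>x. u x powr (p - 1) * (\<eta> x * K (u x)) \<partial>M)"
    by (intro tendsto_mult tendsto_const)
  ultimately show "(\<integral>x. norm (g x) powr (p - 2) * (g x \<bullet> (K (u x) *\<^sub>R grad \<eta> x + (\<eta> x * k (u x)) *\<^sub>R g x)) \<partial>M)
     = lam * (\<integral>x. u x powr (p - 1) * (\<eta> x * K (u x)) \<partial>M)"
    unfolding D_def[symmetric] using weak_eq[OF tst] LIMSEQ_unique by auto
qed

text \<open>The C1 estimate is applied to \<open>\<eta> * K (\<phi> n)\<close> and carried to the
  limit. Its integrals run over Lebesgue measure on the whole space, hence the unweighted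
  \<open>M\<close> and the extension of \<open>u\<close> and \<open>g\<close> by 0.\<close>

lemma translation_estimate_UNIV:
  assumes M: "M = density lborel (indicator \<Omega>)" and \<Omega>: "\<Omega> \<in> sets borel"
    and off: "\<And>x. x \<notin> \<Omega> \<Longrightarrow> u x = 0" "\<And>x. x \<notin> \<Omega> \<Longrightarrow> g x = 0"
    and K: "\<And>t. (K has_real_derivative k t) (at t)" and k: "continuous_on UNIV k" "\<And>t. \<bar>k t\<bar> \<le> C"
    and \<eta>: "smooth_fun \<eta>" "\<And>x. \<bar>\<eta> x\<bar> \<le> C\<eta>" "\<And>x. norm (grad \<eta> x) \<le> C\<eta>"
    and B: "convex B" "B \<in> sets borel"
  shows "(\<integral>\<^sup>+x. indicator B x * indicator B (x + h) * ennreal \<bar>\<eta> (x + h) * K (u (x + h)) - \<eta> x * K (u x)\<bar> \<partial>lborel)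
    \<le> ennreal (norm h) * (\<integral>\<^sup>+x. indicator B x * ennreal (norm (K (u x) *\<^sub>R grad \<eta> x + (\<eta> x * k (u x)) *\<^sub>R g x)) \<partial>lborel)"
proof -
  note [measurable] = \<Omega> B(2)
  have [measurable]: "k \<in> borel_measurable borel" using k by (simp add: borel_measurable_continuous_onI)
  have cK: "continuous_on UNIV K"
    by (rule DERIV_continuous_on[OF has_field_derivative_at_within[OF K]])
  then have [measurable]: "K \<in> borel_measurable borel" by (rule borel_measurable_continuous_onI)
  have [measurable]: "\<eta> \<in> borel_measurable borel" "grad \<eta> \<in> borel_measurable borel"
    using \<eta>(1) smooth_fun_measurable grad_measurable by auto
  have C0: "C \<ge> 0" "C\<eta> \<ge> 0" using k(2)[of 0] \<eta>(2)[of undefined] by linarith+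
  define \<psi> where "\<psi> x = \<eta> x * K (u x)" for x
  define D where "D x = K (u x) *\<^sub>R grad \<eta> x + (\<eta> x * k (u x)) *\<^sub>R g x" for x
  define \<psi>n where "\<psi>n n x = \<eta> x * K (\<phi> n x)" for n x
  define Dn where "Dn n x = K (\<phi> n x) *\<^sub>R grad \<eta> x + (\<eta> x * k (\<phi> n x)) *\<^sub>R grad (\<phi> n) x" for n x
  have [measurable]: "\<psi> \<in> borel_measurable borel" "D \<in> borel_measurable borel"
    "\<psi>n n \<in> borel_measurable borel" "Dn n \<in> borel_measurable borel" for n
    unfolding \<psi>_def D_def \<psi>n_def Dn_def by measurable
  define e where "e n x = C\<eta> * (indicator \<Omega> x * (\<omega> x * err k C n x))" for n x
  have err0: "0 \<le> err k C n x" for n x using err_nonneg C0 by simp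
  have err_le: "err k C n x \<le> \<omega> x * err k C n x" for n x
    using mult_right_mono[OF \<omega>_ge_1[of x] err0[of n x]] by simp
  have \<phi>off: "\<phi> n x = 0" "grad (\<phi> n) x = 0" if "x \<notin> \<Omega>" for n x
  proof -
    have "x \<notin> closure {x. \<phi> n x \<noteq> 0}" using test[of n] that by (auto simp: test_fun_def)
    then show "\<phi> n x = 0" "grad (\<phi> n) x = 0"
      using closure_subset[of "{x. \<phi> n x \<noteq> 0}"] grad_zero_outside_support by auto
  qed
  have d1: "\<bar>\<psi>n n x - \<psi> x\<bar> \<le> e n x" for n x
  proof (cases "x \<in> \<Omega>")
    case True
    have "\<bar>\<psi>n n x - \<psi> x\<bar> \<le> C\<eta> * err k C n x"
      unfolding \<psi>n_def \<psi>_def by (rule approx_bounds(1)[where pn = k and G = "grad \<eta>", OF _ _ K k(2) \<eta>(2) \<eta>(3)]) auto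
    also have "\<dots> \<le> C\<eta> * (\<omega> x * err k C n x)" using C0 err_le by (intro mult_left_mono) auto
    finally show ?thesis using True by (simp add: e_def)
  qed (use off \<phi>off in \<open>simp add: \<psi>n_def \<psi>_def e_def\<close>)
  have d2: "norm (Dn n x - D x) \<le> e n x" for n x
  proof (cases "x \<in> \<Omega>")
    case True
    have "norm (Dn n x - D x) \<le> C\<eta> * err k C n x"
      unfolding Dn_def D_def by (rule approx_bounds(2)[where pn = k and G = "grad \<eta>", OF _ _ K k(2) \<eta>(2) \<eta>(3)]) auto
    also have "\<dots> \<le> C\<eta> * (\<omega> x * err k C n x)" using C0 err_le by (intro mult_left_mono) auto
    finally show ?thesis using True by (simp add: e_def)
  qed (use off \<phi>off in \<open>simp add: Dn_def D_def e_def\<close>)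
  have [measurable]: "e n \<in> borel_measurable borel" for n
    unfolding e_def err_def by measurable
  have e0: "0 \<le> e n x" for n x
    unfolding e_def using C0 err0[of n x] \<omega>_ge_1[of x] by (intro mult_nonneg_nonneg) auto
  define I where "I n = (\<integral>x. \<omega> x * err k C n x \<partial>M)" for n
  have I: "I \<longlonglongrightarrow> 0" unfolding I_def by (rule err_tendsto_0(2)[OF k])
  have Ie: "(\<integral>\<^sup>+x. ennreal (e n x) \<partial>lborel) = ennreal (C\<eta> * I n)" for n
  proof -
    have "(\<integral>\<^sup>+x. ennreal (e n x) \<partial>lborel) = (\<integral>\<^sup>+x. indicator \<Omega> x * ennreal (C\<eta> * (\<omega> x * err k C n x)) \<partial>lborel)"
      by (intro nn_integral_cong) (auto simp: e_def indicator_def)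
    also have "\<dots> = (\<integral>\<^sup>+x. ennreal (C\<eta> * (\<omega> x * err k C n x)) \<partial>M)"
      unfolding M by (subst nn_integral_density) (auto simp: err_def)
    also have "\<dots> = ennreal (\<integral>x. C\<eta> * (\<omega> x * err k C n x) \<partial>M)"
      using err_tendsto_0(1)[OF k] C0 err0 \<omega>_ge_1
      by (intro nn_integral_eq_integral) (auto intro!: mult_nonneg_nonneg order_trans[OF _ \<omega>_ge_1])
    finally show ?thesis by (simp add: I_def)
  qed
  let ?L = "\<integral>\<^sup>+x. indicator B x * indicator B (x + h) * ennreal \<bar>\<psi> (x + h) - \<psi> x\<bar> \<partial>lborel"
  let ?R = "ennreal (norm h) * (\<integral>\<^sup>+x. indicator B x * ennreal (norm (D x)) \<partial>lborel)"
  \<comment> \<open>The errors of the values at \<open>x\<close> and at \<open>x + h\<close>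
    contribute the 2, the error of the gradient contributes \<open>norm h\<close>.\<close>
  have bound: "?L \<le> ?R + ennreal ((norm h + 2) * (C\<eta> * I n))" for n
  proof -
    have "?L \<le> (\<integral>\<^sup>+x. indicator B x * indicator B (x + h) * ennreal \<bar>\<psi>n n (x + h) - \<psi>n n x\<bar> + (ennreal (e n (h + x)) + ennreal (e n x)) \<partial>lborel)"
    proof (rule nn_integral_mono)
      fix x
      have "\<bar>\<psi> (x + h) - \<psi> x\<bar> \<le> \<bar>\<psi>n n (x + h) - \<psi>n n x\<bar> + (e n (h + x) + e n x)"
        using d1[of n x] d1[of n "x + h"] by (simp add: add.commute)
      then have "ennreal \<bar>\<psi> (x + h) - \<psi> x\<bar> \<le> ennreal \<bar>\<psi>n n (x + h) - \<psi>n n x\<bar> + (ennreal (e n (h + x)) + ennreal (e n x))"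
        using e0 by (simp flip: ennreal_plus add: ennreal_leI)
      then show "indicator B x * indicator B (x + h) * ennreal \<bar>\<psi> (x + h) - \<psi> x\<bar>
        \<le> indicator B x * indicator B (x + h) * ennreal \<bar>\<psi>n n (x + h) - \<psi>n n x\<bar> + (ennreal (e n (h + x)) + ennreal (e n x))"
        by (auto simp: indicator_def)
    qed
    also have "\<dots> = (\<integral>\<^sup>+x. indicator B x * indicator B (x + h) * ennreal \<bar>\<psi>n n (x + h) - \<psi>n n x\<bar> \<partial>lborel)
       + ((\<integral>\<^sup>+x. ennreal (e n (h + x)) \<partial>lborel) + (\<integral>\<^sup>+x. ennreal (e n x) \<partial>lborel))"
    proof -
      have "(\<integral>\<^sup>+x. ennreal (e n (h + x)) + ennreal (e n x) \<partial>lborel)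
         = (\<integral>\<^sup>+x. ennreal (e n (h + x)) \<partial>lborel) + (\<integral>\<^sup>+x. ennreal (e n x) \<partial>lborel)"
        by (rule nn_integral_add) measurable
      moreover have "(\<integral>\<^sup>+x. indicator B x * indicator B (x + h) * ennreal \<bar>\<psi>n n (x + h) - \<psi>n n x\<bar> + (ennreal (e n (h + x)) + ennreal (e n x)) \<partial>lborel)
        = (\<integral>\<^sup>+x. indicator B x * indicator B (x + h) * ennreal \<bar>\<psi>n n (x + h) - \<psi>n n x\<bar> \<partial>lborel)
        + (\<integral>\<^sup>+x. ennreal (e n (h + x)) + ennreal (e n x) \<partial>lborel)"
        by (rule nn_integral_add) measurable
      ultimately show ?thesis by simp
    qed
    also have "(\<integral>\<^sup>+x. ennreal (e n (h + x)) \<partial>lborel) = (\<integral>\<^sup>+x. ennreal (e n x) \<partial>lborel)"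
      by (rule nn_integral_shift_lborel[where f = "\<lambda>x. ennreal (e n x)"]) measurable
    also have "(\<integral>\<^sup>+x. indicator B x * indicator B (x + h) * ennreal \<bar>\<psi>n n (x + h) - \<psi>n n x\<bar> \<partial>lborel)
       \<le> ennreal (norm h) * (\<integral>\<^sup>+x. indicator B x * ennreal (norm (Dn n x)) \<partial>lborel)"
    proof (rule translation_estimate_C1[OF _ _ B])
      show "(\<psi>n n has_derivative (\<lambda>h. Dn n x \<bullet> h)) (at x)" for x
        unfolding \<psi>n_def Dn_def by (rule has_derivative_cutoff_comp[OF \<eta>(1) \<phi>_smooth K])
      show "continuous_on UNIV (Dn n)"
        unfolding Dn_def
        by (intro continuous_intros continuous_on_grad \<eta> \<phi>_smooth smooth_fun_continuous
            continuous_on_compose2[OF cK] continuous_on_compose2[OF k(1)]) auto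
    qed
    also have "(\<integral>\<^sup>+x. indicator B x * ennreal (norm (Dn n x)) \<partial>lborel)
      \<le> (\<integral>\<^sup>+x. indicator B x * ennreal (norm (D x)) + ennreal (e n x) \<partial>lborel)"
    proof (rule nn_integral_mono)
      fix x
      have "norm (Dn n x) \<le> norm (D x) + e n x" using d2[of n x] norm_triangle_sub[of "Dn n x" "D x"] by linarith
      then have "ennreal (norm (Dn n x)) \<le> ennreal (norm (D x)) + ennreal (e n x)"
        using e0 by (simp flip: ennreal_plus add: ennreal_leI)
      then show "indicator B x * ennreal (norm (Dn n x)) \<le> indicator B x * ennreal (norm (D x)) + ennreal (e n x)"
        by (auto simp: indicator_def)
    qed
    also have "\<dots> = (\<integral>\<^sup>+x. indicator B x * ennreal (norm (D x)) \<partial>lborel) + (\<integral>\<^sup>+x. ennreal (e n x) \<partial>lborel)"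
      by (rule nn_integral_add) measurable
    finally have "?L \<le> ennreal (norm h) * ((\<integral>\<^sup>+x. indicator B x * ennreal (norm (D x)) \<partial>lborel) + ennreal (C\<eta> * I n))
      + (ennreal (C\<eta> * I n) + ennreal (C\<eta> * I n))"
      by (simp add: Ie add_right_mono mult_left_mono)
    also have "\<dots> = ?R + ennreal ((norm h + 2) * (C\<eta> * I n))"
    proof -
      have "I n \<ge> 0" unfolding I_def using err0 \<omega>_ge_1
        by (intro Bochner_Integration.integral_nonneg mult_nonneg_nonneg) (auto intro: order_trans[OF _ \<omega>_ge_1])
      then have c: "C\<eta> * I n \<ge> 0" using C0 by simp
      then have "ennreal ((norm h + 2) * (C\<eta> * I n)) = ennreal (norm h) * ennreal (C\<eta> * I n) + (ennreal (C\<eta> * I n) + ennreal (C\<eta> * I n))"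
        by (simp add: distrib_right ennreal_plus ennreal_mult flip: mult_2)
      then show ?thesis by (simp add: distrib_left add.assoc)
    qed
    finally show ?thesis .
  qed
  have "(\<lambda>n. ?R + ennreal ((norm h + 2) * (C\<eta> * I n))) \<longlonglongrightarrow> ?R + ennreal ((norm h + 2) * (C\<eta> * 0))"
    by (intro tendsto_add tendsto_const tendsto_ennrealI tendsto_mult I)
  then have "?L \<le> ?R" using bound by (intro LIMSEQ_le_const[of _ ?R]) (auto simp: \<psi>_def)
  then show ?thesis by (simp add: \<psi>_def D_def)
qed

end

subsection \<open>Energy estimates\<close>

text \<open>A C1 positive part, lying between \<open>max 0 (s - \<delta>)\<close> and
  \<open>max 0 s\<close> and with slope at most 1. The energy estimate asks for a continuous
  derivative, which a plain truncation does not have.\<close>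

definition ramp :: "real \<Rightarrow> real \<Rightarrow> real" where
  "ramp \<delta> s = sqrt (\<delta>\<^sup>2 + (max 0 s)\<^sup>2) - \<delta>"

definition ramp' :: "real \<Rightarrow> real \<Rightarrow> real" where
  "ramp' \<delta> s = max 0 s / sqrt (\<delta>\<^sup>2 + (max 0 s)\<^sup>2)"

lemma max0_square_deriv: "((\<lambda>s::real. (max 0 s)\<^sup>2) has_real_derivative 2 * max 0 s) (at s)"
proof -
  consider "s > 0" | "s < 0" | "s = 0" by linarith
  then show ?thesis
  proof cases
    case 1
    have "((\<lambda>s. s\<^sup>2) has_real_derivative 2 * max 0 s) (at s)"
      using 1 by (auto intro!: derivative_eq_intros)
    then show ?thesis
      by (rule has_field_derivative_transform_within_open[of _ _ _ "{0<..}"]) (use 1 in auto)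
  next
    case 2
    have "((\<lambda>s. 0) has_real_derivative 2 * max 0 s) (at s)" using 2 by simp
    then show ?thesis
      by (rule has_field_derivative_transform_within_open[of _ _ _ "{..<0}"]) (use 2 in auto)
  next
    case 3
    have "((\<lambda>h::real. max 0 h) \<longlongrightarrow> max 0 0) (at 0)" by (intro tendsto_intros)
    then have "((\<lambda>h::real. max 0 h) \<longlongrightarrow> 0) (at 0)" by simp
    then have "((\<lambda>h::real. ((max 0 (0 + h))\<^sup>2 - (max 0 0)\<^sup>2) / h) \<longlongrightarrow> 0) (at 0)"
      by (rule Lim_transform_eventually)
        (auto simp: eventually_at_filter max_def power2_eq_square)
    then show ?thesis using 3 by (simp add: DERIV_def)
  qed
qed

lemma ramp_deriv:
  assumes "\<delta> > 0"
  shows "(ramp \<delta> has_real_derivative ramp' \<delta> s) (at s)"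
proof -
  have eq: "inverse (sqrt y) / 2 * (0 + 2 * m) - 0 = m / sqrt y" for y m by (simp only: divide_inverse) simp
  have pos: "\<delta>\<^sup>2 + (max 0 s)\<^sup>2 > 0" using assms zero_less_power[of \<delta> 2] zero_le_power2[of "max 0 s"] by linarith
  have "((\<lambda>s. \<delta>\<^sup>2 + (max 0 s)\<^sup>2) has_real_derivative 0 + 2 * max 0 s) (at s)"
    by (rule DERIV_add[OF DERIV_const max0_square_deriv])
  from DERIV_diff[OF DERIV_chain2[OF DERIV_real_sqrt[OF pos] this] DERIV_const[of \<delta>]]
  show ?thesis unfolding ramp_def[abs_def] ramp'_def eq .
qed

lemma ramp'_continuous:
  assumes "\<delta> > 0"
  shows "continuous_on S (ramp' \<delta>)"
proof -
  have "\<delta>\<^sup>2 + (max 0 s)\<^sup>2 > 0" for s :: real using assms zero_less_power[of \<delta> 2] zero_le_power2[of "max 0 s"] by linarith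
  then have "sqrt (\<delta>\<^sup>2 + (max 0 s)\<^sup>2) \<noteq> 0" for s using real_sqrt_gt_zero less_imp_neq by fastforce
  then show ?thesis unfolding ramp'_def by (intro continuous_intros ballI)
qed

lemma ramp_bounds:
  assumes "\<delta> > 0"
  shows "0 \<le> ramp \<delta> s" "ramp \<delta> s \<le> max 0 s" "max 0 (s - \<delta>) \<le> ramp \<delta> s" "0 \<le> ramp' \<delta> s" "ramp' \<delta> s \<le> 1"
    "s \<le> 0 \<Longrightarrow> ramp \<delta> s = 0" "s \<le> 0 \<Longrightarrow> ramp' \<delta> s = 0"
proof -
  let ?m = "max 0 s"
  have 1: "\<delta> \<le> sqrt (\<delta>\<^sup>2 + ?m\<^sup>2)" using assms by (intro real_le_rsqrt) auto
  have 2: "?m \<le> sqrt (\<delta>\<^sup>2 + ?m\<^sup>2)" by (intro real_le_rsqrt) auto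
  have 4: "sqrt (\<delta>\<^sup>2 + ?m\<^sup>2) > 0" using 1 assms by linarith
  have 5: "s \<le> ?m" by simp
  have 3: "sqrt (\<delta>\<^sup>2 + ?m\<^sup>2) \<le> \<delta> + ?m" using sqrt_sum_squares_le_sum[of \<delta> ?m] assms by auto
  show "0 \<le> ramp \<delta> s" "ramp \<delta> s \<le> ?m" "max 0 (s - \<delta>) \<le> ramp \<delta> s"
    using 1 2 3 5 unfolding ramp_def by linarith+
  show "0 \<le> ramp' \<delta> s" by (simp add: ramp'_def)
  show "ramp' \<delta> s \<le> 1" unfolding ramp'_def using 2 4 by (simp only: divide_le_eq_1_pos)
  show "s \<le> 0 \<Longrightarrow> ramp \<delta> s = 0" "s \<le> 0 \<Longrightarrow> ramp' \<delta> s = 0"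
    using assms by (auto simp: ramp_def ramp'_def)
qed

lemma ramp_measurable [measurable]: "ramp \<delta> \<in> borel_measurable borel" "ramp' \<delta> \<in> borel_measurable borel"
  unfolding ramp_def ramp'_def by measurable

text \<open>The power of \<open>\<eta>\<close> in the gradient bound of a cutoff combines with
  \<open>d powr (p - 1)\<close> into \<open>(d * \<eta> powr (1 / p)) powr (p - 1)\<close>. Young's
  inequality then returns \<open>\<eta> * d powr p\<close>, carrying the same cutoff as the energy,
  so that it can be absorbed.\<close>

lemma young_cutoff:
  fixes p d \<eta> c \<epsilon> :: real
  assumes p: "p > 1" and d: "d \<ge> 0" and \<eta>: "0 \<le> \<eta>" and c: "c \<ge> 0" and \<epsilon>: "\<epsilon> > 0" and n: "n \<le> c * \<eta> powr ((p - 1) / p)"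
  shows "d powr (p - 1) * n \<le> \<epsilon> * (\<eta> * d powr p) + \<epsilon> powr (1 - p) * c powr p"
proof -
  have "d powr (p - 1) * n \<le> d powr (p - 1) * (c * \<eta> powr ((p - 1) / p))"
    by (rule mult_left_mono[OF n]) simp
  also have "\<dots> = (d * \<eta> powr (1 / p)) powr (p - 1) * c"
    using d p by (simp add: powr_mult powr_powr)
  also have "\<dots> \<le> \<epsilon> * (d * \<eta> powr (1 / p)) powr p + \<epsilon> powr (1 - p) * c powr p"
    by (rule young_powr) (use d c \<epsilon> p in auto)
  also have "(d * \<eta> powr (1 / p)) powr p = \<eta> * d powr p"
    using d p \<eta> by (simp add: powr_mult powr_powr mult.commute)
  finally show ?thesis .
qed

section \<open>Testing the equation with functions of the solution\<close>

context weak_solution begin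

lemma M_space: "space M = UNIV"
  using sets_eq_imp_space_eq[OF sets_M] by simp

lemma integrable_const_bound_M:
  fixes f :: "'a \<Rightarrow> real"
  assumes "f \<in> borel_measurable borel" "\<And>x. \<bar>f x\<bar> \<le> C"
  shows "integrable M f"
  using assms by (intro finite_measure.integrable_const_bound[OF finite_M, of _ C]) auto

lemma integrable_powr_g:
  assumes [measurable]: "f \<in> borel_measurable borel" and "\<And>x. \<bar>f x\<bar> \<le> C"
  shows "integrable M (\<lambda>x. f x * norm (g x) powr p)"
proof (rule Bochner_Integration.integrable_bound)
  show "integrable M (\<lambda>x. C * (1 + norm (g x)) powr p)" using g_integrable by simp
  have "\<bar>f x * norm (g x) powr p\<bar> \<le> C * (1 + norm (g x)) powr p" for x
    unfolding abs_mult using assms(2)[of x] p by (intro mult_mono) (auto intro!: powr_mono2)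
  then show "AE x in M. norm (f x * norm (g x) powr p) \<le> norm (C * (1 + norm (g x)) powr p)"
    by (intro AE_I2) (auto intro: order_trans[OF _ abs_ge_self])
qed measurable

lemma integrable_powr_g_minus_1:
  assumes [measurable]: "f \<in> borel_measurable borel" and "\<And>x. \<bar>f x\<bar> \<le> C"
  shows "integrable M (\<lambda>x. f x * norm (g x) powr (p - 1))"
proof (rule Bochner_Integration.integrable_bound)
  show "integrable M (\<lambda>x. C * (1 + norm (g x)) powr p)" using g_integrable by simp
  have "\<bar>f x * norm (g x) powr (p - 1)\<bar> \<le> C * (1 + norm (g x)) powr p" for x
    unfolding abs_mult using assms(2)[of x] order_trans[OF powr_norm_g_le_\<omega> \<omega>_le] by (intro mult_mono) auto
  then show "AE x in M. norm (f x * norm (g x) powr (p - 1)) \<le> norm (C * (1 + norm (g x)) powr p)"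
    by (intro AE_I2) (auto intro: order_trans[OF _ abs_ge_self])
qed measurable

lemma continuous_comp_u:
  fixes k :: "real \<Rightarrow> real"
  assumes "continuous_on {0..1} k"
  shows "(\<lambda>x. k (u x)) \<in> borel_measurable borel" "\<exists>C. \<forall>x. \<bar>k (u x)\<bar> \<le> C"
proof -
  have "(\<lambda>t. k (max 0 (min 1 t))) \<in> borel_measurable borel"
    by (intro borel_measurable_continuous_onI continuous_on_compose2[OF assms] continuous_intros) auto
  then have "(\<lambda>x. k (max 0 (min 1 (u x)))) \<in> borel_measurable borel"
    by (rule measurable_compose[OF u_measurable])
  then show "(\<lambda>x. k (u x)) \<in> borel_measurable borel" using u_nonneg u_le_1 by (simp add: max_absorb2 min_absorb2)
  have "bounded (k ` {0..1})" using assms by (intro compact_imp_bounded compact_continuous_image) auto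
  then obtain C where "\<forall>t\<in>{0..1}. \<bar>k t\<bar> \<le> C" unfolding bounded_iff by auto
  then show "\<exists>C. \<forall>x. \<bar>k (u x)\<bar> \<le> C" using u_nonneg u_le_1 by (intro exI[of _ C]) auto
qed

text \<open>The test function is \<open>\<eta> * K u\<close>. Its gradient has a part along
  \<open>g\<close>, giving the energy, and a part along \<open>grad \<eta>\<close>, bounded by
  Cauchy-Schwarz. The two-sided form serves increasing \<open>K\<close>, where \<open>1 - u\<close>
  is used as a supersolution, and decreasing \<open>K\<close>, where it is used as a
  subsolution.\<close>

lemma energy_estimate:
  assumes K: "\<And>t. t \<in> {0..1} \<Longrightarrow> (K has_real_derivative k t) (at t within {0..1})" and k: "continuous_on {0..1} k"
    and \<eta>: "smooth_fun \<eta>" "\<And>x. \<bar>\<eta> x\<bar> \<le> C\<eta>" "\<And>x. norm (grad \<eta> x) \<le> C\<eta>"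
    and supp: "K 0 = 0 \<or> (compact (closure {x. \<eta> x \<noteq> 0}) \<and> closure {x. \<eta> x \<noteq> 0} \<subseteq> \<Omega>)"
  shows "\<bar>(\<integral>x. \<eta> x * k (u x) * norm (g x) powr p \<partial>M) - lam * (\<integral>x. u x powr (p - 1) * (\<eta> x * K (u x)) \<partial>M)\<bar>
      \<le> (\<integral>x. \<bar>K (u x)\<bar> * norm (grad \<eta> x) * norm (g x) powr (p - 1) \<partial>M)"
    and "integrable M (\<lambda>x. \<eta> x * k (u x) * norm (g x) powr p)"
    and "integrable M (\<lambda>x. \<bar>K (u x)\<bar> * norm (grad \<eta> x) * norm (g x) powr (p - 1))"
    and "integrable M (\<lambda>x. u x powr (p - 1) * (\<eta> x * K (u x)))"
proof -
  obtain K' k' C where ext: "\<And>t. (K' has_real_derivative k' t) (at t)" "continuous_on UNIV k'"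
    "\<And>t. \<bar>k' t\<bar> \<le> C" "\<And>t. t \<in> {0..1} \<Longrightarrow> K' t = K t" "\<And>t. t \<in> {0..1} \<Longrightarrow> k' t = k t"
    using extend_C1_unit_interval[OF K k] by metis
  have ux: "u x \<in> {0..1}" for x using u_nonneg u_le_1 by auto
  have s: "K' 0 = 0 \<or> (compact (closure {x. \<eta> x \<noteq> 0}) \<and> closure {x. \<eta> x \<noteq> 0} \<subseteq> \<Omega>)"
    using supp ext(4)[of 0] by simp
  note id = test_identity_UNIV[OF ext(1-3) \<eta> s, unfolded ext(4)[OF ux] ext(5)[OF ux]]
  have cK: "continuous_on {0..1} K" by (rule DERIV_continuous_on[OF K])
  obtain C1 where C1: "\<And>x. \<bar>K (u x)\<bar> \<le> C1" using continuous_comp_u(2)[OF cK] by blast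
  obtain C2 where C2: "\<And>x. \<bar>k (u x)\<bar> \<le> C2" using continuous_comp_u(2)[OF k] by blast
  note [measurable] = continuous_comp_u(1)[OF cK] continuous_comp_u(1)[OF k]
    smooth_fun_measurable[OF \<eta>(1)] grad_measurable[OF \<eta>(1)]
  have C0: "C\<eta> \<ge> 0" "C1 \<ge> 0" using \<eta>(2)[of undefined] C1[of undefined] by linarith+
  show i1: "integrable M (\<lambda>x. \<eta> x * k (u x) * norm (g x) powr p)"
    by (rule integrable_powr_g[of _ "C\<eta> * C2"]) (auto simp: abs_mult intro!: mult_mono \<eta> C2 C0)
  show i2: "integrable M (\<lambda>x. \<bar>K (u x)\<bar> * norm (grad \<eta> x) * norm (g x) powr (p - 1))"
    by (rule integrable_powr_g_minus_1[of _ "C1 * C\<eta>"]) (auto simp: abs_mult intro!: mult_mono \<eta> C1 C0)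
  show "integrable M (\<lambda>x. u x powr (p - 1) * (\<eta> x * K (u x)))"
  proof (rule integrable_const_bound_M)
    fix x
    have "u x powr (p - 1) \<le> 1" using powr_mono2[of "p - 1" "u x" 1] p u_nonneg[of x] u_le_1[of x] by simp
    then show "\<bar>u x powr (p - 1) * (\<eta> x * K (u x))\<bar> \<le> 1 * (C\<eta> * C1)"
      unfolding abs_mult using \<eta>(2)[of x] C1[of x] C0 by (intro mult_mono) auto
  qed measurable
  \<comment> \<open>At \<open>g x = 0\<close> both sides are 0 because \<open>0 powr a = 0\<close>,
    so the identity also covers \<open>p < 2\<close>.\<close>
  have gg: "norm (g x) powr (p - 2) * (g x \<bullet> g x) = norm (g x) powr p" for x
  proof (cases "g x = 0")
    case False
    have "norm (g x) powr ((p - 2) + 2) = norm (g x) powr (p - 2) * norm (g x) powr 2" by (rule powr_add)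
    then show ?thesis using False by (simp add: powr_numeral power2_norm_eq_inner)
  qed simp
  define X where "X x = K (u x) * (norm (g x) powr (p - 2) * (g x \<bullet> grad \<eta> x))" for x
  have dec: "norm (g x) powr (p - 2) * (g x \<bullet> (K (u x) *\<^sub>R grad \<eta> x + (\<eta> x * k (u x)) *\<^sub>R g x))
    = X x + \<eta> x * k (u x) * norm (g x) powr p" for x
    unfolding gg[symmetric] X_def by (simp add: inner_add_right algebra_simps)
  have Xle: "\<bar>X x\<bar> \<le> \<bar>K (u x)\<bar> * norm (grad \<eta> x) * norm (g x) powr (p - 1)" for x
  proof -
    have "\<bar>X x\<bar> \<le> \<bar>K (u x)\<bar> * (norm (g x) powr (p - 2) * (norm (g x) * norm (grad \<eta> x)))"
      unfolding X_def abs_mult abs_of_nonneg[OF powr_ge_zero] by (intro mult_left_mono Cauchy_Schwarz_ineq2) auto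
    also have "norm (g x) powr (p - 2) * (norm (g x) * norm (grad \<eta> x)) = norm (g x) powr (p - 1) * norm (grad \<eta> x)"
    proof (cases "g x = 0")
      case False
      have "norm (g x) powr ((p - 2) + 1) = norm (g x) powr (p - 2) * norm (g x) powr 1" by (rule powr_add)
      then show ?thesis using False by simp
    qed simp
    finally show ?thesis by (simp add: mult_ac)
  qed
  have [measurable]: "X \<in> borel_measurable borel" unfolding X_def[abs_def] by measurable
  have iX: "integrable M X"
    by (rule Bochner_Integration.integrable_bound[OF i2]) (use Xle in \<open>auto intro!: AE_I2 intro: order_trans[OF _ abs_ge_self]\<close>)
  have "(\<integral>x. \<eta> x * k (u x) * norm (g x) powr p \<partial>M) - lam * (\<integral>x. u x powr (p - 1) * (\<eta> x * K (u x)) \<partial>M) = - (\<integral>x. X x \<partial>M)"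
    using id(1) unfolding dec by (simp add: Bochner_Integration.integral_add[OF iX i1])
  moreover have "\<bar>\<integral>x. X x \<partial>M\<bar> \<le> (\<integral>x. \<bar>X x\<bar> \<partial>M)" by (rule integral_abs_bound)
  moreover have "(\<integral>x. \<bar>X x\<bar> \<partial>M) \<le> (\<integral>x. \<bar>K (u x)\<bar> * norm (grad \<eta> x) * norm (g x) powr (p - 1) \<partial>M)"
    by (rule integral_mono[OF _ i2]) (use iX Xle in auto)
  ultimately show "\<bar>(\<integral>x. \<eta> x * k (u x) * norm (g x) powr p \<partial>M) - lam * (\<integral>x. u x powr (p - 1) * (\<eta> x * K (u x)) \<partial>M)\<bar>
      \<le> (\<integral>x. \<bar>K (u x)\<bar> * norm (grad \<eta> x) * norm (g x) powr (p - 1) \<partial>M)" by linarith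
qed

text \<open>Young's inequality absorbs the gradient on the right into half of the term \<open>a * h\<close>;
  only the zero-order integral of \<open>h\<close> remains. Both test functions used below are designed to
  produce this term.\<close>

lemma absorb_gradient:
  assumes [measurable]: "\<eta> \<in> borel_measurable borel" "w \<in> borel_measurable borel" "h \<in> borel_measurable borel"
      "h' \<in> borel_measurable borel" "c \<in> borel_measurable borel" "n \<in> borel_measurable borel" "B \<in> sets borel"
    and \<eta>: "\<And>x. 0 \<le> \<eta> x" "\<And>x. \<eta> x \<le> 1" "\<And>x. x \<notin> B \<Longrightarrow> \<eta> x = 0"
    and w: "\<And>x. x \<in> B \<Longrightarrow> 1 \<le> w x" "\<And>x. x \<in> B \<Longrightarrow> w x \<le> W"
    and h: "\<And>x. 0 \<le> h x" "\<And>x. h x \<le> Mh" "\<And>x. 0 \<le> h' x" "\<And>x. h' x \<le> Mh"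
    and c: "\<And>x. 0 \<le> c x" "\<And>x. c x \<le> Mc"
    and n: "\<And>x. 0 \<le> n x" "\<And>x. n x \<le> G * \<eta> x powr ((p - 1) / p)" and G: "G \<ge> 0" and a: "a > 0"
    and le: "(\<integral>x. \<eta> x * w x * (a * h x + h' x) * (c x * norm (g x)) powr p \<partial>M)
       \<le> (\<integral>x. w x * h x * n x * (c x * norm (g x)) powr (p - 1) \<partial>M) + c0 * (\<integral>x. indicator B x * h x \<partial>M)"
  shows "(\<integral>x. \<eta> x * (a / 2 * h x + h' x) * (c x * norm (g x)) powr p \<partial>M)
     \<le> (W * (a / 2) powr (1 - p) * G powr p + c0) * (\<integral>x. indicator B x * h x \<partial>M)"
    and "(\<integral>x. \<eta> x * h' x * (c x * norm (g x)) powr p \<partial>M)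
     \<le> (W * (a / 2) powr (1 - p) * G powr p + c0) * (\<integral>x. indicator B x * h x \<partial>M)"
proof -
  define d where "d x = c x * norm (g x)" for x
  have d0: "d x \<ge> 0" for x using c by (simp add: d_def)
  have dp: "d x powr p = c x powr p * norm (g x) powr p" for x unfolding d_def using c by (simp add: powr_mult)
  have [measurable]: "d \<in> borel_measurable borel" unfolding d_def by measurable
  have Mh: "Mh \<ge> 0" using h(1,2)[of undefined] by linarith
  \<comment> \<open>The bounds on \<open>w\<close> say nothing about the sign of \<open>W\<close>
    when \<open>B\<close> is empty, hence the truncation at 0.\<close>
  define W' where "W' = max W 0"
  have W'0: "W' \<ge> 0" by (simp add: W'_def)
  have cp: "c x powr p \<le> Mc powr p" for x using c[of x] p by (intro powr_mono2) auto
  have \<eta>w: "0 \<le> \<eta> x * w x" "\<eta> x * w x \<le> W'" "\<eta> x \<le> \<eta> x * w x" for x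
  proof -
    show "0 \<le> \<eta> x * w x" using \<eta>[of x] w(1)[of x] by (cases "x \<in> B") auto
    show "\<eta> x \<le> \<eta> x * w x" using \<eta>[of x] w(1)[of x] mult_left_mono[of 1 "w x" "\<eta> x"] by (cases "x \<in> B") auto
    have "\<eta> x * w x \<le> 1 * W'" if "x \<in> B" using \<eta>[of x] w[OF that] by (intro mult_mono) (auto simp: W'_def)
    then show "\<eta> x * w x \<le> W'" using \<eta>(3)[of x] W'0 by (cases "x \<in> B") auto
  qed
  have i: "integrable M (\<lambda>x. f x * d x powr p)" if [measurable]: "f \<in> borel_measurable borel" and "\<And>x. 0 \<le> f x" "\<And>x. f x \<le> C" for f C
  proof -
    have "integrable M (\<lambda>x. (f x * c x powr p) * norm (g x) powr p)"
      using that(2,3) cp by (intro integrable_powr_g[of _ "C * Mc powr p"])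
        (auto simp: abs_mult intro!: mult_mono order_trans[OF that(2) that(3)])
    then show ?thesis by (simp add: dp mult_ac)
  qed
  have nn1: "0 \<le> \<eta> x * w x * y" and le1: "\<eta> x * w x * y \<le> W' * Y"
    and nn2: "0 \<le> \<eta> x * y" and le2: "\<eta> x * y \<le> 1 * Y" if "0 \<le> y" "y \<le> Y" for x y Y
    using mult_nonneg_nonneg[OF \<eta>w(1)[of x] that(1)] mult_mono[OF \<eta>w(2)[of x] that(2) W'0 that(1)]
      mult_nonneg_nonneg[OF \<eta>(1)[of x] that(1)] mult_mono[OF \<eta>(2)[of x] that(2) zero_le_one that(1)]
    by blast+
  have h2: "0 \<le> a / 2 * h x" "a / 2 * h x \<le> a / 2 * Mh" for x
    using h a by auto
  have h3: "0 \<le> a / 2 * h x + h' x" "a / 2 * h x + h' x \<le> a / 2 * Mh + Mh" for x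
    using h2[of x] h(3,4)[of x] by linarith+
  have i2: "integrable M (\<lambda>x. (\<eta> x * w x * (a / 2 * h x)) * d x powr p)"
    by (rule i[OF _ nn1[OF h2] le1[OF h2]]) measurable
  have i3: "integrable M (\<lambda>x. (\<eta> x * w x * (a / 2 * h x + h' x)) * d x powr p)"
    by (rule i[OF _ nn1[OF h3] le1[OF h3]]) measurable
  have i4: "integrable M (\<lambda>x. (\<eta> x * (a / 2 * h x + h' x)) * d x powr p)"
    by (rule i[OF _ nn2[OF h3] le2[OF h3]]) measurable
  have iB: "integrable M (\<lambda>x. indicator B x * h x)"
    by (rule integrable_const_bound_M[of _ Mh]) (use h Mh in \<open>auto simp: indicator_def\<close>)
  have pt: "w x * h x * n x * d x powr (p - 1) \<le> (\<eta> x * w x * (a / 2 * h x)) * d x powr p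
      + W * ((a / 2) powr (1 - p) * G powr p) * (indicator B x * h x)" for x
  proof (cases "x \<in> B")
    case True
    have "d x powr (p - 1) * n x \<le> a / 2 * (\<eta> x * d x powr p) + (a / 2) powr (1 - p) * G powr p"
      by (rule young_cutoff[OF p d0 \<eta>(1) G _ n(2)]) (use a in auto)
    then have "(w x * h x) * (d x powr (p - 1) * n x) \<le> (w x * h x) * (a / 2 * (\<eta> x * d x powr p) + (a / 2) powr (1 - p) * G powr p)"
      using h(1)[of x] w(1)[OF True] by (intro mult_left_mono) auto
    also have "\<dots> = (\<eta> x * w x * (a / 2 * h x)) * d x powr p + w x * ((a / 2) powr (1 - p) * G powr p * h x)"
      by (simp add: algebra_simps)
    also have "w x * ((a / 2) powr (1 - p) * G powr p * h x) \<le> W * ((a / 2) powr (1 - p) * G powr p * h x)"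
      using h(1)[of x] w(2)[OF True] by (intro mult_right_mono) auto
    finally show ?thesis using True by (simp add: algebra_simps)
  next
    case False
    then have "n x = 0" using n[of x] \<eta>(3)[OF False] by simp
    then show ?thesis using False \<eta>(3)[OF False] by simp
  qed
  have i5: "integrable M (\<lambda>x. w x * h x * n x * d x powr (p - 1))"
  proof (rule Bochner_Integration.integrable_bound)
    show "integrable M (\<lambda>x. (\<eta> x * w x * (a / 2 * h x)) * d x powr p
      + W * ((a / 2) powr (1 - p) * G powr p) * (indicator B x * h x))"
      using i2 iB by auto
    have "0 \<le> w x * h x * n x * d x powr (p - 1)" for x
    proof (cases "x \<in> B")
      case True then show ?thesis using w(1)[OF True] h(1)[of x] n(1)[of x] by simp
    next
      case False
      then have "n x = 0" using n[of x] \<eta>(3)[OF False] by simp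
      then show ?thesis by simp
    qed
    then show "AE x in M. norm (w x * h x * n x * d x powr (p - 1)) \<le> norm ((\<eta> x * w x * (a / 2 * h x)) * d x powr p
      + W * ((a / 2) powr (1 - p) * G powr p) * (indicator B x * h x))"
      using pt by (intro AE_I2) (auto intro: order_trans[OF _ abs_ge_self])
  qed measurable
  have "(\<integral>x. w x * h x * n x * d x powr (p - 1) \<partial>M) \<le> (\<integral>x. (\<eta> x * w x * (a / 2 * h x)) * d x powr p
      + W * ((a / 2) powr (1 - p) * G powr p) * (indicator B x * h x) \<partial>M)"
    by (rule integral_mono[OF i5 _ pt]) (use i2 iB in auto)
  also have "\<dots> = (\<integral>x. (\<eta> x * w x * (a / 2 * h x)) * d x powr p \<partial>M)
     + W * ((a / 2) powr (1 - p) * G powr p) * (\<integral>x. indicator B x * h x \<partial>M)"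
    using i2 iB by simp
  finally have 1: "(\<integral>x. w x * h x * n x * d x powr (p - 1) \<partial>M) \<le> (\<integral>x. (\<eta> x * w x * (a / 2 * h x)) * d x powr p \<partial>M)
     + W * ((a / 2) powr (1 - p) * G powr p) * (\<integral>x. indicator B x * h x \<partial>M)" .
  have "(\<integral>x. (\<eta> x * w x * (a * h x + h' x)) * d x powr p \<partial>M)
     = (\<integral>x. (\<eta> x * w x * (a / 2 * h x + h' x)) * d x powr p + (\<eta> x * w x * (a / 2 * h x)) * d x powr p \<partial>M)"
    by (intro Bochner_Integration.integral_cong) (auto simp: algebra_simps)
  also have "\<dots> = (\<integral>x. (\<eta> x * w x * (a / 2 * h x + h' x)) * d x powr p \<partial>M) + (\<integral>x. (\<eta> x * w x * (a / 2 * h x)) * d x powr p \<partial>M)"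
    by (rule Bochner_Integration.integral_add[OF i3 i2])
  finally have 2: "(\<integral>x. (\<eta> x * w x * (a / 2 * h x + h' x)) * d x powr p \<partial>M)
     \<le> (W * (a / 2) powr (1 - p) * G powr p + c0) * (\<integral>x. indicator B x * h x \<partial>M)"
    using 1 le unfolding d_def[symmetric] by (simp add: algebra_simps)
  have "(\<integral>x. (\<eta> x * (a / 2 * h x + h' x)) * d x powr p \<partial>M) \<le> (\<integral>x. (\<eta> x * w x * (a / 2 * h x + h' x)) * d x powr p \<partial>M)"
    by (rule integral_mono[OF i4 i3], intro mult_right_mono \<eta>w h3) auto
  with 2 show 3: "(\<integral>x. \<eta> x * (a / 2 * h x + h' x) * (c x * norm (g x)) powr p \<partial>M)
     \<le> (W * (a / 2) powr (1 - p) * G powr p + c0) * (\<integral>x. indicator B x * h x \<partial>M)" by (simp add: d_def)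
  have i6: "integrable M (\<lambda>x. \<eta> x * h' x * d x powr p)"
    by (rule i[OF _ nn2[OF h(3,4)] le2[OF h(3,4)]]) measurable
  have "(\<integral>x. \<eta> x * h' x * d x powr p \<partial>M) \<le> (\<integral>x. (\<eta> x * (a / 2 * h x + h' x)) * d x powr p \<partial>M)"
    using \<eta>(1) h2(1) by (intro integral_mono[OF i6 i4] mult_right_mono mult_left_mono) auto
  with 3 show "(\<integral>x. \<eta> x * h' x * (c x * norm (g x)) powr p \<partial>M)
     \<le> (W * (a / 2) powr (1 - p) * G powr p + c0) * (\<integral>x. indicator B x * h x \<partial>M)" by (simp add: d_def)
qed

end

lemma is_cutoffD:
  assumes "is_cutoff q C x0 \<rho> \<sigma> \<eta>"
  shows "smooth_fun \<eta>" "0 \<le> \<eta> x" "\<eta> x \<le> 1" "norm (x - x0) \<le> \<rho> \<Longrightarrow> \<eta> x = 1" "x \<notin> ball x0 \<sigma> \<Longrightarrow> \<eta> x = 0"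
    "norm (grad \<eta> x) \<le> C / (\<sigma> - \<rho>) * \<eta> x powr ((q - 1) / q)"
  using assms by (auto simp: is_cutoff_def dist_norm norm_minus_commute not_less)

lemma is_cutoff_grad_bound:
  assumes "is_cutoff q C x0 \<rho> \<sigma> \<eta>" "C \<ge> 0" "\<rho> < \<sigma>" "q > 1"
  shows "norm (grad \<eta> x) \<le> C / (\<sigma> - \<rho>) * indicator (ball x0 \<sigma>) x"
proof (cases "x \<in> ball x0 \<sigma>")
  case True
  have "\<eta> x powr ((q - 1) / q) \<le> 1"
    using powr_mono2[of "(q - 1) / q" "\<eta> x" 1] is_cutoffD(2,3)[OF assms(1), of x] assms(4) by simp
  then have "C / (\<sigma> - \<rho>) * \<eta> x powr ((q - 1) / q) \<le> C / (\<sigma> - \<rho>) * 1"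
    using assms by (intro mult_left_mono) auto
  then show ?thesis using is_cutoffD(6)[OF assms(1), of x] True by simp
next
  case False
  then show ?thesis using is_cutoffD(5,6)[OF assms(1), of x] by simp
qed

lemma is_cutoff_bounded:
  assumes "is_cutoff q C x0 \<rho> \<sigma> \<eta>" "C \<ge> 0" "\<rho> < \<sigma>" "q > 1"
  shows "\<bar>\<eta> x\<bar> \<le> max 1 (C / (\<sigma> - \<rho>))" "norm (grad \<eta> x) \<le> max 1 (C / (\<sigma> - \<rho>))"
proof -
  show "\<bar>\<eta> x\<bar> \<le> max 1 (C / (\<sigma> - \<rho>))" using is_cutoffD(2,3)[OF assms(1), of x] by simp
  have "C / (\<sigma> - \<rho>) * indicator (ball x0 \<sigma>) x \<le> C / (\<sigma> - \<rho>) * 1"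
    using assms by (intro mult_left_mono) auto
  then show "norm (grad \<eta> x) \<le> max 1 (C / (\<sigma> - \<rho>))" using is_cutoff_grad_bound[OF assms, of x] by simp
qed

lemma is_cutoff_support:
  assumes "is_cutoff q C x0 \<rho> \<sigma> \<eta>" "cball x0 \<sigma> \<subseteq> \<Omega>"
  shows "compact (closure {x. \<eta> x \<noteq> 0}) \<and> closure {x. \<eta> x \<noteq> 0} \<subseteq> \<Omega>"
proof -
  have "{x. \<eta> x \<noteq> 0} \<subseteq> cball x0 \<sigma>" using is_cutoffD(5)[OF assms(1)] ball_subset_cball by blast
  then have cl: "closure {x. \<eta> x \<noteq> 0} \<subseteq> cball x0 \<sigma>" by (rule closure_minimal) simp
  then have "bounded (closure {x. \<eta> x \<noteq> 0})" using bounded_cball bounded_subset by blast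
  then show ?thesis using cl assms(2) by (auto simp: compact_eq_bounded_closed)
qed

text \<open>Young's inequality with parameter \<open>1 / r\<close>. It trades the \<open>L1\<close>
  norm of a gradient, which \<open>faber_krahn_L1\<close> asks for, against the energy that the
  equation controls; the cost \<open>1 / r\<close> has the dimension of a gradient and is later
  integrated over a superlevel set.\<close>

lemma powr_interpolate:
  fixes a r p :: real
  assumes "a \<ge> 0" "r > 0" "p > 1"
  shows "a \<le> r powr (p - 1) * a powr p + 1 / r"
proof -
  have "a = 1 powr (p - 1) * a" by simp
  also have "\<dots> \<le> 1 / r * 1 powr p + (1 / r) powr (1 - p) * a powr p"
    by (rule young_powr) (use assms in auto)
  also have "(1 / r) powr (1 - p) = r powr (p - 1)"
    using assms by (simp add: powr_divide powr_diff)
  finally show ?thesis by simp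
qed

text \<open>Extension by 0 makes integrals over \<open>M\<close> and over the whole space agree for
  every expression that vanishes with \<open>g\<close>, so balls may cross the boundary of
  \<open>\<Omega>\<close>.\<close>

locale unweighted_solution = weak_solution +
  assumes M_eq: "M = density lborel (indicator \<Omega>)" and \<Omega>_open: "open \<Omega>"
    and off_u: "\<And>x. x \<notin> \<Omega> \<Longrightarrow> u x = 0" and off_g: "\<And>x. x \<notin> \<Omega> \<Longrightarrow> g x = 0"
begin

lemma \<Omega>_borel [measurable]: "\<Omega> \<in> sets borel"
  using \<Omega>_open by simp

lemma M_eq': "M = density lborel (\<lambda>x. ennreal (indicator \<Omega> x))"
  by (simp add: M_eq ennreal_indicator)

lemma integrable_M_iff:
  fixes f :: "'a \<Rightarrow> real"
  assumes [measurable]: "f \<in> borel_measurable borel" and "\<And>x. x \<notin> \<Omega> \<Longrightarrow> f x = 0"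
  shows "integrable M f \<longleftrightarrow> integrable lborel f" "(\<integral>x. f x \<partial>M) = (\<integral>x. f x \<partial>lborel)"
proof -
  have eq: "indicator \<Omega> x * f x = f x" for x using assms(2) by (cases "x \<in> \<Omega>") auto
  show "integrable M f \<longleftrightarrow> integrable lborel f"
    unfolding M_eq' by (subst integrable_density) (auto simp: eq)
  show "(\<integral>x. f x \<partial>M) = (\<integral>x. f x \<partial>lborel)"
    unfolding M_eq' by (subst integral_density) (auto simp: eq)
qed

lemma integral_M_le:
  fixes f :: "'a \<Rightarrow> real"
  assumes [measurable]: "f \<in> borel_measurable borel" and "\<And>x. 0 \<le> f x" "integrable lborel f"
  shows "(\<integral>x. f x \<partial>M) \<le> (\<integral>x. f x \<partial>lborel)"
proof -
  have "(\<integral>x. f x \<partial>M) = (\<integral>x. indicator \<Omega> x * f x \<partial>lborel)"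
    unfolding M_eq' by (subst integral_density) auto
  also have "\<dots> \<le> (\<integral>x. f x \<partial>lborel)"
  proof (rule integral_mono[OF _ assms(3)])
    show "integrable lborel (\<lambda>x. indicator \<Omega> x * f x)"
      by (rule Bochner_Integration.integrable_bound[OF assms(3)]) (auto simp: indicator_def)
  qed (use assms in \<open>auto simp: indicator_def\<close>)
  finally show ?thesis .
qed

lemma translation_estimate:
  assumes K: "\<And>t. t \<in> {0..1} \<Longrightarrow> (K has_real_derivative k t) (at t within {0..1})" and k: "continuous_on {0..1} k"
    and \<eta>: "smooth_fun \<eta>" "\<And>x. \<bar>\<eta> x\<bar> \<le> C\<eta>" "\<And>x. norm (grad \<eta> x) \<le> C\<eta>"
    and B: "convex B" "B \<in> sets borel"
  shows "(\<integral>\<^sup>+x. indicator B x * indicator B (x + h) * ennreal \<bar>\<eta> (x + h) * K (u (x + h)) - \<eta> x * K (u x)\<bar> \<partial>lborel)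
    \<le> ennreal (norm h) * (\<integral>\<^sup>+x. indicator B x * ennreal (norm (K (u x) *\<^sub>R grad \<eta> x + (\<eta> x * k (u x)) *\<^sub>R g x)) \<partial>lborel)"
proof -
  obtain K' k' C where ext: "\<And>t. (K' has_real_derivative k' t) (at t)" "continuous_on UNIV k'"
    "\<And>t. \<bar>k' t\<bar> \<le> C" "\<And>t. t \<in> {0..1} \<Longrightarrow> K' t = K t" "\<And>t. t \<in> {0..1} \<Longrightarrow> k' t = k t"
    using extend_C1_unit_interval[OF K k] by metis
  have ux: "u x \<in> {0..1}" for x using u_nonneg u_le_1 by auto
  show ?thesis
    using translation_estimate_UNIV[OF M_eq \<Omega>_borel off_u off_g ext(1-3) \<eta> B, of h]
    unfolding ext(4)[OF ux] ext(5)[OF ux] .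
qed

text \<open>\<open>faber_krahn_L1\<close> is applied to the cutoff times the ramp of
  \<open>F u - k\<close>, which lives on the superlevel set inside the larger ball. Its gradient
  consists of a cutoff part of order \<open>1 / (\<sigma> - \<rho>)\<close> and a part whose energy
  is bounded by \<open>cacc\<close>. \<open>F\<close> is arbitrary because a logarithm of
  \<open>1 - u + \<delta>\<close> and a multiple of \<open>1 - u\<close> are both needed.\<close>

lemma dg_ineq_of_caccioppoli:
  assumes F: "\<And>t. t \<in> {0..1} \<Longrightarrow> (F has_real_derivative F' t) (at t within {0..1})" and F': "continuous_on {0..1} F'"
    and r: "r > 0" and Cc: "Cc \<ge> 0" and C1: "C1 \<ge> 0"
    and cut: "\<And>\<rho> \<sigma>. 0 < \<rho> \<Longrightarrow> \<rho> < \<sigma> \<Longrightarrow> \<exists>\<eta>. is_cutoff p Cc x0 \<rho> \<sigma> \<eta>"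
    and cacc: "\<And>k \<delta> \<rho> \<sigma> \<eta>. k0 \<le> k \<Longrightarrow> 0 < \<delta> \<Longrightarrow> r / 2 \<le> \<rho> \<Longrightarrow> \<rho> < \<sigma> \<Longrightarrow> \<sigma> \<le> r \<Longrightarrow> is_cutoff p Cc x0 \<rho> \<sigma> \<eta> \<Longrightarrow>
      (\<integral>x. \<eta> x * ramp' \<delta> (F (u x) - k) * (\<bar>F' (u x)\<bar> * norm (g x)) powr p \<partial>M)
        \<le> C1 * (\<sigma> - \<rho>) powr (- p) * (\<integral>x. indicator (ball x0 \<sigma>) x * ramp \<delta> (F (u x) - k) \<partial>lborel)"
  shows "dg_ineq (2 * (2 / unit_ball_vol (real DIM('a))) powr (1 / real DIM('a)) * (Cc + C1 + 1)) p x0 r k0 (\<lambda>x. F (u x))"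
  unfolding dg_ineq_def
proof (intro allI impI, elim conjE)
  fix k \<delta> \<rho> \<sigma> :: real assume kd: "k0 \<le> k" "0 < \<delta>" and rs: "r / 2 \<le> \<rho>" "\<rho> < \<sigma>" "\<sigma> \<le> r"
  let ?B = "ball x0 \<sigma>"
  define A where "A = {x \<in> ?B. k < F (u x)}"
  define V where "V = measure lborel A"
  define \<omega>N where "\<omega>N = unit_ball_vol (real DIM('a))"
  have \<omega>N: "\<omega>N > 0" by (simp add: \<omega>N_def)
  have \<rho>: "\<rho> > 0" using r rs by simp
  obtain \<eta> where \<eta>: "is_cutoff p Cc x0 \<rho> \<sigma> \<eta>" using cut[OF \<rho> rs(2)] by blast
  note \<eta>D = is_cutoffD[OF \<eta>]
  have [measurable]: "ball y s \<in> sets borel" for y :: 'a and s by simp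
  note [measurable] = smooth_fun_measurable[OF \<eta>D(1)] grad_measurable[OF \<eta>D(1)]
  have cF: "continuous_on {0..1} F" by (rule DERIV_continuous_on[OF F])
  note [measurable] = continuous_comp_u(1)[OF cF] continuous_comp_u(1)[OF F']
  obtain CF where CF: "\<And>x. \<bar>F (u x)\<bar> \<le> CF" using continuous_comp_u(2)[OF cF] by blast
  obtain CF' where CF': "\<And>x. \<bar>F' (u x)\<bar> \<le> CF'" using continuous_comp_u(2)[OF F'] by blast
  define h where "h x = ramp \<delta> (F (u x) - k)" for x
  define h' where "h' x = ramp' \<delta> (F (u x) - k)" for x
  define d where "d x = \<bar>F' (u x)\<bar> * norm (g x)" for x
  have [measurable]: "h \<in> borel_measurable borel" "h' \<in> borel_measurable borel" "d \<in> borel_measurable borel"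
    unfolding h_def h'_def d_def by measurable
  have hb: "0 \<le> h x" "h x \<le> max 0 (F (u x) - k)" "max 0 (F (u x) - k - \<delta>) \<le> h x" "0 \<le> h' x" "h' x \<le> 1"
      "F (u x) \<le> k \<Longrightarrow> h x = 0" "F (u x) \<le> k \<Longrightarrow> h' x = 0" for x
    using ramp_bounds[OF kd(2), of "F (u x) - k"] by (auto simp: h_def h'_def)
  have [measurable]: "A \<in> sets borel" unfolding A_def by measurable
  have "emeasure lborel A \<le> emeasure lborel ?B" unfolding A_def by (rule emeasure_mono) auto
  also have "\<dots> < \<infinity>" by (rule emeasure_lborel_ball_finite)
  finally have A_fin: "emeasure lborel A < \<infinity>" .
  have V: "emeasure lborel A = ennreal V" "V \<ge> 0"
    using A_fin by (auto simp: V_def emeasure_eq_ennreal_measure)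
  have g\<eta>: "norm (grad \<eta> x) \<le> Cc / (\<sigma> - \<rho>) * indicator ?B x" for x
    by (rule is_cutoff_grad_bound[OF \<eta> Cc rs(2) p])
  note \<eta>12 = is_cutoff_bounded[OF \<eta> Cc rs(2) p]
  define D where "D x = h x *\<^sub>R grad \<eta> x + (\<eta> x * (h' x * F' (u x))) *\<^sub>R g x" for x
  have T: "(\<integral>\<^sup>+x. ennreal \<bar>\<eta> (x + y) * h (x + y) - \<eta> x * h x\<bar> \<partial>lborel) \<le> ennreal (norm y) * (\<integral>\<^sup>+x. ennreal (norm (D x)) \<partial>lborel)" for y
  proof -
    have dK: "((\<lambda>t. ramp \<delta> (F t - k)) has_real_derivative ramp' \<delta> (F t - k) * F' t) (at t within {0..1})" if "t \<in> {0..1}" for t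
    proof -
      have "((\<lambda>t. F t - k) has_real_derivative F' t) (at t within {0..1})"
        using DERIV_diff[OF F[OF that] DERIV_const[of k]] by simp
      then show ?thesis by (rule DERIV_chain2[OF ramp_deriv[OF kd(2)]])
    qed
    have ck: "continuous_on {0..1} (\<lambda>t. ramp' \<delta> (F t - k) * F' t)"
      by (intro continuous_on_mult F' continuous_on_compose2[OF ramp'_continuous[OF kd(2)]] continuous_intros cF) auto
    show ?thesis
      using translation_estimate[OF dK ck \<eta>D(1) \<eta>12, of UNIV y] by (simp add: h_def h'_def D_def)
  qed
  have FK: "(\<integral>\<^sup>+x. ennreal (\<eta> x * h x) \<partial>lborel) \<le> ennreal (2 * (2 * V / \<omega>N) powr (1 / real DIM('a))) * (\<integral>\<^sup>+x. ennreal (norm (D x)) \<partial>lborel)"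
    unfolding \<omega>N_def
  proof (rule faber_krahn_L1[where E = A])
    show "\<eta> x * h x = 0" if "x \<notin> A" for x
      using that hb(6)[of x] \<eta>D(5)[of x] by (cases "x \<in> ?B") (auto simp: A_def)
    show "0 \<le> \<eta> x * h x" for x using hb \<eta>D by simp
  qed (use T V in auto)
  define J where "J = (\<integral>x. indicator ?B x * max 0 (F (u x) - k) \<partial>lborel)"
  have iJ: "integrable lborel (\<lambda>x. indicator ?B x * max 0 (F (u x) - k))"
  proof (rule integrable_on_ball)
    show "\<bar>max 0 (F (u x) - k)\<bar> \<le> CF + \<bar>k\<bar>" for x using CF[of x] by linarith
  qed measurable
  have hle: "\<bar>h x\<bar> \<le> CF + \<bar>k\<bar>" for x using hb(1,2)[of x] CF[of x] by linarith
  have ih: "integrable lborel (\<lambda>x. indicator ?B x * h x)"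
    by (rule integrable_on_ball[OF _ hle]) measurable
  have hJ: "(\<integral>x. indicator ?B x * h x \<partial>lborel) \<le> J"
    unfolding J_def by (rule integral_mono[OF ih iJ]) (use hb in \<open>auto simp: indicator_def\<close>)
  have J0: "J \<ge> 0" unfolding J_def by (rule Bochner_Integration.integral_nonneg) auto
  have dp: "d x powr p = \<bar>F' (u x)\<bar> powr p * norm (g x) powr p" for x by (simp add: d_def powr_mult)
  have off_d: "x \<notin> \<Omega> \<Longrightarrow> \<eta> x * h' x * d x powr p = 0" for x using off_g by (simp add: d_def)
  have idM: "integrable M (\<lambda>x. \<eta> x * h' x * d x powr p)"
  proof -
    have "integrable M (\<lambda>x. (\<eta> x * h' x * \<bar>F' (u x)\<bar> powr p) * norm (g x) powr p)"
    proof (rule integrable_powr_g)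
      show "\<bar>\<eta> x * h' x * \<bar>F' (u x)\<bar> powr p\<bar> \<le> 1 * 1 * CF' powr p" for x
        unfolding abs_mult using \<eta>D(2,3)[of x] hb(4,5)[of x] CF'[of x] p
        by (intro mult_mono) (auto intro!: powr_mono2)
    qed measurable
    then show ?thesis by (simp add: dp mult_ac)
  qed
  have id: "integrable lborel (\<lambda>x. \<eta> x * h' x * d x powr p)"
    using idM by (subst (asm) integrable_M_iff(1)) (use off_d in auto)
  have dJ: "(\<integral>x. \<eta> x * h' x * d x powr p \<partial>lborel) \<le> C1 * (\<sigma> - \<rho>) powr (- p) * J"
  proof -
    have "(\<integral>x. \<eta> x * h' x * d x powr p \<partial>lborel) = (\<integral>x. \<eta> x * h' x * d x powr p \<partial>M)"
      by (rule integrable_M_iff(2)[symmetric]) (use off_d in auto)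
    also have "\<dots> \<le> C1 * (\<sigma> - \<rho>) powr (- p) * (\<integral>x. indicator ?B x * h x \<partial>lborel)"
      unfolding h_def h'_def d_def by (rule cacc[OF kd rs \<eta>])
    also have "\<dots> \<le> C1 * (\<sigma> - \<rho>) powr (- p) * J" using C1 by (intro mult_left_mono hJ) auto
    finally show ?thesis .
  qed
  \<comment> \<open>A pointwise majorant of \<open>norm (D x)\<close>: the second and third summand
    come from \<open>powr_interpolate\<close>, whose constant \<open>1 / r\<close> matters only on
    \<open>A\<close>, because \<open>\<eta> * h'\<close> vanishes elsewhere.\<close>
  define R where "R x = Cc / (\<sigma> - \<rho>) * (indicator ?B x * h x) + r powr (p - 1) * (\<eta> x * h' x * d x powr p) + 1 / r * indicator A x" for x
  have iA: "integrable lborel (indicator A :: 'a \<Rightarrow> real)"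
    by (rule integrable_real_indicator) (use A_fin in auto)
  have iR: "integrable lborel R"
    unfolding R_def using ih id iA by (intro Bochner_Integration.integrable_add integrable_mult_right)
  have DR: "norm (D x) \<le> R x" for x
  proof -
    have "norm (D x) \<le> h x * norm (grad \<eta> x) + (\<eta> x * h' x) * d x"
      unfolding D_def using hb(1,4)[of x] \<eta>D(2)[of x]
      by (intro norm_triangle_mono) (auto simp: abs_mult d_def)
    also have "h x * norm (grad \<eta> x) \<le> h x * (Cc / (\<sigma> - \<rho>) * indicator ?B x)"
      using hb(1)[of x] by (intro mult_left_mono g\<eta>)
    also have "(\<eta> x * h' x) * d x \<le> r powr (p - 1) * (\<eta> x * h' x * d x powr p) + 1 / r * indicator A x"
    proof (cases "x \<in> A")
      case True
      have "(\<eta> x * h' x) * d x \<le> (\<eta> x * h' x) * (r powr (p - 1) * d x powr p + 1 / r)"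
        using hb(4)[of x] \<eta>D(2)[of x] r p by (intro mult_left_mono powr_interpolate) (auto simp: d_def)
      also have "\<dots> = r powr (p - 1) * (\<eta> x * h' x * d x powr p) + (\<eta> x * h' x) * (1 / r)"
        by (simp add: algebra_simps)
      also have "(\<eta> x * h' x) * (1 / r) \<le> (1 * 1) * (1 / r)"
        using hb(4,5)[of x] \<eta>D(2,3)[of x] r by (intro mult_right_mono mult_mono) auto
      finally show ?thesis using True by simp
    next
      case False
      then have "\<eta> x * h' x = 0" using hb(7)[of x] \<eta>D(5)[of x] by (cases "x \<in> ?B") (auto simp: A_def)
      then show ?thesis using False by auto
    qed
    finally show ?thesis by (simp add: R_def algebra_simps)
  qed
  have "(\<integral>\<^sup>+x. ennreal (norm (D x)) \<partial>lborel) \<le> (\<integral>\<^sup>+x. ennreal (R x) \<partial>lborel)"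
    by (intro nn_integral_mono ennreal_leI DR)
  also have "\<dots> = ennreal (\<integral>x. R x \<partial>lborel)"
    using order_trans[OF norm_ge_zero DR] by (intro nn_integral_eq_integral[OF iR]) auto
  also have "(\<integral>x. R x \<partial>lborel) = Cc / (\<sigma> - \<rho>) * (\<integral>x. indicator ?B x * h x \<partial>lborel)
      + r powr (p - 1) * (\<integral>x. \<eta> x * h' x * d x powr p \<partial>lborel) + 1 / r * V"
    unfolding R_def V_def using ih id iA by simp
  also have "\<dots> \<le> Cc * (r powr (p - 1) * (\<sigma> - \<rho>) powr (- p)) * J + r powr (p - 1) * (C1 * (\<sigma> - \<rho>) powr (- p) * J) + 1 / r * V"
  proof -
    \<comment> \<open>Since \<open>\<sigma> - \<rho> \<le> r\<close>, the cutoff part can be written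
      with the same factor as the energy part.\<close>
    have "1 / (\<sigma> - \<rho>) \<le> r powr (p - 1) * (\<sigma> - \<rho>) powr (- p)"
    proof -
      have "(\<sigma> - \<rho>) powr (p - 1) * (\<sigma> - \<rho>) powr (- p) \<le> r powr (p - 1) * (\<sigma> - \<rho>) powr (- p)"
        using rs r p \<rho> by (intro mult_right_mono powr_mono2) auto
      moreover have "(\<sigma> - \<rho>) powr (p - 1) * (\<sigma> - \<rho>) powr (- p) = (\<sigma> - \<rho>) powr (- 1)"
        by (simp flip: powr_add)
      ultimately show ?thesis using rs by (simp add: powr_minus_divide)
    qed
    then have "Cc * (1 / (\<sigma> - \<rho>)) \<le> Cc * (r powr (p - 1) * (\<sigma> - \<rho>) powr (- p))" using Cc by (intro mult_left_mono)
    then have "Cc / (\<sigma> - \<rho>) * (\<integral>x. indicator ?B x * h x \<partial>lborel) \<le> Cc * (r powr (p - 1) * (\<sigma> - \<rho>) powr (- p)) * J"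
      using hJ Cc hb(1) by (intro mult_mono) (auto intro!: Bochner_Integration.integral_nonneg)
    then show ?thesis using mult_left_mono[OF dJ, of "r powr (p - 1)"] by auto
  qed
  also have "\<dots> \<le> (Cc + C1 + 1) * (r powr (p - 1) * (\<sigma> - \<rho>) powr (- p) * J + V / r)"
  proof -
    define X where "X = r powr (p - 1) * (\<sigma> - \<rho>) powr (- p) * J"
    define Y where "Y = V / r"
    have "0 \<le> (Cc + C1) * Y" "0 \<le> X" using Cc C1 V r J0 by (auto simp: X_def Y_def)
    then have "Cc * X + C1 * X + Y \<le> (Cc + C1 + 1) * (X + Y)" by (simp add: algebra_simps)
    then show ?thesis by (simp add: X_def Y_def mult_ac)
  qed
  finally have D_le: "(\<integral>\<^sup>+x. ennreal (norm (D x)) \<partial>lborel) \<le> ennreal ((Cc + C1 + 1) * (r powr (p - 1) * (\<sigma> - \<rho>) powr (- p) * J + V / r))"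
    by (simp add: ennreal_leI)
  have i\<eta>h: "integrable lborel (\<lambda>x. \<eta> x * h x)"
  proof (rule Bochner_Integration.integrable_bound[OF ih])
    have "\<eta> x * h x \<le> indicator ?B x * h x" for x
      using \<eta>D(2,3,5)[of x] hb(1)[of x] by (cases "x \<in> ?B") (auto intro: mult_left_le_one_le)
    then show "AE x in lborel. norm (\<eta> x * h x) \<le> norm (indicator ?B x * h x)"
      using \<eta>D(2) hb(1) by (intro AE_I2) (simp add: abs_mult)
  qed measurable
  have "ennreal (\<integral>x. \<eta> x * h x \<partial>lborel) = (\<integral>\<^sup>+x. ennreal (\<eta> x * h x) \<partial>lborel)"
    using i\<eta>h \<eta>D(2) hb(1) by (intro nn_integral_eq_integral[symmetric]) auto
  also have "\<dots> \<le> ennreal (2 * (2 * V / \<omega>N) powr (1 / real DIM('a))) * (\<integral>\<^sup>+x. ennreal (norm (D x)) \<partial>lborel)"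
    by (rule FK)
  also have "\<dots> \<le> ennreal (2 * (2 * V / \<omega>N) powr (1 / real DIM('a))) * ennreal ((Cc + C1 + 1) * (r powr (p - 1) * (\<sigma> - \<rho>) powr (- p) * J + V / r))"
    by (intro mult_left_mono D_le) auto
  also have "\<dots> = ennreal (2 * (2 * V / \<omega>N) powr (1 / real DIM('a)) * ((Cc + C1 + 1) * (r powr (p - 1) * (\<sigma> - \<rho>) powr (- p) * J + V / r)))"
    by (rule ennreal_mult'[symmetric]) (use Cc C1 J0 V r in auto)
  finally have "(\<integral>x. \<eta> x * h x \<partial>lborel) \<le> 2 * (2 * V / \<omega>N) powr (1 / real DIM('a)) * ((Cc + C1 + 1) * (r powr (p - 1) * (\<sigma> - \<rho>) powr (- p) * J + V / r))"
    using Cc C1 J0 V r by (subst (asm) ennreal_le_iff) auto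
  moreover have "(2 * V / \<omega>N) powr (1 / real DIM('a)) = (2 / \<omega>N) powr (1 / real DIM('a)) * V powr (1 / real DIM('a))"
    using V \<omega>N powr_mult[of "2 / \<omega>N" V "1 / real DIM('a)"] by simp
  moreover have "(\<integral>x. indicator (ball x0 \<rho>) x * max 0 (F (u x) - k - \<delta>) \<partial>lborel) \<le> (\<integral>x. \<eta> x * h x \<partial>lborel)"
  proof (rule integral_mono[OF _ i\<eta>h])
    show "integrable lborel (\<lambda>x. indicator (ball x0 \<rho>) x * max 0 (F (u x) - k - \<delta>))"
    proof (rule integrable_on_ball)
      show "\<bar>max 0 (F (u x) - k - \<delta>)\<bar> \<le> CF + \<bar>k\<bar> + \<delta>" for x using CF[of x] kd by linarith
    qed measurable
    show "indicator (ball x0 \<rho>) x * max 0 (F (u x) - k - \<delta>) \<le> \<eta> x * h x" for x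
    proof (cases "x \<in> ball x0 \<rho>")
      case True
      then have "\<eta> x = 1" by (intro \<eta>D(4)) (auto simp: dist_norm norm_minus_commute)
      then show ?thesis using True hb(3)[of x] by simp
    next
      case False
      then show ?thesis using \<eta>D(2)[of x] hb(1)[of x] by simp
    qed
  qed
  ultimately show "(\<integral>x. indicator (ball x0 \<rho>) x * max 0 (F (u x) - k - \<delta>) \<partial>lborel) \<le>
       2 * (2 / unit_ball_vol (real DIM('a))) powr (1 / real DIM('a)) * (Cc + C1 + 1) *
       measure lborel {x \<in> ball x0 \<sigma>. k < F (u x)} powr (1 / real DIM('a)) *
       (r powr (p - 1) * (\<sigma> - \<rho>) powr - p * (\<integral>x. indicator (ball x0 \<sigma>) x * max 0 (F (u x) - k) \<partial>lborel)
         + measure lborel {x \<in> ball x0 \<sigma>. k < F (u x)} / r)"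
    unfolding J_def[symmetric] A_def[symmetric] V_def[symmetric] \<omega>N_def[symmetric] by (simp add: mult_ac)
qed

end

subsection \<open>The weak Harnack inequality\<close>

context unweighted_solution begin

text \<open>Testing with \<open>(1 - u + \<delta>) powr (1 - p) * h\<close> gives an energy bound for \<open>ln (1 - u + \<delta>)\<close>, the function
  \<open>1 - u\<close> being a supersolution up to a bounded right-hand side. The choice of \<open>\<delta>\<close> means
  \<open>\<delta> powr (1 - p) = r powr (- p)\<close>, so this right-hand side scales like the gradient of the cutoff.\<close>

lemma log_energy:
  fixes K h h' :: "real \<Rightarrow> real"
  assumes r: "0 < r" and \<delta>: "\<delta> = r powr (p / (p - 1))" and Cc: "Cc \<ge> 0"
    and cut: "is_cutoff p Cc x0 \<rho> \<sigma> \<eta>" and rs: "0 < \<rho>" "\<rho> < \<sigma>" "\<sigma> - \<rho> \<le> r"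
    and K: "\<And>t. t \<in> {0..1} \<Longrightarrow> (K has_real_derivative (1 - t + \<delta>) powr (- p) * ((p - 1) * h t + h' t)) (at t within {0..1})"
    and h: "continuous_on {0..1} h" "\<And>t. 0 \<le> h t" and h': "continuous_on {0..1} h'" "\<And>t. 0 \<le> h' t"
    and K0: "K 0 = 0" and Kb: "\<And>t. t \<in> {0..1} \<Longrightarrow> 0 \<le> K t" "\<And>t. t \<in> {0..1} \<Longrightarrow> K t \<le> (1 - t + \<delta>) powr (1 - p) * h t"
  shows "(\<integral>x. \<eta> x * ((p - 1) / 2 * h (u x) + h' (u x)) * (1 / (1 - u x + \<delta>) * norm (g x)) powr p \<partial>M)
      \<le> (((p - 1) / 2) powr (1 - p) * Cc powr p + \<bar>lam\<bar>) * (\<sigma> - \<rho>) powr (- p) * (\<integral>x. indicator (ball x0 \<sigma>) x * h (u x) \<partial>lborel)"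
    and "(\<integral>x. \<eta> x * h' (u x) * (1 / (1 - u x + \<delta>) * norm (g x)) powr p \<partial>M)
      \<le> (((p - 1) / 2) powr (1 - p) * Cc powr p + \<bar>lam\<bar>) * (\<sigma> - \<rho>) powr (- p) * (\<integral>x. indicator (ball x0 \<sigma>) x * h (u x) \<partial>lborel)"
proof -
  note \<eta>D = is_cutoffD[OF cut]
  have [measurable]: "ball y s \<in> sets borel" for y :: 'a and s by simp
  let ?B = "ball x0 \<sigma>"
  have \<delta>0: "\<delta> > 0" using r \<delta> by simp
  define V where "V t = 1 - t + \<delta>" for t
  have V: "V (u x) \<ge> \<delta>" "V (u x) > 0" for x using u_le_1[of x] \<delta>0 by (auto simp: V_def)
  have ux: "u x \<in> {0..1}" for x using u_nonneg u_le_1 by auto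
  define k where "k t = V t powr (- p) * ((p - 1) * h t + h' t)" for t
  have cV: "continuous_on {0..1} (\<lambda>t. V t powr s)" for s
    unfolding V_def using \<delta>0 by (intro continuous_intros) auto
  have ck: "continuous_on {0..1} k"
    unfolding k_def by (intro continuous_intros cV h h')
  have Kd: "(K has_real_derivative k t) (at t within {0..1})" if "t \<in> {0..1}" for t
    using K[OF that] by (simp add: k_def V_def)
  have cK: "continuous_on {0..1} K" by (rule DERIV_continuous_on[OF Kd])
  obtain Mh where Mh: "\<And>x. \<bar>h (u x)\<bar> \<le> Mh" using continuous_comp_u(2)[OF h(1)] by blast
  obtain Mh' where Mh': "\<And>x. \<bar>h' (u x)\<bar> \<le> Mh'" using continuous_comp_u(2)[OF h'(1)] by blast
  note [measurable] = smooth_fun_measurable[OF \<eta>D(1)] grad_measurable[OF \<eta>D(1)]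
    continuous_comp_u(1)[OF h(1)] continuous_comp_u(1)[OF h'(1)] continuous_comp_u(1)[OF cK]
  note \<eta>12 = is_cutoff_bounded[OF cut Cc rs(2) p]
  define C\<eta> where "C\<eta> = max 1 (Cc / (\<sigma> - \<rho>))"
  note en = energy_estimate[OF Kd ck \<eta>D(1) \<eta>12 disjI1[OF K0]]
  \<comment> \<open>\<open>c x * norm (g x)\<close> is the length of the gradient of
    \<open>ln (1 - u + \<delta>)\<close>; all gradients are expressed by it from here on.\<close>
  define c where "c x = 1 / V (u x)" for x
  have [measurable]: "c \<in> borel_measurable borel" unfolding c_def V_def by measurable
  have cb: "0 \<le> c x" "c x \<le> 1 / \<delta>" for x using V[of x] \<delta>0 by (auto simp: c_def frac_le)
  have cp: "(c x * norm (g x)) powr s = V (u x) powr (- s) * norm (g x) powr s" for x s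
    using V[of x] by (simp add: c_def powr_mult powr_divide powr_minus_divide)
  have ih: "integrable lborel (\<lambda>x. indicator ?B x * h (u x))"
    by (rule integrable_on_ball[OF _ Mh]) measurable
  have ihM: "integrable M (\<lambda>x. indicator ?B x * h (u x))"
    using Mh h(2) by (intro integrable_const_bound_M[of _ Mh]) (auto simp: indicator_def intro: order_trans[OF _ Mh] order_trans[OF abs_ge_zero Mh])
  have \<delta>p: "\<delta> powr (1 - p) = r powr (- p)" 
  proof -
    have "p / (p - 1) * (1 - p) = - (p / (p - 1) * (p - 1))" by (simp only: minus_mult_right) simp
    also have "\<dots> = - p" using p by simp
    finally show ?thesis unfolding \<delta> powr_powr by simp
  qed
  have l1: "lam * (\<integral>x. u x powr (p - 1) * (\<eta> x * K (u x)) \<partial>M) \<le> \<bar>lam\<bar> * r powr (- p) * (\<integral>x. indicator ?B x * h (u x) \<partial>M)"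
  proof -
    have pt: "0 \<le> u x powr (p - 1) * (\<eta> x * K (u x))"
       "u x powr (p - 1) * (\<eta> x * K (u x)) \<le> r powr (- p) * (indicator ?B x * h (u x))" for x
    proof -
      show "0 \<le> u x powr (p - 1) * (\<eta> x * K (u x))" using \<eta>D(2)[of x] Kb(1)[OF ux[of x]] by simp
      have u1: "u x powr (p - 1) \<le> 1" using powr_mono2[of "p - 1" "u x" 1] p u_nonneg[of x] u_le_1[of x] by simp
      have "V (u x) powr (1 - p) \<le> \<delta> powr (1 - p)" using V[of x] \<delta>0 p by (intro powr_mono2') auto
      then have "K (u x) \<le> \<delta> powr (1 - p) * h (u x)"
        using Kb(2)[OF ux[of x]] h(2)[of "u x"] mult_right_mono[of "V (u x) powr (1 - p)" "\<delta> powr (1 - p)" "h (u x)"] by (simp add: V_def)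
      then have "\<eta> x * K (u x) \<le> indicator ?B x * (\<delta> powr (1 - p) * h (u x))"
        using \<eta>D(2,3,5)[of x] Kb(1)[OF ux[of x]] mult_mono[of "\<eta> x" 1 "K (u x)" "\<delta> powr (1 - p) * h (u x)"]
        by (cases "x \<in> ?B") auto
      then have "u x powr (p - 1) * (\<eta> x * K (u x)) \<le> 1 * (indicator ?B x * (\<delta> powr (1 - p) * h (u x)))"
        using u1 \<eta>D(2)[of x] Kb(1)[OF ux[of x]] by (intro mult_mono[OF u1]) auto
      then show "u x powr (p - 1) * (\<eta> x * K (u x)) \<le> r powr (- p) * (indicator ?B x * h (u x))"
        by (simp add: \<delta>p mult_ac)
    qed
    have "(\<integral>x. u x powr (p - 1) * (\<eta> x * K (u x)) \<partial>M) \<le> (\<integral>x. r powr (- p) * (indicator ?B x * h (u x)) \<partial>M)"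
      by (rule integral_mono[OF en(4) _ pt(2)]) (use ihM in auto)
    moreover have "(\<integral>x. u x powr (p - 1) * (\<eta> x * K (u x)) \<partial>M) \<ge> 0"
      using pt(1) by (intro Bochner_Integration.integral_nonneg) auto
    ultimately have "\<bar>lam * (\<integral>x. u x powr (p - 1) * (\<eta> x * K (u x)) \<partial>M)\<bar> \<le> \<bar>lam\<bar> * (r powr (- p) * (\<integral>x. indicator ?B x * h (u x) \<partial>M))"
      unfolding abs_mult by (intro mult_left_mono) auto
    then show ?thesis by (simp add: mult_ac)
  qed
  have lhs: "\<eta> x * 1 * ((p - 1) * h (u x) + h' (u x)) * (c x * norm (g x)) powr p = \<eta> x * k (u x) * norm (g x) powr p" for x
    by (simp add: cp k_def mult_ac)
  have mid: "(\<integral>x. \<bar>K (u x)\<bar> * norm (grad \<eta> x) * norm (g x) powr (p - 1) \<partial>M)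
    \<le> (\<integral>x. 1 * h (u x) * norm (grad \<eta> x) * (c x * norm (g x)) powr (p - 1) \<partial>M)"
  proof (rule integral_mono[OF en(3)])
    have "integrable M (\<lambda>x. (h (u x) * norm (grad \<eta> x) * V (u x) powr (1 - p)) * norm (g x) powr (p - 1))"
    proof (rule integrable_powr_g_minus_1)
      show "(\<lambda>x. h (u x) * norm (grad \<eta> x) * V (u x) powr (1 - p)) \<in> borel_measurable borel"
        unfolding V_def by measurable
      show "\<bar>h (u x) * norm (grad \<eta> x) * V (u x) powr (1 - p)\<bar> \<le> Mh * C\<eta> * \<delta> powr (1 - p)" for x
        unfolding abs_mult C\<eta>_def using Mh[of x] \<eta>12(2)[of x] V[of x] \<delta>0 p order_trans[OF abs_ge_zero Mh[of x]]
        by (intro mult_mono) (auto intro!: powr_mono2')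
    qed
    then show "integrable M (\<lambda>x. 1 * h (u x) * norm (grad \<eta> x) * (c x * norm (g x)) powr (p - 1))"
      by (simp add: cp mult_ac)
    fix x
    have "\<bar>K (u x)\<bar> \<le> V (u x) powr (1 - p) * h (u x)" using Kb[OF ux[of x]] by (simp add: V_def)
    then have "\<bar>K (u x)\<bar> * (norm (grad \<eta> x) * norm (g x) powr (p - 1)) \<le> (V (u x) powr (1 - p) * h (u x)) * (norm (grad \<eta> x) * norm (g x) powr (p - 1))"
      by (rule mult_right_mono) simp
    then show "\<bar>K (u x)\<bar> * norm (grad \<eta> x) * norm (g x) powr (p - 1) \<le> 1 * h (u x) * norm (grad \<eta> x) * (c x * norm (g x)) powr (p - 1)"
      by (simp add: cp mult_ac)
  qed
  have main_le: "(\<integral>x. \<eta> x * 1 * ((p - 1) * h (u x) + h' (u x)) * (c x * norm (g x)) powr p \<partial>M)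
       \<le> (\<integral>x. 1 * h (u x) * norm (grad \<eta> x) * (c x * norm (g x)) powr (p - 1) \<partial>M)
         + \<bar>lam\<bar> * r powr (- p) * (\<integral>x. indicator ?B x * h (u x) \<partial>M)"
    unfolding lhs using en(1) l1 mid by linarith
  have hM: "h (u x) \<le> max Mh Mh'" "h' (u x) \<le> max Mh Mh'" for x using Mh[of x] Mh'[of x] by auto
  have abs_res1: "(\<integral>x. \<eta> x * ((p - 1) / 2 * h (u x) + h' (u x)) * (c x * norm (g x)) powr p \<partial>M)
     \<le> (1 * ((p - 1) / 2) powr (1 - p) * (Cc / (\<sigma> - \<rho>)) powr p + \<bar>lam\<bar> * r powr (- p)) * (\<integral>x. indicator ?B x * h (u x) \<partial>M)"
    by (rule absorb_gradient(1)[where w = "\<lambda>_. 1", OF _ _ _ _ _ _ _ _ _ _ _ _ _ hM(1) _ hM(2) cb _ \<eta>D(6)])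
      (use \<eta>D(1-5) h(2) h'(2) Cc rs p main_le in auto)
  have abs_res2: "(\<integral>x. \<eta> x * h' (u x) * (c x * norm (g x)) powr p \<partial>M)
     \<le> (1 * ((p - 1) / 2) powr (1 - p) * (Cc / (\<sigma> - \<rho>)) powr p + \<bar>lam\<bar> * r powr (- p)) * (\<integral>x. indicator ?B x * h (u x) \<partial>M)"
    by (rule absorb_gradient(2)[where w = "\<lambda>_. 1", OF _ _ _ _ _ _ _ _ _ _ _ _ _ hM(1) _ hM(2) cb _ \<eta>D(6)])
      (use \<eta>D(1-5) h(2) h'(2) Cc rs p main_le in auto)
  have "r powr (- p) \<le> (\<sigma> - \<rho>) powr (- p)" using rs r p by (intro powr_mono2') auto
  then have "\<bar>lam\<bar> * r powr (- p) \<le> \<bar>lam\<bar> * (\<sigma> - \<rho>) powr (- p)" by (intro mult_left_mono) auto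
  moreover have "(Cc / (\<sigma> - \<rho>)) powr p = Cc powr p * (\<sigma> - \<rho>) powr (- p)"
    using Cc rs by (simp add: powr_divide powr_minus_divide)
  ultimately have "1 * ((p - 1) / 2) powr (1 - p) * (Cc / (\<sigma> - \<rho>)) powr p + \<bar>lam\<bar> * r powr (- p)
    \<le> (((p - 1) / 2) powr (1 - p) * Cc powr p + \<bar>lam\<bar>) * (\<sigma> - \<rho>) powr (- p)"
    by (simp add: algebra_simps)
  moreover have "(\<integral>x. indicator ?B x * h (u x) \<partial>M) \<le> (\<integral>x. indicator ?B x * h (u x) \<partial>lborel)"
    by (rule integral_M_le[OF _ _ ih]) (use h(2) in auto)
  moreover have "(\<integral>x. indicator ?B x * h (u x) \<partial>M) \<ge> 0"
    using h(2) by (intro Bochner_Integration.integral_nonneg) auto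
  ultimately have fin: "(1 * ((p - 1) / 2) powr (1 - p) * (Cc / (\<sigma> - \<rho>)) powr p + \<bar>lam\<bar> * r powr (- p)) * (\<integral>x. indicator ?B x * h (u x) \<partial>M)
    \<le> (((p - 1) / 2) powr (1 - p) * Cc powr p + \<bar>lam\<bar>) * (\<sigma> - \<rho>) powr (- p) * (\<integral>x. indicator ?B x * h (u x) \<partial>lborel)"
    by (intro mult_mono) auto
  show "(\<integral>x. \<eta> x * ((p - 1) / 2 * h (u x) + h' (u x)) * (1 / (1 - u x + \<delta>) * norm (g x)) powr p \<partial>M)
      \<le> (((p - 1) / 2) powr (1 - p) * Cc powr p + \<bar>lam\<bar>) * (\<sigma> - \<rho>) powr (- p) * (\<integral>x. indicator (ball x0 \<sigma>) x * h (u x) \<partial>lborel)"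
    using abs_res1 fin unfolding c_def V_def by linarith
  show "(\<integral>x. \<eta> x * h' (u x) * (1 / (1 - u x + \<delta>) * norm (g x)) powr p \<partial>M)
      \<le> (((p - 1) / 2) powr (1 - p) * Cc powr p + \<bar>lam\<bar>) * (\<sigma> - \<rho>) powr (- p) * (\<integral>x. indicator (ball x0 \<sigma>) x * h (u x) \<partial>lborel)"
    using abs_res2 fin unfolding c_def V_def by linarith
qed

text \<open>Moser's argument: the logarithmic estimate and the Poincare inequality bound the mean of
  \<open>ln (1 / (1 - u + \<delta>))\<close> above its value on the set of positive density, and De Giorgi's iteration turns
  this into a pointwise bound. Balls that leave \<open>\<Omega>\<close> are allowed, where \<open>1 - u = 1\<close>.\<close>

theorem weak_harnack:
  assumes \<nu>: "\<nu> > 0"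
  shows "\<exists>c>0. \<forall>x0 r m. 0 < r \<and> r \<le> 1 \<and> 0 < m \<and> m \<le> 1 \<and>
     \<nu> * r ^ DIM('a) \<le> measure lborel {x \<in> ball x0 r. m \<le> 1 - u x} \<longrightarrow>
     (AE x in lborel. x \<in> ball x0 (r / 2) \<longrightarrow> c * m \<le> 1 - u x + r powr (p / (p - 1)))"
proof -
  obtain Cc where Cc: "Cc \<ge> 0" and cut: "\<And>(x0::'a) \<rho> \<sigma>. 0 < \<rho> \<Longrightarrow> \<rho> < \<sigma> \<Longrightarrow> \<exists>\<eta>. is_cutoff p Cc x0 \<rho> \<sigma> \<eta>"
    using cutoff_exists[OF p, where 'a = 'a] by blast
  define N where "N = DIM('a)"
  define \<omega>N where "\<omega>N = unit_ball_vol (real DIM('a))"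
  have \<omega>N: "\<omega>N > 0" by (simp add: \<omega>N_def)
  define C1 where "C1 = ((p - 1) / 2) powr (1 - p) * Cc powr p + \<bar>lam\<bar>"
  have C1: "C1 \<ge> 0" by (simp add: C1_def)
  define Cdg where "Cdg = 2 * (2 / \<omega>N) powr (1 / real DIM('a)) * (Cc + C1 + 1)"
  have Cdg: "Cdg > 0" unfolding Cdg_def using \<omega>N Cc C1 by (intro mult_pos_pos) auto
  obtain \<nu>0 where \<nu>0: "\<nu>0 > 0" and dg: "\<And>(x0::'a) r f k0 K Mb. r > 0 \<Longrightarrow> K \<ge> 1 \<Longrightarrow> f \<in> borel_measurable borel \<Longrightarrow>
     (\<And>x. \<bar>f x\<bar> \<le> Mb) \<Longrightarrow> dg_ineq Cdg p x0 r k0 f \<Longrightarrow>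
     (\<integral>x. indicator (ball x0 r) x * max 0 (f x - k0) \<partial>lborel) \<le> \<nu>0 * K * r ^ DIM('a) \<Longrightarrow>
     (AE x in lborel. x \<in> ball x0 (r / 2) \<longrightarrow> f x \<le> k0 + K)"
    using de_giorgi_bounded[OF p Cdg, where 'a = 'a] by blast
  \<comment> \<open>\<open>C2\<close> is the constant of the logarithmic energy, tested with a
    cutoff on the ball of radius \<open>2 * r\<close>; \<open>C3\<close> is what Poincare's
    inequality makes of it. \<open>KK\<close> meets both demands of
    \<open>de_giorgi_bounded\<close>: it is at least 1, and large enough for the initial
    smallness.\<close>
  define C2 where "C2 = 2 / (p - 1) * C1 * \<omega>N * 2 ^ N"
  have C2: "C2 \<ge> 0" using C1 \<omega>N p by (simp add: C2_def)
  define C3 where "C3 = 2 * \<omega>N * 2 ^ N * (C2 + \<omega>N) / \<nu>"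
  have C3: "C3 \<ge> 0" using C2 \<omega>N \<nu> by (simp add: C3_def)
  define KK where "KK = max 1 ((C3 + \<omega>N) / \<nu>0)"
  have "AE x in lborel. x \<in> ball x0 (r / 2) \<longrightarrow> exp (- KK) * m \<le> 1 - u x + r powr (p / (p - 1))"
    if r: "0 < r" "r \<le> 1" and m: "0 < m" "m \<le> 1"
      and meas: "\<nu> * r ^ DIM('a) \<le> measure lborel {x \<in> ball x0 r. m \<le> 1 - u x}" for x0 r m
  proof -
    have [measurable]: "ball y s \<in> sets borel" for y :: 'a and s by simp
    define \<delta> where "\<delta> = r powr (p / (p - 1))"
    have \<delta>: "\<delta> > 0" using r by (simp add: \<delta>_def)
    define V where "V t = 1 - t + \<delta>" for t
    \<comment> \<open>\<open>L\<close> is normalised to vanish at \<open>t = 0\<close>, the value of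
      \<open>u\<close> outside \<open>\<Omega>\<close>. Ramps of \<open>L\<close> above a
      nonnegative level then vanish at 0 as well, which makes cutoffs across the boundary
      admissible.\<close>
    define L where "L t = ln (1 + \<delta>) - ln (V t)" for t
    have V: "V t > 0" "V t \<le> 1 + \<delta>" if "t \<in> {0..1}" for t using that \<delta> by (auto simp: V_def)
    have ux: "u x \<in> {0..1}" for x using u_nonneg u_le_1 by auto
    have dV: "(V has_real_derivative -1) (at t within {0..1})" for t
      unfolding V_def by (auto intro!: derivative_eq_intros)
    have dL: "(L has_real_derivative 1 / V t) (at t within {0..1})" if "t \<in> {0..1}" for t
      unfolding L_def using V[OF that] by (auto intro!: derivative_eq_intros dV simp: divide_inverse)
    have cV: "continuous_on {0..1} V" unfolding V_def by (intro continuous_intros)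
    have cinv: "continuous_on {0..1} (\<lambda>t. 1 / V t)"
      using V(1) by (intro continuous_intros cV) force
    have cL: "continuous_on {0..1} L" by (rule DERIV_continuous_on[OF dL])
    have dVp: "((\<lambda>t. V t powr (1 - p)) has_real_derivative (p - 1) * V t powr (- p)) (at t within {0..1})" if "t \<in> {0..1}" for t
    proof -
      have "((\<lambda>v. v powr (1 - p)) has_real_derivative (1 - p) * V t powr (1 - p - 1)) (at (V t))"
        by (rule has_real_derivative_powr[OF V(1)[OF that]])
      from DERIV_chain2[OF this dV] show ?thesis by (simp add: algebra_simps)
    qed
    have VV: "V t powr (1 - p) * (1 / V t) = V t powr (- p)" if "t \<in> {0..1}" for t
      using V[OF that] powr_diff[of "V t" "1 - p" 1] by simp
    note [measurable] = continuous_comp_u(1)[OF cL] continuous_comp_u(1)[OF cinv]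
    obtain Lb where Lb: "\<And>x. \<bar>L (u x)\<bar> \<le> Lb" using continuous_comp_u(2)[OF cL] by blast
    \<comment> \<open>This is the level of \<open>L\<close> at which \<open>V = m\<close>, so the
      set of positive density lies where \<open>L (u x) \<le> k0\<close>. It is nonnegative because
      \<open>m \<le> 1\<close>.\<close>
    define k0 where "k0 = ln ((1 + \<delta>) / m)"
    have k0: "k0 \<ge> 0" using m \<delta> unfolding k0_def by (intro ln_ge_zero) (auto simp: field_simps)
    have k0_eq: "k0 = ln (1 + \<delta>) - ln m" unfolding k0_def using \<delta> m by (simp add: ln_div)
    have rN: "emeasure lborel (ball y s) = ennreal (\<omega>N * s ^ N)" if "s \<ge> 0" for y :: 'a and s
      using emeasure_ball[OF that, of y] by (simp add: \<omega>N_def N_def)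
    have rN': "measure lborel (ball y s) = \<omega>N * s ^ N" if "s \<ge> 0" for y :: 'a and s
      using content_ball[OF that, of y] by (simp add: \<omega>N_def N_def)
    have iball: "integrable lborel (indicator (ball y s) :: 'a \<Rightarrow> real)" for y s
      by (rule integrable_real_indicator) (use emeasure_lborel_ball_finite[of y s] in auto)
    define d where "d x = 1 / V (u x) * norm (g x)" for x
    have d0: "d x \<ge> 0" for x using V[OF ux[of x]] by (simp add: d_def)
    have [measurable]: "d \<in> borel_measurable borel" unfolding d_def by measurable
    obtain Mi where Mi: "\<And>x. \<bar>1 / V (u x)\<bar> \<le> Mi" using continuous_comp_u(2)[OF cinv] by blast
    have idp: "integrable M (\<lambda>x. f x * d x powr p)" if [measurable]: "f \<in> borel_measurable borel" and f: "\<And>x. \<bar>f x\<bar> \<le> 1" for f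
    proof -
      have "integrable M (\<lambda>x. (f x * (1 / V (u x)) powr p) * norm (g x) powr p)"
      proof (rule integrable_powr_g)
        show "\<bar>f x * (1 / V (u x)) powr p\<bar> \<le> 1 * Mi powr p" for x
          unfolding abs_mult using f[of x] Mi[of x] V[OF ux[of x]] p by (intro mult_mono) (auto intro!: powr_mono2)
      qed measurable
      moreover have "d x powr p = (1 / V (u x)) powr p * norm (g x) powr p" for x
        unfolding d_def using V[OF ux[of x]] by (intro powr_mult)
      ultimately show ?thesis by (simp add: mult_ac)
    qed
    have offd: "x \<notin> \<Omega> \<Longrightarrow> f x * d x powr p = 0" for f :: "'a \<Rightarrow> real" and x
      using off_g by (simp add: d_def)
    have log_est: "(\<integral>x. indicator (ball x0 r) x * d x powr p \<partial>lborel) \<le> C2 * r ^ N * r powr (- p)"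
    proof -
      obtain \<eta> where \<eta>: "is_cutoff p Cc x0 r (2 * r) \<eta>" using cut[of r "2 * r" x0] r by auto
      note \<eta>D = is_cutoffD[OF \<eta>]
      note [measurable] = smooth_fun_measurable[OF \<eta>D(1)]
      \<comment> \<open>The choice \<open>h = 1\<close>, \<open>h' = 0\<close> gives the plain
        logarithmic estimate; subtracting \<open>(1 + \<delta>) powr (1 - p)\<close> makes the test
        function vanish at 0.\<close>
      have "(\<integral>x. \<eta> x * ((p - 1) / 2 * (\<lambda>_. 1) (u x) + (\<lambda>_. 0) (u x)) * (1 / (1 - u x + \<delta>) * norm (g x)) powr p \<partial>M)
        \<le> (((p - 1) / 2) powr (1 - p) * Cc powr p + \<bar>lam\<bar>) * (2 * r - r) powr (- p) * (\<integral>x. indicator (ball x0 (2 * r)) x * (\<lambda>_. 1) (u x) \<partial>lborel)"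
      proof (rule log_energy(1)[OF r(1) \<delta>_def Cc \<eta>, where K = "\<lambda>t. V t powr (1 - p) - (1 + \<delta>) powr (1 - p)"])
        show "((\<lambda>t. V t powr (1 - p) - (1 + \<delta>) powr (1 - p)) has_real_derivative (1 - t + \<delta>) powr - p * ((p - 1) * 1 + 0)) (at t within {0..1})"
          if "t \<in> {0..1}" for t
          using DERIV_diff[OF dVp[OF that] DERIV_const[of "(1 + \<delta>) powr (1 - p)"]] by (simp add: V_def mult.commute)
        show "0 \<le> V t powr (1 - p) - (1 + \<delta>) powr (1 - p)" if "t \<in> {0..1}" for t
          using V[OF that] p powr_mono2'[of "1 - p" "V t" "1 + \<delta>"] by simp
        show "V 0 powr (1 - p) - (1 + \<delta>) powr (1 - p) = 0" by (simp add: V_def)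
      qed (use r in \<open>auto simp: V_def\<close>)
      moreover have "\<eta> x * ((p - 1) / 2 * 1 + 0) * (1 / (1 - u x + \<delta>) * norm (g x)) powr p = (p - 1) / 2 * (\<eta> x * d x powr p)" for x
        by (simp add: d_def V_def)
      ultimately have "(\<integral>x. (p - 1) / 2 * (\<eta> x * d x powr p) \<partial>M) \<le> C1 * r powr (- p) * (\<omega>N * (2 * r) ^ N)"
        using r by (simp only:) (simp add: C1_def rN')
      then have "(p - 1) / 2 * (\<integral>x. \<eta> x * d x powr p \<partial>M) \<le> C1 * r powr (- p) * (\<omega>N * (2 * r) ^ N)"
        by (simp only: integral_mult_right_zero)
      then have 1: "(\<integral>x. \<eta> x * d x powr p \<partial>M) \<le> C2 * r ^ N * r powr (- p)"
        using p by (simp add: C2_def field_simps power_mult_distrib)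
      have "(\<integral>x. indicator (ball x0 r) x * d x powr p \<partial>lborel) = (\<integral>x. indicator (ball x0 r) x * d x powr p \<partial>M)"
        by (rule integrable_M_iff(2)[symmetric]) (use offd in auto)
      also have "\<dots> \<le> (\<integral>x. \<eta> x * d x powr p \<partial>M)"
      proof (rule integral_mono)
        show "integrable M (\<lambda>x. indicator (ball x0 r) x * d x powr p)" by (rule idp) (auto simp: indicator_def)
        show "integrable M (\<lambda>x. \<eta> x * d x powr p)" by (rule idp) (use \<eta>D(2,3) in auto)
        show "indicator (ball x0 r) x * d x powr p \<le> \<eta> x * d x powr p" for x
          using \<eta>D(2)[of x] \<eta>D(4)[of x] by (intro mult_right_mono) (auto simp: indicator_def dist_norm norm_minus_commute)
      qed
      finally show ?thesis using 1 by linarith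
    qed
    have pre: "(\<integral>x. indicator (ball x0 r) x * max 0 (L (u x) - k0) \<partial>lborel) \<le> (C3 + \<omega>N) * r ^ N"
    proof -
      \<comment> \<open>The translation estimate wants a C1 function of \<open>u\<close>. A ramp
        with parameter 1 falls below the positive part by at most 1, which costs the summand
        \<open>\<omega>N * r ^ N\<close> in the bound.\<close>
      define f where "f x = ramp 1 (L (u x) - k0)" for x
      have [measurable]: "f \<in> borel_measurable borel" unfolding f_def by measurable
      define Z where "Z = {x \<in> ball x0 r. m \<le> 1 - u x}"
      have [measurable]: "Z \<in> sets borel" unfolding Z_def by measurable
      have Zfin: "emeasure lborel Z \<le> emeasure lborel (ball x0 r)" unfolding Z_def by (rule emeasure_mono) auto
      have f0: "f x = 0" if "x \<in> Z" for x
      proof -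
        have "m \<le> V (u x)" using that \<delta> by (auto simp: Z_def V_def)
        then have "L (u x) \<le> k0" unfolding L_def k0_eq using m by simp
        then show ?thesis unfolding f_def by (intro ramp_bounds(6)) auto
      qed
      have fb: "0 \<le> f x" "max 0 (L (u x) - k0) \<le> f x + 1" "\<bar>f x\<bar> \<le> Lb + \<bar>k0\<bar>" for x
        using ramp_bounds(1-3)[of 1 "L (u x) - k0"] Lb[of x] unfolding f_def by auto
      define D where "D x = (ramp' 1 (L (u x) - k0) * (1 / V (u x))) *\<^sub>R g x" for x
      define I where "I = (\<integral>\<^sup>+x. indicator (ball x0 r) x * ennreal (norm (D x)) \<partial>lborel)"
      have T: "(\<integral>\<^sup>+x. indicator (ball x0 r) x * indicator (ball x0 r) (x + y) * ennreal \<bar>f (x + y) - f x\<bar> \<partial>lborel) \<le> ennreal (norm y) * I" for y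
      proof -
        have dK: "((\<lambda>t. ramp 1 (L t - k0)) has_real_derivative ramp' 1 (L t - k0) * (1 / V t)) (at t within {0..1})" if "t \<in> {0..1}" for t
        proof -
          have "((\<lambda>t. L t - k0) has_real_derivative 1 / V t) (at t within {0..1})"
            using DERIV_diff[OF dL[OF that] DERIV_const[of k0]] by simp
          then show ?thesis by (rule DERIV_chain2[OF ramp_deriv[OF zero_less_one]])
        qed
        have ck: "continuous_on {0..1} (\<lambda>t. ramp' 1 (L t - k0) * (1 / V t))"
          by (intro continuous_on_mult cinv continuous_on_compose2[OF ramp'_continuous[OF zero_less_one]] continuous_intros cL) auto
        have g1: "grad (\<lambda>_::'a. 1) x = 0" for x by (rule grad_eqI) simp
        show ?thesis
          using translation_estimate[OF dK ck smooth_fun_const[of 1], of 1 "ball x0 r" y]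
          by (simp add: g1 I_def D_def f_def)
      qed
      have P: "emeasure lborel Z * (\<integral>\<^sup>+x. indicator (ball x0 r) x * ennreal (f x) \<partial>lborel)
        \<le> emeasure lborel (ball (0::'a) (2 * r)) * (ennreal (2 * r) * I)"
        by (rule poincare_L1[OF _ _ fb(1) _ f0 T]) (auto simp: Z_def)
      have ifd: "integrable lborel (\<lambda>x. indicator (ball x0 r) x * d x powr p)"
      proof (rule iffD1[OF integrable_M_iff(1)])
        show "integrable M (\<lambda>x. indicator (ball x0 r) x * d x powr p)" by (rule idp) (auto simp: indicator_def)
      qed (use offd in auto)
      have "I \<le> (\<integral>\<^sup>+x. ennreal (r powr (p - 1) * (indicator (ball x0 r) x * d x powr p) + 1 / r * indicator (ball x0 r) x) \<partial>lborel)"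
        unfolding I_def
      proof (rule nn_integral_mono)
        fix x
        have "norm (D x) \<le> 1 * d x"
          using ramp_bounds(4,5)[of 1 "L (u x) - k0"] V[OF ux[of x]]
          unfolding D_def d_def norm_scaleR abs_mult by (simp only: mult.assoc) (intro mult_mono; simp)
        also have "\<dots> \<le> r powr (p - 1) * d x powr p + 1 / r" using powr_interpolate[OF d0 r(1) p] by simp
        finally show "indicator (ball x0 r) x * ennreal (norm (D x))
          \<le> ennreal (r powr (p - 1) * (indicator (ball x0 r) x * d x powr p) + 1 / r * indicator (ball x0 r) x)"
          by (auto simp: indicator_def ennreal_leI)
      qed
      also have "\<dots> = ennreal (\<integral>x. r powr (p - 1) * (indicator (ball x0 r) x * d x powr p) + 1 / r * indicator (ball x0 r) x \<partial>lborel)"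
        using ifd iball r by (intro nn_integral_eq_integral) auto
      also have "(\<integral>x. r powr (p - 1) * (indicator (ball x0 r) x * d x powr p) + 1 / r * indicator (ball x0 r) x \<partial>lborel)
        = r powr (p - 1) * (\<integral>x. indicator (ball x0 r) x * d x powr p \<partial>lborel) + 1 / r * (\<omega>N * r ^ N)"
        using ifd iball r by (simp add: rN')
      also have "\<dots> \<le> r powr (p - 1) * (C2 * r ^ N * r powr (- p)) + 1 / r * (\<omega>N * r ^ N)"
        by (intro add_right_mono mult_left_mono log_est) auto
      also have "\<dots> = (C2 + \<omega>N) * r ^ N / r"
      proof -
        have "r powr (p - 1) * r powr (- p) = 1 / r" 
        proof -
          have "r powr (p - 1) * r powr (- p) = r powr (- 1)" by (simp flip: powr_add)
          then show ?thesis using r by (simp add: powr_minus_divide)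
        qed
        then have "r powr (p - 1) * (C2 * r ^ N * r powr (- p)) = C2 * r ^ N * (1 / r)" by (simp add: mult_ac)
        then show ?thesis by (simp add: algebra_simps add_divide_distrib)
      qed
      finally have I_le: "I \<le> ennreal ((C2 + \<omega>N) * r ^ N / r)" by (simp add: ennreal_leI)
      define J where "J = (\<integral>x. indicator (ball x0 r) x * f x \<partial>lborel)"
      have iJ: "integrable lborel (\<lambda>x. indicator (ball x0 r) x * f x)"
        by (rule integrable_on_ball[OF _ fb(3)]) measurable
      have J0: "J \<ge> 0" unfolding J_def using fb(1) by (intro Bochner_Integration.integral_nonneg) auto
      have J: "(\<integral>\<^sup>+x. indicator (ball x0 r) x * ennreal (f x) \<partial>lborel) = ennreal J"
      proof -
        have "(\<integral>\<^sup>+x. indicator (ball x0 r) x * ennreal (f x) \<partial>lborel) = (\<integral>\<^sup>+x. ennreal (indicator (ball x0 r) x * f x) \<partial>lborel)"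
          by (intro nn_integral_cong) (auto simp: indicator_def)
        also have "\<dots> = ennreal J" unfolding J_def using fb(1) by (intro nn_integral_eq_integral iJ) auto
        finally show ?thesis .
      qed
      have mZ: "ennreal (\<nu> * r ^ N) \<le> emeasure lborel Z"
      proof -
        have "emeasure lborel Z < \<infinity>" using Zfin emeasure_lborel_ball_finite le_less_trans by blast
        then have "emeasure lborel Z = ennreal (measure lborel Z)" by (intro emeasure_eq_ennreal_measure) auto
        then show ?thesis using meas by (simp add: Z_def N_def ennreal_leI)
      qed
      have "ennreal (\<nu> * r ^ N * J) \<le> emeasure lborel Z * ennreal J"
        using mZ J0 \<nu> r by (simp add: ennreal_mult mult_right_mono)
      also have "\<dots> \<le> ennreal (\<omega>N * (2 * r) ^ N) * (ennreal (2 * r) * ennreal ((C2 + \<omega>N) * r ^ N / r))"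
        using P unfolding J using r I_le by (auto simp: rN intro!: mult_left_mono elim!: order_trans)
      also have "\<dots> = ennreal (\<omega>N * (2 * r) ^ N * (2 * r * ((C2 + \<omega>N) * r ^ N / r)))"
      proof -
        have "ennreal a * (ennreal b * ennreal e) = ennreal (a * (b * e))" if "0 \<le> a" "0 \<le> b" "0 \<le> e" for a b e
          using that by (simp add: ennreal_mult)
        then show ?thesis using r \<omega>N C2 by force
      qed
      finally have "\<nu> * r ^ N * J \<le> \<omega>N * (2 * r) ^ N * (2 * r * ((C2 + \<omega>N) * r ^ N / r))"
        using r \<omega>N C2 by (subst (asm) ennreal_le_iff) auto
      also have "\<dots> = r ^ N * (C3 * \<nu> * r ^ N)" using r \<nu> by (simp add: C3_def power_mult_distrib mult_ac)
      finally have "r ^ N * (\<nu> * J) \<le> r ^ N * (\<nu> * (C3 * r ^ N))" by (simp only: mult_ac)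
      then have Jle: "J \<le> C3 * r ^ N" using r \<nu> by simp
      have "(\<integral>x. indicator (ball x0 r) x * max 0 (L (u x) - k0) \<partial>lborel) \<le> (\<integral>x. indicator (ball x0 r) x * f x + indicator (ball x0 r) x \<partial>lborel)"
      proof (rule integral_mono)
        show "integrable lborel (\<lambda>x. indicator (ball x0 r) x * max 0 (L (u x) - k0))"
        proof (rule integrable_on_ball)
          show "\<bar>max 0 (L (u x) - k0)\<bar> \<le> Lb + \<bar>k0\<bar>" for x using Lb[of x] by linarith
        qed measurable
        show "integrable lborel (\<lambda>x. indicator (ball x0 r) x * f x + indicator (ball x0 r) x)" using iJ iball by auto
        show "indicator (ball x0 r) x * max 0 (L (u x) - k0) \<le> indicator (ball x0 r) x * f x + indicator (ball x0 r) x" for x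
          using fb(2)[of x] by (auto simp: indicator_def)
      qed
      also have "\<dots> = J + \<omega>N * r ^ N" using iJ iball r by (simp add: J_def rN')
      finally show ?thesis using Jle by (simp add: algebra_simps)
    qed
    have dgi: "dg_ineq Cdg p x0 r k0 (\<lambda>x. L (u x))"
      unfolding Cdg_def \<omega>N_def
    proof (rule dg_ineq_of_caccioppoli[OF dL cinv r(1) Cc C1 cut])
      fix k e \<rho> \<sigma> \<eta>
      assume a: "k0 \<le> k" "0 < (e::real)" "r / 2 \<le> \<rho>" "\<rho> < \<sigma>" "\<sigma> \<le> r" "is_cutoff p Cc x0 \<rho> \<sigma> \<eta>"
      have dR: "((\<lambda>t. ramp e (L t - k)) has_real_derivative ramp' e (L t - k) * (1 / V t)) (at t within {0..1})" if "t \<in> {0..1}" for t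
      proof -
        have "((\<lambda>t. L t - k) has_real_derivative 1 / V t) (at t within {0..1})"
          using DERIV_diff[OF dL[OF that] DERIV_const[of k]] by simp
        then show ?thesis by (rule DERIV_chain2[OF ramp_deriv[OF a(2)]])
      qed
      \<comment> \<open>Since the derivative of \<open>L\<close> is \<open>1 / V\<close>,
        differentiating \<open>V powr (1 - p)\<close> and differentiating the ramp both leave the
        factor \<open>V powr (- p)\<close>, the form that \<open>log_energy\<close>
        requires.\<close>
      have "(\<integral>x. \<eta> x * (\<lambda>t. ramp' e (L t - k)) (u x) * (1 / (1 - u x + \<delta>) * norm (g x)) powr p \<partial>M)
        \<le> (((p - 1) / 2) powr (1 - p) * Cc powr p + \<bar>lam\<bar>) * (\<sigma> - \<rho>) powr (- p) * (\<integral>x. indicator (ball x0 \<sigma>) x * (\<lambda>t. ramp e (L t - k)) (u x) \<partial>lborel)"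
      proof (rule log_energy(2)[OF r(1) \<delta>_def Cc a(6), where K = "\<lambda>t. V t powr (1 - p) * ramp e (L t - k)"])
        show "((\<lambda>t. V t powr (1 - p) * ramp e (L t - k)) has_real_derivative
            (1 - t + \<delta>) powr - p * ((p - 1) * ramp e (L t - k) + ramp' e (L t - k))) (at t within {0..1})" if t: "t \<in> {0..1}" for t
        proof -
          have "(p - 1) * V t powr (- p) * ramp e (L t - k) + ramp' e (L t - k) * (1 / V t) * V t powr (1 - p)
            = V t powr (- p) * ((p - 1) * ramp e (L t - k) + ramp' e (L t - k))"
            by (simp only: mult.assoc mult.commute[of "1 / V t"] VV[OF t]) (simp add: algebra_simps)
          then show ?thesis using DERIV_mult[OF dVp[OF t] dR[OF t]] by (simp add: V_def)
        qed
        show "continuous_on {0..1} (\<lambda>t. ramp e (L t - k))" by (rule DERIV_continuous_on[OF dR])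
        show "continuous_on {0..1} (\<lambda>t. ramp' e (L t - k))"
          by (intro continuous_on_compose2[OF ramp'_continuous[OF a(2)]] continuous_intros cL) auto
        show "V 0 powr (1 - p) * ramp e (L 0 - k) = 0"
          using ramp_bounds(6)[OF a(2), of "L 0 - k"] k0 a(1) by (simp add: L_def V_def)
      qed (use a r ramp_bounds[OF a(2)] in \<open>auto simp: V_def\<close>)
      then show "(\<integral>x. \<eta> x * ramp' e (L (u x) - k) * (\<bar>1 / V (u x)\<bar> * norm (g x)) powr p \<partial>M)
        \<le> C1 * (\<sigma> - \<rho>) powr (- p) * (\<integral>x. indicator (ball x0 \<sigma>) x * ramp e (L (u x) - k) \<partial>lborel)"
        using V(1)[OF ux] by (simp add: C1_def V_def abs_of_pos less_imp_le)
    qed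
    have "AE x in lborel. x \<in> ball x0 (r / 2) \<longrightarrow> L (u x) \<le> k0 + KK"
    proof (rule dg[OF r(1) _ _ Lb dgi])
      have "(C3 + \<omega>N) \<le> \<nu>0 * KK" using \<nu>0 by (simp add: KK_def max_def field_simps)
      then have "(C3 + \<omega>N) * r ^ N \<le> \<nu>0 * KK * r ^ N" using r by (intro mult_right_mono) auto
      with pre show "(\<integral>x. indicator (ball x0 r) x * max 0 (L (u x) - k0) \<partial>lborel) \<le> \<nu>0 * KK * r ^ DIM('a)"
        unfolding N_def by linarith
    qed (auto simp: KK_def)
    then show ?thesis
    proof eventually_elim
      case (elim x)
      show ?case
      proof
        assume "x \<in> ball x0 (r / 2)"
        with elim have "ln m - KK \<le> ln (V (u x))" by (simp add: L_def k0_eq)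
        then have "exp (ln m - KK) \<le> exp (ln (V (u x)))" by simp
        then show "exp (- KK) * m \<le> 1 - u x + r powr (p / (p - 1))"
          using m V[OF ux[of x]] by (simp add: exp_diff exp_minus V_def \<delta>_def field_simps)
      qed
    qed
  qed
  then show ?thesis by (intro exI[of _ "exp (- KK)"]) auto
qed

end

subsection \<open>Growth at a maximum point\<close>

context unweighted_solution begin

text \<open>\<open>1 - u\<close> is a subsolution inside \<open>\<Omega>\<close>. The factor \<open>exp (F u)\<close> in the test function supplies the
  zero-order gradient term needed by \<open>absorb_gradient\<close>; it is bounded only almost everywhere on the
  ball, whence the truncation \<open>w\<close>.\<close>

theorem sup_decay:
  assumes lam: "lam \<ge> 0" and c0: "0 < c0"
  shows "\<exists>\<nu>>0. \<forall>x0 r S. 0 < r \<and> 0 < S \<and> cball x0 r \<subseteq> \<Omega> \<and>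
     (AE x in lborel. x \<in> ball x0 r \<longrightarrow> 1 - u x \<le> S) \<and>
     measure lborel {x \<in> ball x0 r. c0 * S / 2 < 1 - u x} \<le> \<nu> * r ^ DIM('a) \<longrightarrow>
     (AE x in lborel. x \<in> ball x0 (r / 2) \<longrightarrow> 1 - u x \<le> c0 * S)"
proof -
  obtain Cc where Cc: "Cc \<ge> 0" and cut: "\<And>(x0::'a) \<rho> \<sigma>. 0 < \<rho> \<Longrightarrow> \<rho> < \<sigma> \<Longrightarrow> \<exists>\<eta>. is_cutoff p Cc x0 \<rho> \<sigma> \<eta>"
    using cutoff_exists[OF p, where 'a = 'a] by blast
  \<comment> \<open>The function \<open>F\<close> below is at most \<open>2 / c0\<close> almost
    everywhere on the ball, so \<open>W\<close> bounds \<open>exp (F u)\<close> there, independently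
    of \<open>r\<close> and \<open>S\<close>.\<close>
  define W where "W = exp (2 / c0)"
  define C1 where "C1 = W * (1 / 2) powr (1 - p) * Cc powr p"
  have C1: "C1 \<ge> 0" by (simp add: C1_def W_def)
  define \<omega>N where "\<omega>N = unit_ball_vol (real DIM('a))"
  have \<omega>N: "\<omega>N > 0" by (simp add: \<omega>N_def)
  define Cdg where "Cdg = 2 * (2 / \<omega>N) powr (1 / real DIM('a)) * (Cc + C1 + 1)"
  have Cdg: "Cdg > 0" unfolding Cdg_def using \<omega>N Cc C1 by (intro mult_pos_pos) auto
  obtain \<nu>0 where \<nu>0: "\<nu>0 > 0" and dg: "\<And>(x0::'a) r f k0 K Mb. r > 0 \<Longrightarrow> K \<ge> 1 \<Longrightarrow> f \<in> borel_measurable borel \<Longrightarrow>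
     (\<And>x. \<bar>f x\<bar> \<le> Mb) \<Longrightarrow> dg_ineq Cdg p x0 r k0 f \<Longrightarrow>
     (\<integral>x. indicator (ball x0 r) x * max 0 (f x - k0) \<partial>lborel) \<le> \<nu>0 * K * r ^ DIM('a) \<Longrightarrow>
     (AE x in lborel. x \<in> ball x0 (r / 2) \<longrightarrow> f x \<le> k0 + K)"
    using de_giorgi_bounded[OF p Cdg, where 'a = 'a] by blast
  have "AE x in lborel. x \<in> ball x0 (r / 2) \<longrightarrow> 1 - u x \<le> c0 * S"
    if r: "0 < r" and S: "0 < S" and sub: "cball x0 r \<subseteq> \<Omega>" and ae: "AE x in lborel. x \<in> ball x0 r \<longrightarrow> 1 - u x \<le> S"
      and small: "measure lborel {x \<in> ball x0 r. c0 * S / 2 < 1 - u x} \<le> \<nu>0 * c0 / 2 * r ^ DIM('a)" for x0 r S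
  proof -
    have [measurable]: "ball y s \<in> sets borel" for y :: 'a and s by simp
    \<comment> \<open>The scaling puts \<open>1 - u = c0 * S / 2\<close> at level 1 and
      \<open>1 - u = c0 * S\<close> at level 2, so De Giorgi's iteration with \<open>k0 = 1\<close>
      and \<open>K = 1\<close> leads from one to the other.\<close>
    define A where "A = 2 / (c0 * S)"
    have A: "A > 0" using c0 S by (simp add: A_def)
    define F where "F t = A * (1 - t)" for t
    have dF: "(F has_real_derivative - A) (at t within {0..1})" for t
      unfolding F_def by (auto intro!: derivative_eq_intros)
    have cF: "continuous_on {0..1} F" by (rule DERIV_continuous_on[OF dF])
    have Fb: "\<bar>F (u x)\<bar> \<le> A" "0 \<le> F (u x)" for x
      using A u_nonneg[of x] u_le_1[of x] by (auto simp: F_def abs_mult)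
    have aeF: "AE x in lborel. x \<in> ball x0 r \<longrightarrow> F (u x) \<le> 2 / c0"
      using ae
    proof eventually_elim
      case (elim x)
      show ?case
      proof
        assume "x \<in> ball x0 r"
        with elim have "A * (1 - u x) \<le> A * S" using A by (intro mult_left_mono) auto
        also have "A * S = 2 / c0" using S by (simp add: A_def)
        finally show "F (u x) \<le> 2 / c0" by (simp add: F_def)
      qed
    qed
    have [measurable]: "(\<lambda>x. F (u x)) \<in> borel_measurable borel" unfolding F_def by measurable
    have dgi: "dg_ineq Cdg p x0 r 1 (\<lambda>x. F (u x))"
      unfolding Cdg_def \<omega>N_def
    proof (rule dg_ineq_of_caccioppoli[OF dF continuous_on_const r Cc C1 cut])
      fix k e \<rho> \<sigma> :: real and \<eta> :: "'a \<Rightarrow> real"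
      assume a: "1 \<le> k" "0 < e" "r / 2 \<le> \<rho>" "\<rho> < \<sigma>" "\<sigma> \<le> r" and cut\<eta>: "is_cutoff p Cc x0 \<rho> \<sigma> \<eta>"
      note \<eta>D = is_cutoffD[OF cut\<eta>]
      let ?B = "ball x0 \<sigma>"
      have \<rho>: "\<rho> > 0" using r a by simp
      note [measurable] = smooth_fun_measurable[OF \<eta>D(1)] grad_measurable[OF \<eta>D(1)]
      define h where "h t = ramp e (F t - k)" for t
      define h' where "h' t = ramp' e (F t - k)" for t
      have hb: "0 \<le> h t" "0 \<le> h' t" "h' t \<le> 1" for t using ramp_bounds[OF a(2)] by (auto simp: h_def h'_def)
      have hb2: "h (u x) \<le> A + \<bar>k\<bar>" for x
        using ramp_bounds(2)[OF a(2), of "F (u x) - k"] Fb[of x] unfolding h_def by linarith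
      define E where "E t = exp (F t)" for t
      define K where "K t = E t * h t" for t
      define kk where "kk t = - A * (E t * (h t + h' t))" for t
      have E1: "E (u x) \<ge> 1" for x using Fb(2)[of x] by (simp add: E_def)
      have cE: "continuous_on {0..1} E" unfolding E_def by (intro continuous_intros cF)
      have dh: "(h has_real_derivative h' t * (- A)) (at t within {0..1})" for t
      proof -
        have "((\<lambda>t. F t - k) has_real_derivative - A) (at t within {0..1})"
          using DERIV_diff[OF dF DERIV_const[of k]] by simp
        then show ?thesis unfolding h_def[abs_def] h'_def by (rule DERIV_chain2[OF ramp_deriv[OF a(2)]])
      qed
      have dE: "(E has_real_derivative E t * (- A)) (at t within {0..1})" for t
        unfolding E_def[abs_def] by (rule DERIV_chain2[OF DERIV_exp dF])
      have dK: "(K has_real_derivative kk t) (at t within {0..1})" for t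
        using DERIV_mult[OF dE dh] unfolding K_def[abs_def] kk_def by (simp add: algebra_simps)
      have ch: "continuous_on {0..1} h" by (rule DERIV_continuous_on[OF dh])
      have ch': "continuous_on {0..1} h'" unfolding h'_def[abs_def]
        by (intro continuous_on_compose2[OF ramp'_continuous[OF a(2)]] continuous_intros cF) auto
      have ck: "continuous_on {0..1} kk" unfolding kk_def[abs_def]
        by (intro continuous_intros cE ch ch')
      note [measurable] = continuous_comp_u(1)[OF cE] continuous_comp_u(1)[OF ch] continuous_comp_u(1)[OF ch']
      have g\<eta>: "norm (grad \<eta> x) \<le> Cc / (\<sigma> - \<rho>) * indicator ?B x" for x
        by (rule is_cutoff_grad_bound[OF cut\<eta> Cc a(4) p])
      have "cball x0 \<sigma> \<subseteq> \<Omega>" using sub a by (auto simp: subset_iff)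
      note supp = is_cutoff_support[OF cut\<eta> this]
      note en = energy_estimate[OF dK ck \<eta>D(1) is_cutoff_bounded[OF cut\<eta> Cc a(4) p] disjI2[OF supp]]
      define X where "X = (\<integral>x. \<eta> x * (E (u x) * (h (u x) + h' (u x))) * norm (g x) powr p \<partial>M)"
      define Y where "Y = (\<integral>x. E (u x) * h (u x) * norm (grad \<eta> x) * norm (g x) powr (p - 1) \<partial>M)"
      have "0 \<le> (\<integral>x. u x powr (p - 1) * (\<eta> x * K (u x)) \<partial>M)"
        using \<eta>D(2) hb by (intro Bochner_Integration.integral_nonneg) (auto simp: K_def E_def)
      then have "0 \<le> lam * (\<integral>x. u x powr (p - 1) * (\<eta> x * K (u x)) \<partial>M)" using lam by simp
      moreover have "(\<integral>x. \<eta> x * kk (u x) * norm (g x) powr p \<partial>M) = - A * X"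
      proof -
        have "(\<integral>x. \<eta> x * kk (u x) * norm (g x) powr p \<partial>M) = (\<integral>x. - A * (\<eta> x * (E (u x) * (h (u x) + h' (u x))) * norm (g x) powr p) \<partial>M)"
          by (intro Bochner_Integration.integral_cong) (auto simp: kk_def)
        then show ?thesis unfolding X_def by (simp only: integral_mult_right_zero)
      qed
      moreover have "(\<integral>x. \<bar>K (u x)\<bar> * norm (grad \<eta> x) * norm (g x) powr (p - 1) \<partial>M) = Y"
        unfolding Y_def by (intro Bochner_Integration.integral_cong) (auto simp: K_def abs_mult hb E_def)
      ultimately have AXY: "A * X \<le> Y" using en(1) by linarith
      define w where "w x = min (E (u x)) W" for x
      have [measurable]: "w \<in> borel_measurable borel" unfolding w_def by measurable
      have w: "1 \<le> w x" "w x \<le> W" for x using E1[of x] c0 by (auto simp: w_def W_def)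
      have wE: "AE x in M. x \<in> ?B \<longrightarrow> w x = E (u x)"
      proof -
        have "AE x in lborel. x \<in> ?B \<longrightarrow> w x = E (u x)"
          using aeF by eventually_elim (use a in \<open>auto simp: w_def E_def W_def\<close>)
        then show ?thesis unfolding M_eq by (subst AE_density) auto
      qed
      have s1: "(\<integral>x. \<eta> x * w x * (1 * h (u x) + h' (u x)) * (A * norm (g x)) powr p \<partial>M) = A powr p * X"
      proof -
        have "(\<integral>x. \<eta> x * w x * (1 * h (u x) + h' (u x)) * (A * norm (g x)) powr p \<partial>M)
          = (\<integral>x. A powr p * (\<eta> x * (E (u x) * (h (u x) + h' (u x))) * norm (g x) powr p) \<partial>M)"
        proof (rule integral_cong_AE)
          show "AE x in M. \<eta> x * w x * (1 * h (u x) + h' (u x)) * (A * norm (g x)) powr p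
            = A powr p * (\<eta> x * (E (u x) * (h (u x) + h' (u x))) * norm (g x) powr p)"
            using wE
          proof eventually_elim
            case (elim x)
            then show ?case using \<eta>D(5)[of x] A by (cases "x \<in> ?B") (auto simp: powr_mult)
          qed
        qed measurable
        then show ?thesis unfolding X_def by (simp only: integral_mult_right_zero)
      qed
      have s2: "(\<integral>x. w x * h (u x) * norm (grad \<eta> x) * (A * norm (g x)) powr (p - 1) \<partial>M) = A powr (p - 1) * Y"
      proof -
        have "(\<integral>x. w x * h (u x) * norm (grad \<eta> x) * (A * norm (g x)) powr (p - 1) \<partial>M)
          = (\<integral>x. A powr (p - 1) * (E (u x) * h (u x) * norm (grad \<eta> x) * norm (g x) powr (p - 1)) \<partial>M)"
        proof (rule integral_cong_AE)
          show "AE x in M. w x * h (u x) * norm (grad \<eta> x) * (A * norm (g x)) powr (p - 1)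
            = A powr (p - 1) * (E (u x) * h (u x) * norm (grad \<eta> x) * norm (g x) powr (p - 1))"
            using wE
          proof eventually_elim
            case (elim x)
            then show ?case using g\<eta>[of x] A by (cases "x \<in> ?B") (auto simp: powr_mult)
          qed
        qed measurable
        then show ?thesis unfolding Y_def by (simp only: integral_mult_right_zero)
      qed
      have "A powr p * X = A powr (p - 1) * (A * X)" using A by (simp add: powr_diff)
      also have "\<dots> \<le> A powr (p - 1) * Y" by (intro mult_left_mono AXY) auto
      finally have main_le: "(\<integral>x. \<eta> x * w x * (1 * h (u x) + h' (u x)) * (A * norm (g x)) powr p \<partial>M)
        \<le> (\<integral>x. w x * h (u x) * norm (grad \<eta> x) * (A * norm (g x)) powr (p - 1) \<partial>M)
          + 0 * (\<integral>x. indicator ?B x * h (u x) \<partial>M)"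
        unfolding s1 s2 by simp
      have hM: "h (u x) \<le> max (A + \<bar>k\<bar>) 1" "h' (u x) \<le> max (A + \<bar>k\<bar>) 1" for x
        using hb2[of x] hb(3)[of "u x"] by auto
      have res: "(\<integral>x. \<eta> x * h' (u x) * (A * norm (g x)) powr p \<partial>M)
        \<le> (W * (1 / 2) powr (1 - p) * (Cc / (\<sigma> - \<rho>)) powr p + 0) * (\<integral>x. indicator ?B x * h (u x) \<partial>M)"
        by (rule absorb_gradient(2)[where w = w and a = 1, OF _ _ _ _ _ _ _ _ _ _ _ _ _ hM(1) _ hM(2) _ order_refl _ \<eta>D(6)])
          (use \<eta>D(1-5) hb Cc a p A w main_le in auto)
      have ih: "integrable lborel (\<lambda>x. indicator ?B x * h (u x))"
        by (rule integrable_on_ball[of _ "A + \<bar>k\<bar>"]) (use hb hb2 in auto)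
      have "(\<integral>x. \<eta> x * h' (u x) * (A * norm (g x)) powr p \<partial>M)
        \<le> (W * (1 / 2) powr (1 - p) * (Cc / (\<sigma> - \<rho>)) powr p) * (\<integral>x. indicator ?B x * h (u x) \<partial>M)" using res by simp
      also have "\<dots> \<le> (W * (1 / 2) powr (1 - p) * (Cc / (\<sigma> - \<rho>)) powr p) * (\<integral>x. indicator ?B x * h (u x) \<partial>lborel)"
        by (intro mult_left_mono integral_M_le[OF _ _ ih]) (use hb in \<open>auto simp: W_def\<close>)
      also have "(Cc / (\<sigma> - \<rho>)) powr p = Cc powr p * (\<sigma> - \<rho>) powr (- p)"
        using Cc a by (simp add: powr_divide powr_minus_divide)
      finally show "(\<integral>x. \<eta> x * ramp' e (F (u x) - k) * (\<bar>- A\<bar> * norm (g x)) powr p \<partial>M)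
        \<le> C1 * (\<sigma> - \<rho>) powr (- p) * (\<integral>x. indicator ?B x * ramp e (F (u x) - k) \<partial>lborel)"
        using A by (simp add: C1_def h_def h'_def mult_ac)
    qed
    have "AE x in lborel. x \<in> ball x0 (r / 2) \<longrightarrow> F (u x) \<le> 1 + 1"
    proof (rule dg[OF r _ _ Fb(1) dgi])
      define Z where "Z = {x \<in> ball x0 r. c0 * S / 2 < 1 - u x}"
      have [measurable]: "Z \<in> sets borel" unfolding Z_def by measurable
      have ZF: "x \<in> Z \<longleftrightarrow> x \<in> ball x0 r \<and> 1 < F (u x)" for x
        using c0 S by (auto simp: Z_def F_def A_def field_simps)
      have "emeasure lborel Z \<le> emeasure lborel (ball x0 r)" unfolding Z_def by (rule emeasure_mono) auto
      also have "\<dots> < \<infinity>" by (rule emeasure_lborel_ball_finite)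
      finally have iZ: "integrable lborel (indicator Z :: 'a \<Rightarrow> real)"
        by (intro integrable_real_indicator) auto
      \<comment> \<open>\<open>F - 1\<close> is nonpositive off \<open>Z\<close> and at most
        \<open>2 / c0\<close> on it, which the factor \<open>c0 / 2\<close> in the density threshold
        compensates exactly.\<close>
      have "(\<integral>x. indicator (ball x0 r) x * max 0 (F (u x) - 1) \<partial>lborel) \<le> (\<integral>x. 2 / c0 * indicator Z x \<partial>lborel)"
      proof (rule integral_mono_AE)
        show "integrable lborel (\<lambda>x. indicator (ball x0 r) x * max 0 (F (u x) - 1))"
        proof (rule integrable_on_ball)
          show "\<bar>max 0 (F (u x) - 1)\<bar> \<le> A + 1" for x using Fb[of x] by linarith
        qed measurable
        show "AE x in lborel. indicator (ball x0 r) x * max 0 (F (u x) - 1) \<le> 2 / c0 * indicator Z x"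
          using aeF
        proof eventually_elim
          case (elim x)
          then show ?case using ZF[of x] c0 by (cases "x \<in> ball x0 r"; cases "x \<in> Z") auto
        qed
      qed (use iZ in auto)
      also have "\<dots> = 2 / c0 * measure lborel Z" by simp
      also have "\<dots> \<le> 2 / c0 * (\<nu>0 * c0 / 2 * r ^ DIM('a))"
        using small c0 unfolding Z_def by (intro mult_left_mono) auto
      also have "\<dots> = \<nu>0 * 1 * r ^ DIM('a)" using c0 by simp
      finally show "(\<integral>x. indicator (ball x0 r) x * max 0 (F (u x) - 1) \<partial>lborel) \<le> \<nu>0 * 1 * r ^ DIM('a)" .
    qed auto
    then show ?thesis
      by eventually_elim (use c0 S in \<open>auto simp: F_def A_def field_simps\<close>)
  qed
  then show ?thesis using \<nu>0 c0 by (intro exI[of _ "\<nu>0 * c0 / 2"]) auto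
qed

definition max_point :: "'a \<Rightarrow> bool" where
  "max_point x0 \<longleftrightarrow> (\<forall>r>0. \<forall>\<epsilon>>0. \<not> (AE x in lborel. x \<in> ball x0 r \<longrightarrow> u x \<le> 1 - \<epsilon>))"

lemma powr_conjugate_le:
  assumes "0 \<le> r" "r \<le> 1"
  shows "r powr (p / (p - 1)) \<le> r"
proof (cases "r = 0")
  case False
  have "r powr (p / (p - 1)) \<le> r powr 1" using assms p by (intro powr_mono') (auto simp: field_simps)
  then show ?thesis using assms by simp
qed simp

text \<open>Otherwise finitely many balls on which \<open>u\<close> stays away from 1 cover the
  compact closure, and the essential supremum would be below 1. Compactness yields a point of the
  closure only, so the boundary has to be excluded separately.\<close>

lemma max_point_exists:
  assumes "bounded \<Omega>" and "\<And>c. c < 1 \<Longrightarrow> \<not> (AE x in lborel. x \<in> \<Omega> \<longrightarrow> u x \<le> c)"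
  shows "\<exists>x0\<in>closure \<Omega>. max_point x0"
proof (rule ccontr)
  assume "\<not> ?thesis"
  then have "\<forall>x0\<in>closure \<Omega>. \<exists>r \<epsilon>. r > 0 \<and> \<epsilon> > 0 \<and> (AE x in lborel. x \<in> ball x0 r \<longrightarrow> u x \<le> 1 - \<epsilon>)"
    unfolding max_point_def by blast
  then obtain r \<epsilon> where re: "\<And>x0. x0 \<in> closure \<Omega> \<Longrightarrow> r x0 > 0" "\<And>x0. x0 \<in> closure \<Omega> \<Longrightarrow> \<epsilon> x0 > 0"
    "\<And>x0. x0 \<in> closure \<Omega> \<Longrightarrow> AE x in lborel. x \<in> ball x0 (r x0) \<longrightarrow> u x \<le> 1 - \<epsilon> x0"
    by metis
  have "compact (closure \<Omega>)" using assms(1) by simp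
  then obtain T where T: "T \<subseteq> closure \<Omega>" "finite T" "closure \<Omega> \<subseteq> (\<Union>x0\<in>T. ball x0 (r x0))"
    by (rule compactE_image[of _ "closure \<Omega>" "\<lambda>x0. ball x0 (r x0)"]) (use re(1) in force)+
  define e where "e = Min (insert 1 (\<epsilon> ` T))"
  have e: "e > 0" "\<And>x0. x0 \<in> T \<Longrightarrow> e \<le> \<epsilon> x0"
    using T re(2) by (auto simp: e_def)
  have "AE x in lborel. \<forall>x0\<in>T. x \<in> ball x0 (r x0) \<longrightarrow> u x \<le> 1 - \<epsilon> x0"
    using T re(3) by (intro AE_finite_allI) auto
  then have "AE x in lborel. x \<in> \<Omega> \<longrightarrow> u x \<le> 1 - e"
  proof eventually_elim
    case (elim x)
    show ?case
    proof
      assume "x \<in> \<Omega>"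
      then obtain x0 where "x0 \<in> T" "x \<in> ball x0 (r x0)" using T(3) closure_subset by blast
      then show "u x \<le> 1 - e" using elim e(2) by fastforce
    qed
  qed
  then show False using assms(2)[of "1 - e"] e(1) by simp
qed

text \<open>Near a point outside \<open>\<Omega>\<close> a half ball avoids \<open>\<Omega>\<close> by convexity, so \<open>1 - u = 1\<close> there and the weak
  Harnack inequality keeps \<open>u\<close> away from 1.\<close>

lemma max_point_interior:
  assumes "convex \<Omega>" "\<Omega> \<noteq> {}" "max_point x0"
  shows "x0 \<in> \<Omega>"
proof (rule ccontr)
  assume "x0 \<notin> \<Omega>"
  then obtain a b where ab: "a \<noteq> 0" "\<forall>x\<in>\<Omega>. a \<bullet> x \<le> b" "b \<le> a \<bullet> x0"
    using separating_hyperplane_sets[of \<Omega> "{x0}"] assms by auto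
  define \<omega>N where "\<omega>N = unit_ball_vol (real DIM('a))"
  have \<omega>N: "\<omega>N > 0" by (simp add: \<omega>N_def)
  obtain c where c: "c > 0" and wh: "\<And>x0 r m. 0 < r \<Longrightarrow> r \<le> 1 \<Longrightarrow> 0 < m \<Longrightarrow> m \<le> 1 \<Longrightarrow>
     \<omega>N / 2 ^ DIM('a) * r ^ DIM('a) \<le> measure lborel {x \<in> ball x0 r. m \<le> 1 - u x} \<Longrightarrow>
     (AE x in lborel. x \<in> ball x0 (r / 2) \<longrightarrow> c * m \<le> 1 - u x + r powr (p / (p - 1)))"
    using weak_harnack[of "\<omega>N / 2 ^ DIM('a)"] \<omega>N by auto
  \<comment> \<open>As \<open>p / (p - 1) > 1\<close>, the error term of the Harnack inequality is
    at most \<open>r\<close>, hence at most half of \<open>c\<close>.\<close>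
  define r where "r = min 1 (c / 2)"
  have r: "0 < r" "r \<le> 1" "r \<le> c / 2" using c by (auto simp: r_def)
  \<comment> \<open>Shifting by \<open>r / 2\<close> along the outer normal puts a ball of radius
    \<open>r / 2\<close> strictly beyond the separating hyperplane; its volume is the density
    threshold chosen above.\<close>
  define y where "y = x0 + (r / 2 / norm a) *\<^sub>R a"
  have yx: "dist x0 y = r / 2" using ab(1) r by (simp add: y_def dist_norm)
  have sub: "ball y (r / 2) \<subseteq> {x \<in> ball x0 r. 1 \<le> 1 - u x}"
  proof
    fix x assume x: "x \<in> ball y (r / 2)"
    have 1: "x \<in> ball x0 r" using dist_triangle[of x0 x y] yx x by simp
    have "\<bar>a \<bullet> (y - x)\<bar> \<le> norm a * norm (y - x)" by (rule Cauchy_Schwarz_ineq2)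
    also have "\<dots> < norm a * (r / 2)" using x ab(1) by (simp add: dist_norm)
    finally have "a \<bullet> y - a \<bullet> x < norm a * (r / 2)" unfolding inner_diff_right by linarith
    moreover have "a \<bullet> y = a \<bullet> x0 + norm a * (r / 2)"
      using ab(1) by (simp add: y_def inner_add_right power2_norm_eq_inner[symmetric] power2_eq_square)
    ultimately have "b < a \<bullet> x" using ab(3) by linarith
    then have "x \<notin> \<Omega>" using ab(2) by force
    then show "x \<in> {x \<in> ball x0 r. 1 \<le> 1 - u x}" using 1 off_u by simp
  qed
  have [measurable]: "ball x0 r \<in> sets borel" by simp
  have meas: "{x \<in> ball x0 r. 1 \<le> 1 - u x} \<in> sets lborel" by measurable
  have "emeasure lborel {x \<in> ball x0 r. 1 \<le> 1 - u x} \<le> emeasure lborel (ball x0 r)" by (rule emeasure_mono) auto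
  also have "\<dots> < \<infinity>" by (rule emeasure_lborel_ball_finite)
  finally have fm: "{x \<in> ball x0 r. 1 \<le> 1 - u x} \<in> fmeasurable lborel" using meas by (intro fmeasurableI) auto
  have "\<omega>N / 2 ^ DIM('a) * r ^ DIM('a) = measure lborel (ball y (r / 2))"
    using r by (simp add: content_ball \<omega>N_def power_divide)
  also have "\<dots> \<le> measure lborel {x \<in> ball x0 r. 1 \<le> 1 - u x}"
    by (rule measure_mono_fmeasurable[OF sub _ fm]) simp
  finally have "AE x in lborel. x \<in> ball x0 (r / 2) \<longrightarrow> c * 1 \<le> 1 - u x + r powr (p / (p - 1))"
    by (intro wh r) auto
  then have "AE x in lborel. x \<in> ball x0 (r / 2) \<longrightarrow> u x \<le> 1 - c / 2"
    by eventually_elim (use powr_conjugate_le[of r] r in auto)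
  then show False using assms(3) r c unfolding max_point_def by (metis half_gt_zero)
qed

text \<open>At each dyadic scale either the oscillation estimate improves the bound on \<open>1 - u\<close> by the natural
  factor, or \<open>1 - u\<close> is large on a set of positive density, which the weak Harnack inequality excludes
  at a maximum point.\<close>

lemma max_point_growth:
  assumes lam: "lam \<ge> 0" and x0: "x0 \<in> \<Omega>" "max_point x0"
  shows "\<exists>r0>0. cball x0 r0 \<subseteq> \<Omega> \<and> (\<forall>k::nat. AE x in lborel. x \<in> ball x0 (r0 / 2 ^ k) \<longrightarrow>
      1 - u x \<le> (2 powr (- (p / (p - 1)))) ^ k)"
proof -
  define q where "q = p / (p - 1)"
  define c0 where "c0 = (2::real) powr (- q)"
  have q: "q > 0" using p by (simp add: q_def)
  have c0: "0 < c0" "c0 \<le> 1" using q powr_mono[of "-q" 0 "2::real"] by (auto simp: c0_def)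
  obtain \<nu> where \<nu>: "\<nu> > 0" and sd: "\<And>x0 r S. 0 < r \<Longrightarrow> 0 < S \<Longrightarrow> cball x0 r \<subseteq> \<Omega> \<Longrightarrow>
     (AE x in lborel. x \<in> ball x0 r \<longrightarrow> 1 - u x \<le> S) \<Longrightarrow>
     measure lborel {x \<in> ball x0 r. c0 * S / 2 < 1 - u x} \<le> \<nu> * r ^ DIM('a) \<Longrightarrow>
     (AE x in lborel. x \<in> ball x0 (r / 2) \<longrightarrow> 1 - u x \<le> c0 * S)"
    using sup_decay[OF lam c0(1)] by blast
  obtain c where c: "c > 0" and wh: "\<And>x0 r m. 0 < r \<Longrightarrow> r \<le> 1 \<Longrightarrow> 0 < m \<Longrightarrow> m \<le> 1 \<Longrightarrow>
     \<nu> * r ^ DIM('a) \<le> measure lborel {x \<in> ball x0 r. m \<le> 1 - u x} \<Longrightarrow>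
     (AE x in lborel. x \<in> ball x0 (r / 2) \<longrightarrow> c * m \<le> 1 - u x + r powr q)"
    using weak_harnack[OF \<nu>] unfolding q_def by blast
  obtain r1 where r1: "r1 > 0" "cball x0 r1 \<subseteq> \<Omega>" using \<Omega>_open x0(1) open_contains_cball by blast
  \<comment> \<open>The last bound gives \<open>r0 powr q \<le> c * c0 / 4\<close>, so that at every
    scale the error term of the Harnack inequality is at most half of its lower bound
    \<open>c * c0 * S / 2\<close>.\<close>
  define r0 where "r0 = min r1 (min 1 (c * c0 / 4))"
  have r0: "0 < r0" "r0 \<le> 1" "r0 \<le> r1" "r0 \<le> c * c0 / 4" using r1 c c0 by (auto simp: r0_def)
  have sub: "cball x0 r0 \<subseteq> \<Omega>" using r1 r0(3) by (auto simp: subset_iff)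
  have r0q: "r0 powr q \<le> c * c0 / 4" using powr_conjugate_le[of r0] r0 unfolding q_def by auto
  have "AE x in lborel. x \<in> ball x0 (r0 / 2 ^ k) \<longrightarrow> 1 - u x \<le> c0 ^ k" for k
  proof (induction k)
    case 0
    show ?case using u_nonneg by simp
  next
    case (Suc k)
    define r where "r = r0 / 2 ^ k"
    define S where "S = c0 ^ k"
    have "(2::real) ^ k \<ge> 1" by simp
    then have "r \<le> r0" using r0(1) by (simp add: r_def divide_le_eq mult_le_cancel_left1)
    moreover have "0 < r" using r0(1) by (simp add: r_def)
    ultimately have r: "0 < r" "r \<le> 1" "r \<le> r0" using r0(2) by linarith+
    have S: "0 < S" "S \<le> 1" using c0 by (auto simp: S_def power_le_one)
    have subr: "cball x0 r \<subseteq> \<Omega>" using sub r(3) by (auto simp: subset_iff)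
    \<comment> \<open>Halving the radius multiplies \<open>r powr q\<close> by exactly
      \<open>c0\<close>. The error of the Harnack inequality and the bound \<open>S\<close>
      therefore shrink at the same rate, and the smallness of \<open>r0\<close> suffices for all
      scales.\<close>
    have rq: "r powr q = r0 powr q * S"
    proof -
      have "r powr q = r0 powr q / (2 ^ k) powr q" unfolding r_def by (rule powr_divide)
      also have "(2 ^ k) powr q = 1 / S"
        unfolding S_def c0_def by (simp add: powr_powr powr_minus_divide power_one_over mult.commute flip: powr_realpow)
      finally show ?thesis by simp
    qed
    have "measure lborel {x \<in> ball x0 r. c0 * S / 2 < 1 - u x} \<le> \<nu> * r ^ DIM('a)"
    proof (rule ccontr)
      assume big: "\<not> ?thesis"
      define m where "m = c0 * S / 2"
      have m: "0 < m" "m \<le> 1" using c0 S mult_le_one[of c0 S] by (auto simp: m_def)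
      have [measurable]: "ball x0 r \<in> sets borel" by simp
      have meas: "{x \<in> ball x0 r. m \<le> 1 - u x} \<in> sets lborel" "{x \<in> ball x0 r. m < 1 - u x} \<in> sets lborel" by measurable
      have "emeasure lborel {x \<in> ball x0 r. m \<le> 1 - u x} \<le> emeasure lborel (ball x0 r)" by (rule emeasure_mono) auto
      also have "\<dots> < \<infinity>" by (rule emeasure_lborel_ball_finite)
      finally have fm: "{x \<in> ball x0 r. m \<le> 1 - u x} \<in> fmeasurable lborel" using meas by (intro fmeasurableI) auto
      have "\<nu> * r ^ DIM('a) \<le> measure lborel {x \<in> ball x0 r. m < 1 - u x}" using big by (simp add: m_def)
      also have "\<dots> \<le> measure lborel {x \<in> ball x0 r. m \<le> 1 - u x}"
        by (rule measure_mono_fmeasurable[OF _ meas(2) fm]) auto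
      finally have "AE x in lborel. x \<in> ball x0 (r / 2) \<longrightarrow> c * m \<le> 1 - u x + r powr q"
        by (rule wh[OF r(1,2) m])
      then have "AE x in lborel. x \<in> ball x0 (r / 2) \<longrightarrow> u x \<le> 1 - c * c0 * S / 4"
      proof eventually_elim
        case (elim x)
        have "r powr q \<le> c * c0 / 4 * S" unfolding rq using r0q S by (intro mult_right_mono) auto
        then show ?case using elim by (auto simp: m_def)
      qed
      moreover have "c * c0 * S / 4 > 0" using c c0 S by simp
      ultimately show False using x0(2) r(1) unfolding max_point_def by (metis half_gt_zero)
    qed
    then have "AE x in lborel. x \<in> ball x0 (r / 2) \<longrightarrow> 1 - u x \<le> c0 * S"
      using Suc.IH by (intro sd r S subr) (auto simp: r_def S_def)
    then show ?case by (simp add: r_def S_def mult.commute)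
  qed
  then show ?thesis using r0(1) sub unfolding c0_def q_def by blast
qed

end

subsection \<open>Decay of the weight\<close>

context weak_solution begin

text \<open>The solution itself is an admissible test function: \<open>K t = t\<close> vanishes at
  0, so the constant 1 may serve as cutoff.\<close>

lemma energy_balance:
  "(\<integral>x. norm (g x) powr p \<partial>M) = lam * (\<integral>x. u x powr (p - 1) * u x \<partial>M)"
proof -
  have g1: "grad (\<lambda>_::'a. 1) x = 0" for x by (rule grad_eqI) simp
  have "\<bar>(\<integral>x. 1 * 1 * norm (g x) powr p \<partial>M) - lam * (\<integral>x. u x powr (p - 1) * (1 * u x) \<partial>M)\<bar>
      \<le> (\<integral>x. \<bar>u x\<bar> * norm (grad (\<lambda>_. 1) x) * norm (g x) powr (p - 1) \<partial>M)"
    by (rule energy_estimate(1)[of "\<lambda>t. t" "\<lambda>_. 1" "\<lambda>_. 1" 1]) (auto simp: g1)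
  then show ?thesis by (simp add: g1)
qed

text \<open>Eigenvalues are arbitrary reals by definition. Testing with \<open>u\<close> equates
  \<open>lam\<close> times a positive integral with an energy, which fixes the sign.\<close>

lemma lam_nonneg:
  assumes "\<not> (AE x in M. u x = 0)"
  shows "lam \<ge> 0"
proof -
  have u1: "u x powr (p - 1) \<le> 1" for x
    using powr_mono2[of "p - 1" "u x" 1] p u_nonneg[of x] u_le_1[of x] by simp
  have i: "integrable M (\<lambda>x. u x powr (p - 1) * u x)"
    by (rule integrable_const_bound_M[of _ 1]) (use u1 u_nonneg u_le_1 in \<open>auto simp: abs_mult intro: mult_le_one\<close>)
  have nn: "0 \<le> u x powr (p - 1) * u x" for x using u_nonneg by simp
  have "(\<integral>x. u x powr (p - 1) * u x \<partial>M) \<noteq> 0"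
  proof
    assume "(\<integral>x. u x powr (p - 1) * u x \<partial>M) = 0"
    then have "AE x in M. u x powr (p - 1) * u x = 0"
      using integral_nonneg_eq_0_iff_AE[of M "\<lambda>x. u x powr (p - 1) * u x"] i nn by simp
    then have "AE x in M. u x = 0" by eventually_elim auto
    then show False using assms by simp
  qed
  moreover have "(\<integral>x. u x powr (p - 1) * u x \<partial>M) \<ge> 0" using nn by (intro Bochner_Integration.integral_nonneg) auto
  ultimately have pos: "(\<integral>x. u x powr (p - 1) * u x \<partial>M) > 0" by simp
  have "(\<integral>x. norm (g x) powr p \<partial>M) \<ge> 0" by (intro Bochner_Integration.integral_nonneg) auto
  with energy_balance pos show ?thesis by (metis mult_neg_pos not_less)
qed

lemma gradient_zero:
  assumes "lam = 0"
  shows "AE x in M. g x = 0"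
proof -
  have i: "integrable M (\<lambda>x. norm (g x) powr p)" using integrable_powr_g[of "\<lambda>_. 1" 1] by simp
  have "(\<integral>x. norm (g x) powr p \<partial>M) = 0" using energy_balance assms by simp
  then have "AE x in M. norm (g x) powr p = 0"
    using integral_nonneg_eq_0_iff_AE[OF i] by simp
  then show ?thesis by eventually_elim auto
qed

lemma ball_measurable_M [measurable]: "ball y s \<in> sets M"
  by (simp add: sets_M)

text \<open>Testing with \<open>\<eta>\<close> bounds the mass of the smaller ball by the flux
  \<open>X\<close> through the cutoff, since \<open>u \<ge> 1 / 2\<close> there. Testing with
  \<open>\<eta> * (1 - u)\<close> shows that the energy \<open>E\<close> is at most
  \<open>S * X\<close>. Young's inequality bounds \<open>X\<close> by \<open>E\<close> and the mass
  of the larger ball, which closes the loop. All integrals are with respect to \<open>M\<close>, so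
  the weight is never compared between points.\<close>

lemma weighted_ball_decay:
  assumes lam: "lam > 0"
  shows "\<exists>C>0. \<forall>x0 r S. 0 < r \<and> 0 < S \<and> S \<le> 1 / 2 \<and> cball x0 r \<subseteq> \<Omega> \<and>
     (AE x in M. x \<in> ball x0 r \<longrightarrow> 1 - u x \<le> S) \<longrightarrow>
     measure M (ball x0 (r / 2)) \<le> C * r powr (- p) * S powr (p - 1) * measure M (ball x0 r)"
proof -
  obtain Cc where Cc: "Cc \<ge> 0" and cut: "\<And>(x0::'a) \<rho> \<sigma>. 0 < \<rho> \<Longrightarrow> \<rho> < \<sigma> \<Longrightarrow> \<exists>\<eta>. is_cutoff p Cc x0 \<rho> \<sigma> \<eta>"
    using cutoff_exists[OF p, where 'a = 'a] by blast
  \<comment> \<open>The summand 1 secures \<open>C > 0\<close> even if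
    \<open>Cc = 0\<close>.\<close>
  define C where "C = 2 powr (p - 1) / lam * (2 * 2 powr (p - 1) * (2 * Cc) powr p) + 1"
  have C0: "C > 0" using lam unfolding C_def by (intro add_nonneg_pos) auto
  have "measure M (ball x0 (r / 2)) \<le> C * r powr (- p) * S powr (p - 1) * measure M (ball x0 r)"
    if r: "0 < r" and S: "0 < S" "S \<le> 1 / 2" and sub: "cball x0 r \<subseteq> \<Omega>"
      and ae: "AE x in M. x \<in> ball x0 r \<longrightarrow> 1 - u x \<le> S" for x0 r S
  proof -
    interpret finite_measure M by (rule finite_M)
    have [measurable]: "ball y s \<in> sets borel" for y :: 'a and s by simp
    obtain \<eta> where \<eta>: "is_cutoff p Cc x0 (r / 2) r \<eta>" using cut[of "r / 2" r x0] r by auto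
    note \<eta>D = is_cutoffD[OF \<eta>]
    let ?B = "ball x0 r"
    note [measurable] = smooth_fun_measurable[OF \<eta>D(1)] grad_measurable[OF \<eta>D(1)]
    define G where "G = 2 * Cc / r"
    have G0: "G \<ge> 0" using Cc r by (simp add: G_def)
    have Geq: "Cc / (r - r / 2) = G" using r by (simp add: G_def field_simps)
    have n1: "norm (grad \<eta> x) \<le> G * \<eta> x powr ((p - 1) / p)" for x using \<eta>D(6)[of x] unfolding Geq .
    have n2: "norm (grad \<eta> x) \<le> G * indicator ?B x" for x
      using is_cutoff_grad_bound[OF \<eta> Cc _ p, of x] r unfolding Geq by simp
    note \<eta>12 = is_cutoff_bounded[OF \<eta> Cc _ p] and supp = is_cutoff_support[OF \<eta> sub]
    have rr: "r / 2 < r" using r by simp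
    have d1: "((\<lambda>t::real. 1 - t) has_real_derivative - 1) (at t within {0..1})" for t
      by (auto intro!: derivative_eq_intros)
    note en1 = energy_estimate[OF d1 continuous_on_const \<eta>D(1) \<eta>12(1)[OF rr] \<eta>12(2)[OF rr] disjI2[OF supp]]
    have d2: "((\<lambda>t::real. 1) has_real_derivative 0) (at t within {0..1})" for t by simp
    note en2 = energy_estimate[OF d2 continuous_on_const \<eta>D(1) \<eta>12(1)[OF rr] \<eta>12(2)[OF rr] disjI2[OF supp]]
    define E where "E = (\<integral>x. \<eta> x * norm (g x) powr p \<partial>M)"
    define X where "X = (\<integral>x. norm (grad \<eta> x) * norm (g x) powr (p - 1) \<partial>M)"
    have iX: "integrable M (\<lambda>x. norm (grad \<eta> x) * norm (g x) powr (p - 1))" using en2(3) by simp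
    have iE: "integrable M (\<lambda>x. \<eta> x * norm (g x) powr p)" using en1(2) by simp
    have EX: "E \<le> S * X"
    proof -
      have "0 \<le> (\<integral>x. u x powr (p - 1) * (\<eta> x * (1 - u x)) \<partial>M)"
        using \<eta>D(2) u_le_1 by (intro Bochner_Integration.integral_nonneg) auto
      then have "0 \<le> lam * (\<integral>x. u x powr (p - 1) * (\<eta> x * (1 - u x)) \<partial>M)" using lam by simp
      then have "E \<le> (\<integral>x. \<bar>1 - u x\<bar> * norm (grad \<eta> x) * norm (g x) powr (p - 1) \<partial>M)"
        using en1(1) unfolding E_def by simp
      also have "\<dots> \<le> (\<integral>x. S * (norm (grad \<eta> x) * norm (g x) powr (p - 1)) \<partial>M)"
      proof (rule integral_mono_AE[OF en1(3)])
        show "AE x in M. \<bar>1 - u x\<bar> * norm (grad \<eta> x) * norm (g x) powr (p - 1) \<le> S * (norm (grad \<eta> x) * norm (g x) powr (p - 1))"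
          using ae
        proof eventually_elim
          case (elim x)
          show ?case
          proof (cases "x \<in> ?B")
            case True
            with elim have "\<bar>1 - u x\<bar> * (norm (grad \<eta> x) * norm (g x) powr (p - 1)) \<le> S * (norm (grad \<eta> x) * norm (g x) powr (p - 1))"
              using u_le_1[of x] by (intro mult_right_mono) auto
            then show ?thesis by (simp add: mult.assoc)
          next
            case False
            then show ?thesis using n2[of x] by simp
          qed
        qed
      qed (use iX in auto)
      finally show ?thesis unfolding X_def by simp
    qed
    have iB: "integrable M (indicator ?B :: 'a \<Rightarrow> real)"
      by (rule integrable_const_bound_M[of _ 1]) (auto simp: indicator_def)
    \<comment> \<open>With \<open>E \<le> S * X\<close> this makes \<open>\<epsilon> * E\<close> at
      most \<open>X / 2\<close>. The other term of Young's inequality carries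
      \<open>\<epsilon> powr (1 - p)\<close>, the origin of the power
      \<open>S powr (p - 1)\<close>.\<close>
    define \<epsilon> where "\<epsilon> = 1 / (2 * S)"
    have \<epsilon>: "\<epsilon> > 0" using S by (simp add: \<epsilon>_def)
    have "X \<le> (\<integral>x. \<epsilon> * (\<eta> x * norm (g x) powr p) + (\<epsilon> powr (1 - p) * G powr p) * indicator ?B x \<partial>M)"
      unfolding X_def
    proof (rule integral_mono[OF iX])
      show "integrable M (\<lambda>x. \<epsilon> * (\<eta> x * norm (g x) powr p) + (\<epsilon> powr (1 - p) * G powr p) * indicator ?B x)"
        using iE iB by auto
      show "norm (grad \<eta> x) * norm (g x) powr (p - 1) \<le> \<epsilon> * (\<eta> x * norm (g x) powr p) + (\<epsilon> powr (1 - p) * G powr p) * indicator ?B x" for x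
      proof (cases "x \<in> ?B")
        case True
        then show ?thesis using young_cutoff[OF p norm_ge_zero \<eta>D(2) G0 \<epsilon> n1, of "g x" x] by (simp add: mult.commute)
      next
        case False
        then show ?thesis using n2[of x] \<eta>D(5)[of x] by simp
      qed
    qed
    also have "\<dots> = \<epsilon> * E + (\<epsilon> powr (1 - p) * G powr p) * measure M ?B"
      using iE iB by (simp add: E_def M_space)
    also have "\<epsilon> * E \<le> X / 2" using mult_left_mono[OF EX, of \<epsilon>] S \<epsilon> by (simp add: \<epsilon>_def)
    finally have X1: "X \<le> 2 * (\<epsilon> powr (1 - p) * G powr p) * measure M ?B" by simp
    have "\<epsilon> powr (1 - p) = 2 powr (p - 1) * S powr (p - 1)"
      using S by (simp add: \<epsilon>_def powr_divide powr_mult powr_diff)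
    moreover have "G powr p = (2 * Cc) powr p * r powr (- p)"
      using Cc r by (simp add: G_def powr_divide powr_minus_divide)
    ultimately have X2: "X \<le> (2 * 2 powr (p - 1) * (2 * Cc) powr p) * (r powr (- p) * S powr (p - 1) * measure M ?B)"
      using X1 by (simp add: mult_ac)
    have "lam * ((1 / 2) powr (p - 1) * measure M (ball x0 (r / 2))) \<le> lam * (\<integral>x. u x powr (p - 1) * (\<eta> x * 1) \<partial>M)"
    proof (rule mult_left_mono)
      have iB2: "integrable M (indicator (ball x0 (r / 2)) :: 'a \<Rightarrow> real)"
        by (rule integrable_const_bound_M[of _ 1]) (auto simp: indicator_def)
      have "(1 / 2) powr (p - 1) * measure M (ball x0 (r / 2)) = (\<integral>x. (1 / 2) powr (p - 1) * indicator (ball x0 (r / 2)) x \<partial>M)"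
        by (simp add: M_space)
      also have "\<dots> \<le> (\<integral>x. u x powr (p - 1) * (\<eta> x * 1) \<partial>M)"
      proof (rule integral_mono_AE[OF _ en2(4)])
        show "AE x in M. (1 / 2) powr (p - 1) * indicator (ball x0 (r / 2)) x \<le> u x powr (p - 1) * (\<eta> x * 1)"
          using ae
        proof eventually_elim
          case (elim x)
          show ?case
          proof (cases "x \<in> ball x0 (r / 2)")
            case True
            then have "x \<in> ?B" "\<eta> x = 1" using r \<eta>D(4)[of x] by (auto simp: dist_norm norm_minus_commute)
            then show ?thesis using elim S True p by (auto intro!: powr_mono2)
          next
            case False
            then show ?thesis using \<eta>D(2)[of x] by simp
          qed
        qed
      qed (use iB2 in auto)
      finally show "(1 / 2) powr (p - 1) * measure M (ball x0 (r / 2)) \<le> (\<integral>x. u x powr (p - 1) * (\<eta> x * 1) \<partial>M)" .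
    qed (use lam in auto)
    also have "\<dots> \<le> X" using en2(1) unfolding X_def by simp
    finally have "lam * ((1 / 2) powr (p - 1) * measure M (ball x0 (r / 2))) \<le> X" .
    then have "measure M (ball x0 (r / 2)) \<le> 2 powr (p - 1) / lam * X"
      using lam by (simp add: powr_divide field_simps)
    also have "\<dots> \<le> 2 powr (p - 1) / lam * ((2 * 2 powr (p - 1) * (2 * Cc) powr p) * (r powr (- p) * S powr (p - 1) * measure M ?B))"
      using lam by (intro mult_left_mono X2) auto
    also have "\<dots> = (C - 1) * (r powr (- p) * S powr (p - 1) * measure M ?B)"
      by (simp add: C_def)
    also have "\<dots> \<le> C * (r powr (- p) * S powr (p - 1) * measure M ?B)"
      by (intro mult_right_mono) auto
    finally show ?thesis by (simp add: mult.assoc)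
  qed
  then show ?thesis using C0 by blast
qed

end

text \<open>Cauchy-Schwarz for \<open>1 = sqrt W * sqrt (1 / W)\<close>, obtained from
  \<open>2 \<le> t * W + 1 / (t * W)\<close> by a choice of \<open>t\<close>. With
  \<open>J + 1\<close> in place of \<open>J\<close> the parameter is positive also when
  \<open>J = 0\<close>.\<close>

lemma ball_volume_square_le:
  fixes W :: "'a::euclidean_space \<Rightarrow> real"
  assumes [measurable]: "W \<in> borel_measurable borel" "B \<in> sets borel" and b: "b > 0" "measure lborel B = b" "integrable lborel (indicator B :: 'a \<Rightarrow> real)"
    and W: "AE x in lborel. x \<in> B \<longrightarrow> W x > 0"
    and iW: "integrable lborel (\<lambda>x. indicator B x * W x)"
    and iV: "integrable lborel (\<lambda>x. indicator B x * inverse (W x))" and J: "(\<integral>x. indicator B x * inverse (W x) \<partial>lborel) \<le> J" "J \<ge> 0"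
  shows "b\<^sup>2 \<le> (J + 1) * (\<integral>x. indicator B x * W x \<partial>lborel)"
proof -
  define t where "t = (J + 1) / b"
  have t: "t > 0" using J b by (simp add: t_def)
  have "2 * b = (\<integral>x. 2 * indicator B x \<partial>lborel)" using b by simp
  also have "\<dots> \<le> (\<integral>x. t * (indicator B x * W x) + 1 / t * (indicator B x * inverse (W x)) \<partial>lborel)"
  proof (rule integral_mono_AE)
    show "AE x in lborel. 2 * indicator B x \<le> t * (indicator B x * W x) + 1 / t * (indicator B x * inverse (W x))"
      using W
    proof eventually_elim
      case (elim x)
      show ?case
      proof (cases "x \<in> B")
        case True
        define y where "y = t * W x"
        have y: "y > 0" using elim True t by (simp add: y_def)
        have "2 * y / y \<le> (y\<^sup>2 + 1) / y"
          using sum_squares_bound[of y 1] y by (intro divide_right_mono) auto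
        then have "2 \<le> y + 1 / y" using y by (simp add: add_divide_distrib power2_eq_square)
        then have "2 \<le> t * W x + 1 / (t * W x)" by (simp add: y_def)
        then show ?thesis using True by (simp add: inverse_eq_divide)
      qed auto
    qed
  qed (use b iW iV in auto)
  also have "\<dots> = t * (\<integral>x. indicator B x * W x \<partial>lborel) + 1 / t * (\<integral>x. indicator B x * inverse (W x) \<partial>lborel)"
    using iW iV by simp
  also have "1 / t * (\<integral>x. indicator B x * inverse (W x) \<partial>lborel) \<le> b"
  proof -
    have "1 / t * (\<integral>x. indicator B x * inverse (W x) \<partial>lborel) \<le> 1 / t * (J + 1)"
      using t J by (intro mult_left_mono) auto
    also have "\<dots> = b" using J b by (simp add: t_def)
    finally show ?thesis .
  qed
  finally have "b \<le> t * (\<integral>x. indicator B x * W x \<partial>lborel)" by simp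
  then have "b * b \<le> b * (t * (\<integral>x. indicator B x * W x \<partial>lborel))" using b by (intro mult_left_mono) auto
  then show ?thesis using b by (simp add: t_def power2_eq_square)
qed

text \<open>Once \<open>C * \<theta> ^ k < a / 2\<close> the sequence loses at least a factor
  \<open>a / 2\<close> per step, which the lower bound, losing only \<open>a\<close> per step, does
  not permit.\<close>

lemma superpolynomial_decay_impossible:
  fixes m :: "nat \<Rightarrow> real"
  assumes low: "\<And>k. c * a ^ k \<le> m k" and c: "c > 0" and a: "0 < a"
    and dec: "\<And>k. k \<ge> 1 \<Longrightarrow> m (Suc k) \<le> C * \<theta> ^ k * m k" and \<theta>: "0 < \<theta>" "\<theta> < 1" and m: "\<And>k. 0 \<le> m k"
  shows False
proof -
  have "(\<lambda>k. C * \<theta> ^ k) \<longlonglongrightarrow> C * 0"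
    using \<theta> by (intro tendsto_mult tendsto_const LIMSEQ_realpow_zero) auto
  then have "\<forall>\<^sub>F k in sequentially. C * \<theta> ^ k < a / 2" using a by (intro order_tendstoD) auto
  then obtain k0 where k0: "\<And>k. k \<ge> k0 \<Longrightarrow> C * \<theta> ^ k < a / 2" by (auto simp: eventually_sequentially)
  define k1 where "k1 = max k0 1"
  have bound: "m (k1 + j) \<le> (a / 2) ^ j * m k1" for j
  proof (induction j)
    case (Suc j)
    have "m (Suc (k1 + j)) \<le> C * \<theta> ^ (k1 + j) * m (k1 + j)" by (rule dec) (simp add: k1_def)
    also have "\<dots> \<le> a / 2 * m (k1 + j)"
      by (intro mult_right_mono m less_imp_le[OF k0]) (simp add: k1_def)
    also have "\<dots> \<le> a / 2 * ((a / 2) ^ j * m k1)" using a by (intro mult_left_mono Suc) auto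
    finally show ?case by simp
  qed simp
  have "c * a ^ k1 \<le> (1 / 2) ^ j * m k1" for j
  proof -
    have "c * a ^ k1 * a ^ j \<le> (a / 2) ^ j * m k1"
      using order_trans[OF low bound[of j]] by (simp add: power_add mult.assoc)
    also have "\<dots> = ((1 / 2) ^ j * m k1) * a ^ j" by (simp add: power_divide field_simps)
    finally show ?thesis using a by simp
  qed
  moreover have "(\<lambda>j. (1 / 2) ^ j * m k1) \<longlonglongrightarrow> 0 * m k1"
    by (intro tendsto_mult tendsto_const LIMSEQ_realpow_zero) auto
  ultimately have "c * a ^ k1 \<le> 0" by (intro LIMSEQ_le_const[of _ 0]) auto
  then show False using mult_pos_pos[OF c zero_less_power[OF a, of k1]] by linarith
qed

subsection \<open>From eigenfunctions to weak solutions\<close>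

text \<open>This settles the degenerate case of a zero eigenvalue, where constants may belong to the weighted
  space with zero boundary values.\<close>

lemma eq_1_on_ball_of_zero_gradient:
  fixes W u :: "'a::euclidean_space \<Rightarrow> real" and \<phi> :: "nat \<Rightarrow> 'a \<Rightarrow> real"
  assumes p: "p > 1" and [measurable]: "W \<in> borel_measurable borel" "u \<in> borel_measurable borel"
    and W0: "\<And>x. 0 \<le> W x" and Wpos: "AE x in lborel. x \<in> ball x0 R \<longrightarrow> W x > 0"
    and iW: "integrable lborel (\<lambda>x. indicator (ball x0 R) x * W x powr (1 / (1 - p)))"
    and \<phi>: "\<And>n. smooth_fun (\<phi> n)"
    and lim_u: "(\<lambda>n. \<integral>\<^sup>+x. ennreal (W x * \<bar>\<phi> n x - u x\<bar> powr p) \<partial>lborel) \<longlonglongrightarrow> 0"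
    and lim_g: "(\<lambda>n. \<integral>\<^sup>+x. ennreal (W x * norm (grad (\<phi> n) x) powr p) \<partial>lborel) \<longlonglongrightarrow> 0"
    and mx: "\<And>s. s < 1 \<Longrightarrow> \<not> (AE x in lborel. x \<in> ball x0 R \<longrightarrow> u x \<le> s)"
  shows "AE x in lborel. x \<in> ball x0 R \<longrightarrow> 1 \<le> u x"
proof -
  let ?B = "ball x0 R"
  have [measurable]: "ball y s \<in> sets borel" for y :: 'a and s by simp
  note [measurable] = smooth_fun_measurable[OF \<phi>] grad_measurable[OF \<phi>]
  \<comment> \<open>The exponent is chosen so that
    \<open>f powr (p - 1) * W powr (1 / p) = 1\<close> on the ball, while \<open>f powr p\<close> is
    the dual weight assumed integrable. Convergence in weighted \<open>Lp\<close> thereby becomes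
    convergence in \<open>L1\<close> of the ball.\<close>
  define f where "f x = indicator ?B x * W x powr (- 1 / (p * (p - 1)))" for x
  have [measurable]: "f \<in> borel_measurable borel" unfolding f_def by measurable
  have fp: "f x powr p = indicator ?B x * W x powr (1 / (1 - p))" for x
  proof -
    have "- 1 / (p * (p - 1)) * p = 1 / (1 - p)" using p by (simp add: field_simps)
    then show ?thesis unfolding f_def by (cases "x \<in> ?B") (auto simp: powr_powr)
  qed
  have fp1: "f x powr (p - 1) * (W x powr (1 / p) * a) = indicator ?B x * a" if "x \<in> ?B \<longrightarrow> W x > 0" for x a
  proof (cases "x \<in> ?B")
    case True
    have "- 1 / (p * (p - 1)) * (p - 1) = - (1 / p)" using p by (simp add: field_simps)
    then have "f x powr (p - 1) = W x powr (- (1 / p))" using True unfolding f_def by (simp add: powr_powr)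
    moreover have "W x powr (- (1 / p)) * W x powr (1 / p) = 1" using that True by (simp flip: powr_add)
    ultimately show ?thesis using True by (simp add: mult.assoc[symmetric])
  qed (simp add: f_def)
  have L1: "(\<lambda>n. \<integral>\<^sup>+x. indicator ?B x * ennreal (a n x) \<partial>lborel) \<longlonglongrightarrow> 0"
    if [measurable]: "\<And>n. a n \<in> borel_measurable borel" and a: "\<And>n x. 0 \<le> a n x"
      and l: "(\<lambda>n. \<integral>\<^sup>+x. ennreal (W x * a n x powr p) \<partial>lborel) \<longlonglongrightarrow> 0" for a :: "nat \<Rightarrow> 'a \<Rightarrow> real"
  proof -
    have "(\<lambda>n. \<integral>\<^sup>+x. ennreal (f x powr (p - 1) * (W x powr (1 / p) * a n x)) \<partial>lborel) \<longlonglongrightarrow> 0"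
    proof (rule tendsto_nn_integral_young[OF p])
      show "integrable lborel (\<lambda>x. f x powr p)" unfolding fp by (rule iW)
      show "0 \<le> f x" for x by (simp add: f_def)
      have "(W x powr (1 / p) * a n x) powr p = W x * a n x powr p" for x n
        using W0[of x] p by (simp add: powr_mult powr_powr)
      then show "(\<lambda>n. \<integral>\<^sup>+x. ennreal ((W x powr (1 / p) * a n x) powr p) \<partial>lborel) \<longlonglongrightarrow> 0" using l by simp
    qed (use a in auto)
    moreover have "(\<integral>\<^sup>+x. ennreal (f x powr (p - 1) * (W x powr (1 / p) * a n x)) \<partial>lborel) = (\<integral>\<^sup>+x. indicator ?B x * ennreal (a n x) \<partial>lborel)" for n
    proof (rule nn_integral_cong_AE)
      show "AE x in lborel. ennreal (f x powr (p - 1) * (W x powr (1 / p) * a n x)) = indicator ?B x * ennreal (a n x)"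
        using Wpos by eventually_elim (simp add: fp1 indicator_def)
    qed
    ultimately show ?thesis by simp
  qed
  define A where "A n = (\<integral>\<^sup>+x. indicator ?B x * ennreal \<bar>\<phi> n x - u x\<bar> \<partial>lborel)" for n
  define D where "D n = (\<integral>\<^sup>+x. indicator ?B x * ennreal (norm (grad (\<phi> n) x)) \<partial>lborel)" for n
  have A: "A \<longlonglongrightarrow> 0" unfolding A_def by (rule L1) (use lim_u in auto)
  have D: "D \<longlonglongrightarrow> 0" unfolding D_def by (rule L1) (use lim_g in auto)
  have ge: "AE x in lborel. x \<in> ?B \<longrightarrow> s \<le> u x" if s: "s < 1" for s
  proof -
    \<comment> \<open>Poincare's inequality wants a nonnegative function vanishing on a set of
      positive measure. By \<open>mx\<close> the set \<open>s \<le> u\<close> has positive measure,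
      and \<open>F\<close> is 1-Lipschitz in \<open>u\<close>, so its first differences vanish with
      those of \<open>\<phi> n\<close>.\<close>
    define F where "F x = max 0 (s - u x)" for x
    have [measurable]: "F \<in> borel_measurable borel" unfolding F_def by measurable
    have T: "(\<integral>\<^sup>+x. indicator ?B x * indicator ?B (x + h) * ennreal \<bar>F (x + h) - F x\<bar> \<partial>lborel) \<le> ennreal (norm h) * 0" for h
    proof -
      let ?L = "\<integral>\<^sup>+x. indicator ?B x * indicator ?B (x + h) * ennreal \<bar>F (x + h) - F x\<bar> \<partial>lborel"
      have "?L \<le> ennreal (norm h) * D n + (A n + A n)" for n
      proof -
        have "?L \<le> (\<integral>\<^sup>+x. indicator ?B x * indicator ?B (x + h) * ennreal \<bar>\<phi> n (x + h) - \<phi> n x\<bar>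
            + (indicator ?B (h + x) * ennreal \<bar>\<phi> n (h + x) - u (h + x)\<bar> + indicator ?B x * ennreal \<bar>\<phi> n x - u x\<bar>) \<partial>lborel)"
        proof (rule nn_integral_mono)
          fix x
          have "\<bar>F (x + h) - F x\<bar> \<le> \<bar>\<phi> n (x + h) - \<phi> n x\<bar> + (\<bar>\<phi> n (h + x) - u (h + x)\<bar> + \<bar>\<phi> n x - u x\<bar>)"
            unfolding F_def add.commute[of h x] by linarith
          then have "ennreal \<bar>F (x + h) - F x\<bar> \<le> ennreal \<bar>\<phi> n (x + h) - \<phi> n x\<bar> + (ennreal \<bar>\<phi> n (h + x) - u (h + x)\<bar> + ennreal \<bar>\<phi> n x - u x\<bar>)"
            by (simp flip: ennreal_plus add: ennreal_leI)
          then show "indicator ?B x * indicator ?B (x + h) * ennreal \<bar>F (x + h) - F x\<bar>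
            \<le> indicator ?B x * indicator ?B (x + h) * ennreal \<bar>\<phi> n (x + h) - \<phi> n x\<bar>
            + (indicator ?B (h + x) * ennreal \<bar>\<phi> n (h + x) - u (h + x)\<bar> + indicator ?B x * ennreal \<bar>\<phi> n x - u x\<bar>)"
            by (cases "x \<in> ?B"; cases "x + h \<in> ?B") (simp_all add: add.commute[of h x])
        qed
        also have "\<dots> = (\<integral>\<^sup>+x. indicator ?B x * indicator ?B (x + h) * ennreal \<bar>\<phi> n (x + h) - \<phi> n x\<bar> \<partial>lborel)
            + (\<integral>\<^sup>+x. indicator ?B (h + x) * ennreal \<bar>\<phi> n (h + x) - u (h + x)\<bar> + indicator ?B x * ennreal \<bar>\<phi> n x - u x\<bar> \<partial>lborel)"
          by (rule nn_integral_add) measurable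
        also have "(\<integral>\<^sup>+x. indicator ?B (h + x) * ennreal \<bar>\<phi> n (h + x) - u (h + x)\<bar> + indicator ?B x * ennreal \<bar>\<phi> n x - u x\<bar> \<partial>lborel)
            = (\<integral>\<^sup>+x. indicator ?B (h + x) * ennreal \<bar>\<phi> n (h + x) - u (h + x)\<bar> \<partial>lborel) + A n"
          unfolding A_def by (rule nn_integral_add) measurable
        also have "(\<integral>\<^sup>+x. indicator ?B (h + x) * ennreal \<bar>\<phi> n (h + x) - u (h + x)\<bar> \<partial>lborel) = A n"
          unfolding A_def by (rule nn_integral_shift_lborel[where f = "\<lambda>x. indicator ?B x * ennreal \<bar>\<phi> n x - u x\<bar>"]) measurable
        also have "(\<integral>\<^sup>+x. indicator ?B x * indicator ?B (x + h) * ennreal \<bar>\<phi> n (x + h) - \<phi> n x\<bar> \<partial>lborel) \<le> ennreal (norm h) * D n"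
          unfolding D_def by (rule translation_estimate_C1[OF smooth_fun_has_derivative[OF \<phi>] continuous_on_grad[OF \<phi>]]) auto
        finally show ?thesis by (simp add: add_right_mono)
      qed
      moreover have "(\<lambda>n. ennreal (norm h) * D n + (A n + A n)) \<longlonglongrightarrow> ennreal (norm h) * 0 + (0 + 0)"
        by (intro tendsto_add A ennreal_tendsto_cmult D) auto
      ultimately show ?thesis by (intro LIMSEQ_le_const[of _ "ennreal (norm h) * 0"]) auto
    qed
    define Z where "Z = {x \<in> ?B. s \<le> u x}"
    have [measurable]: "Z \<in> sets borel" unfolding Z_def by measurable
    have "emeasure lborel Z * (\<integral>\<^sup>+x. indicator ?B x * ennreal (F x) \<partial>lborel) \<le> emeasure lborel (ball (0::'a) (2 * R)) * (ennreal (2 * R) * 0)"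
      by (rule poincare_L1[OF _ _ _ _ _ T]) (auto simp: Z_def F_def)
    moreover have "emeasure lborel Z \<noteq> 0"
    proof
      assume "emeasure lborel Z = 0"
      then have "AE x in lborel. x \<notin> Z" by (intro AE_not_in) (auto simp: null_sets_def)
      then have "AE x in lborel. x \<in> ?B \<longrightarrow> u x \<le> s" by eventually_elim (auto simp: Z_def)
      then show False using mx[OF s] by simp
    qed
    ultimately have "(\<integral>\<^sup>+x. indicator ?B x * ennreal (F x) \<partial>lborel) = 0" by simp
    then have "AE x in lborel. indicator ?B x * ennreal (F x) = 0"
      by (subst (asm) nn_integral_0_iff_AE) auto
    then show ?thesis
      by eventually_elim (auto simp: F_def indicator_def ennreal_eq_0_iff)
  qed
  have "AE x in lborel. \<forall>n. x \<in> ?B \<longrightarrow> 1 - 1 / real (Suc n) \<le> u x"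
    unfolding AE_all_countable by (intro allI ge) auto
  then show ?thesis
  proof eventually_elim
    case (elim x)
    show ?case
    proof
      assume "x \<in> ?B"
      have "(\<lambda>n. 1 - 1 / real (Suc n)) \<longlonglongrightarrow> 1 - 0"
        by (intro tendsto_diff tendsto_const LIMSEQ_Suc[OF lim_inverse_n'])
      then show "1 \<le> u x" using elim \<open>x \<in> ?B\<close> by (intro LIMSEQ_le_const2) auto
    qed
  qed
qed

text \<open>The real-valued statement is applied to each coordinate, and the finitely many
  exceptional null sets are merged.\<close>

lemma borel_representative:
  fixes g :: "'a::euclidean_space \<Rightarrow> 'a"
  assumes "g \<in> borel_measurable lebesgue"
  shows "\<exists>g'\<in>borel_measurable borel. AE x in lborel. g x = g' x"
proof -
  have "\<exists>f'. f' \<in> borel_measurable borel \<and> (AE x in lborel. g x \<bullet> b = f' x)" for b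
  proof -
    have "(\<lambda>x. g x \<bullet> b) \<in> borel_measurable (completion lborel)" using assms by measurable
    from completion_ex_borel_measurable_real[OF this] show ?thesis by auto
  qed
  then obtain f where f: "\<And>b. f b \<in> borel_measurable borel" "\<And>b. AE x in lborel. g x \<bullet> b = f b x" by metis
  note [measurable] = f(1)
  have "AE x in lborel. \<forall>b\<in>Basis. g x \<bullet> b = f b x" using f(2) by (intro AE_finite_allI) auto
  then have "AE x in lborel. g x = (\<Sum>b\<in>Basis. f b x *\<^sub>R b)"
  proof eventually_elim
    case (elim x)
    then show ?case using euclidean_representation[of "g x"] by simp
  qed
  then show ?thesis by (intro bexI[of _ "\<lambda>x. \<Sum>b\<in>Basis. f b x *\<^sub>R b"]) auto
qed

text \<open>Borel representatives are chosen, clamped to the unit interval and extended by 0, and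
  the approximating sequence is thinned out until it converges almost everywhere. The weighted
  \<open>Lp\<close> limits are returned as well, because the case of a zero eigenvalue needs them in
  unreduced form.\<close>

lemma eigenpair_weak_solution:
  fixes \<Omega> :: "'a::euclidean_space set"
  assumes \<Omega>: "open \<Omega>" "bounded \<Omega>" and p: "p > 1"
    and w: "continuous_on (closure \<Omega>) w" "\<forall>x\<in>closure \<Omega>. 0 \<le> w x" "AE x in lebesgue. x \<in> \<Omega> \<longrightarrow> w x > 0"
    and ep: "eigenpair p w \<Omega> lam u g"
    and u: "AE x in lebesgue. x \<in> \<Omega> \<longrightarrow> u x > 0" "AE x in lebesgue. x \<in> \<Omega> \<longrightarrow> \<bar>u x\<bar> \<le> 1"
  defines "W \<equiv> \<lambda>x. if x \<in> \<Omega> then w x else 0"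
  shows "\<exists>u' g' \<phi>. weak_solution (density lborel (\<lambda>x. ennreal (W x))) \<Omega> p lam u' g' \<phi> \<and>
     (AE x in lborel. x \<in> \<Omega> \<longrightarrow> u x = u' x) \<and> (\<forall>x. x \<notin> \<Omega> \<longrightarrow> u' x = 0 \<and> g' x = 0) \<and>
     (\<lambda>n. \<integral>\<^sup>+x. ennreal (W x * \<bar>\<phi> n x - u' x\<bar> powr p) \<partial>lborel) \<longlonglongrightarrow> 0 \<and>
     (\<lambda>n. \<integral>\<^sup>+x. ennreal (W x * norm (grad (\<phi> n) x - g' x) powr p) \<partial>lborel) \<longlonglongrightarrow> 0"
proof -
  have [measurable]: "\<Omega> \<in> sets borel" using \<Omega> by simp
  have "W = (\<lambda>x. indicator \<Omega> x *\<^sub>R w x)" by (auto simp: W_def indicator_def)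
  then have Wm [measurable]: "W \<in> borel_measurable borel"
    using borel_measurable_continuous_on_indicator[OF _ continuous_on_subset[OF w(1) closure_subset]] by simp
  have W0: "0 \<le> W x" for x using w(2) closure_subset[of \<Omega>] by (auto simp: W_def)
  have AE_lborel: "AE x in lborel. P x" if "AE x in lebesgue. P x" "Measurable.pred lborel P" for P :: "'a \<Rightarrow> bool"
    using that AE_completion_iff by blast
  have "bounded (w ` closure \<Omega>)"
    using w(1) \<Omega>(2) by (intro compact_imp_bounded compact_continuous_image) auto
  then obtain Wb where "\<forall>x\<in>closure \<Omega>. norm (w x) \<le> Wb" unfolding bounded_iff by auto
  then have Wb: "W x \<le> max 0 Wb * indicator \<Omega> x" for x
    using closure_subset[of \<Omega>] by (fastforce simp: W_def indicator_def)
  define M where "M = density lborel (\<lambda>x. ennreal (W x))"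
  have sM [measurable_cong]: "sets M = sets borel" by (simp add: M_def)
  have emM: "emeasure lborel \<Omega> < \<infinity>" using \<Omega>(2) emeasure_bounded_finite by blast
  have fM: "finite_measure M"
  proof (rule finite_measureI)
    have "emeasure M (space M) = (\<integral>\<^sup>+x. ennreal (W x) \<partial>lborel)" unfolding M_def by (subst emeasure_density) auto
    also have "\<dots> \<le> (\<integral>\<^sup>+x. ennreal (max 0 Wb) * indicator \<Omega> x \<partial>lborel)"
    proof (rule nn_integral_mono)
      show "ennreal (W x) \<le> ennreal (max 0 Wb) * indicator \<Omega> x" for x
        using Wb[of x] by (cases "x \<in> \<Omega>") (auto simp: W_def intro: ennreal_leI)
    qed
    also have "\<dots> = ennreal (max 0 Wb) * emeasure lborel \<Omega>" by (rule nn_integral_cmult_indicator) simp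
    also have "\<dots> < \<infinity>" using emM by (simp add: ennreal_mult_less_top)
    finally show "emeasure M (space M) \<noteq> \<infinity>" by simp
  qed
  obtain \<phi> where ml: "u \<in> borel_measurable lebesgue" "g \<in> borel_measurable lebesgue"
    and tst: "\<And>n. test_fun \<Omega> (\<phi> n)"
    and lim1: "(\<lambda>n. \<integral>\<^sup>+x\<in>\<Omega>. ennreal (w x * \<bar>\<phi> n x - u x\<bar> powr p) \<partial>lebesgue) \<longlonglongrightarrow> 0"
    and lim2: "(\<lambda>n. \<integral>\<^sup>+x\<in>\<Omega>. ennreal (w x * norm (grad (\<phi> n) x - g x) powr p) \<partial>lebesgue) \<longlonglongrightarrow> 0"
    using ep unfolding eigenpair_def W0_def by blast
  obtain u1 where u1: "u1 \<in> borel_measurable borel" "AE x in lborel. u x = u1 x"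
    using completion_ex_borel_measurable_real[of u lborel] ml(1) by auto
  obtain g1 where g1: "g1 \<in> borel_measurable borel" "AE x in lborel. g x = g1 x"
    using borel_representative[OF ml(2)] by blast
  define u' where "u' x = (if x \<in> \<Omega> then max 0 (min 1 (u1 x)) else 0)" for x
  define g' where "g' x = (if x \<in> \<Omega> then g1 x else 0)" for x
  note [measurable] = u1(1) g1(1)
  have [measurable]: "u' \<in> borel_measurable borel" "g' \<in> borel_measurable borel"
    unfolding u'_def g'_def by measurable
  have [measurable]: "\<phi> n \<in> borel_measurable borel" "grad (\<phi> n) \<in> borel_measurable borel" for n
    using tst[of n] smooth_fun_measurable grad_measurable by (auto simp: test_fun_def)
  have u1': "AE x in lborel. x \<in> \<Omega> \<longrightarrow> u1 x > 0" "AE x in lborel. x \<in> \<Omega> \<longrightarrow> \<bar>u1 x\<bar> \<le> 1"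
  proof -
    have "AE x in lebesgue. u x = u1 x" using u1(2) by (rule AE_completion)
    then have "AE x in lebesgue. x \<in> \<Omega> \<longrightarrow> u1 x > 0" using u(1) by eventually_elim auto
    then show "AE x in lborel. x \<in> \<Omega> \<longrightarrow> u1 x > 0" by (rule AE_lborel) measurable
    have "AE x in lebesgue. u x = u1 x" using u1(2) by (rule AE_completion)
    then have "AE x in lebesgue. x \<in> \<Omega> \<longrightarrow> \<bar>u1 x\<bar> \<le> 1" using u(2) by eventually_elim auto
    then show "AE x in lborel. x \<in> \<Omega> \<longrightarrow> \<bar>u1 x\<bar> \<le> 1" by (rule AE_lborel) measurable
  qed
  have eqs: "AE x in lborel. x \<in> \<Omega> \<longrightarrow> u x = u' x \<and> g x = g' x"
    using u1(2) g1(2) u1' by eventually_elim (auto simp: u'_def g'_def)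
  then have eqs': "AE x in lebesgue. x \<in> \<Omega> \<longrightarrow> u x = u' x \<and> g x = g' x" by (rule AE_completion)
  have conv1: "(\<lambda>n. \<integral>\<^sup>+x. ennreal (W x * \<bar>\<phi> n x - u' x\<bar> powr p) \<partial>lborel) \<longlonglongrightarrow> 0"
  proof -
    have "(\<integral>\<^sup>+x\<in>\<Omega>. ennreal (w x * \<bar>\<phi> n x - u x\<bar> powr p) \<partial>lebesgue) = (\<integral>\<^sup>+x. ennreal (W x * \<bar>\<phi> n x - u' x\<bar> powr p) \<partial>lebesgue)" for n
      by (rule nn_integral_cong_AE) (use eqs' in \<open>eventually_elim, auto simp: W_def indicator_def\<close>)
    then show ?thesis using lim1 by (simp add: nn_integral_completion)
  qed
  have conv2: "(\<lambda>n. \<integral>\<^sup>+x. ennreal (W x * norm (grad (\<phi> n) x - g' x) powr p) \<partial>lborel) \<longlonglongrightarrow> 0"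
  proof -
    have "(\<integral>\<^sup>+x\<in>\<Omega>. ennreal (w x * norm (grad (\<phi> n) x - g x) powr p) \<partial>lebesgue) = (\<integral>\<^sup>+x. ennreal (W x * norm (grad (\<phi> n) x - g' x) powr p) \<partial>lebesgue)" for n
      by (rule nn_integral_cong_AE) (use eqs' in \<open>eventually_elim, auto simp: W_def indicator_def\<close>)
    then show ?thesis using lim2 by (simp add: nn_integral_completion)
  qed
  have nnM: "(\<integral>\<^sup>+x. ennreal (f x) \<partial>M) = (\<integral>\<^sup>+x. ennreal (W x * f x) \<partial>lborel)" if "f \<in> borel_measurable borel" for f
    unfolding M_def using that W0 by (subst nn_integral_density) (auto simp: ennreal_mult')
  have convM1: "(\<lambda>n. \<integral>\<^sup>+x. ennreal (\<bar>\<phi> n x - u' x\<bar> powr p) \<partial>M) \<longlonglongrightarrow> 0"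
    using conv1 by (simp add: nnM)
  have convM2: "(\<lambda>n. \<integral>\<^sup>+x. ennreal (norm (grad (\<phi> n) x - g' x) powr p) \<partial>M) \<longlonglongrightarrow> 0"
    using conv2 by (simp add: nnM)
  have const: "integrable M (\<lambda>x. c)" for c :: real using finite_measure.integrable_const[OF fM] .
  have gint: "integrable M (\<lambda>x. (1 + norm (g' x)) powr p)"
  proof -
    \<comment> \<open>A single test function at distance less than 1 suffices for the integrability
      of \<open>g'\<close>, as its own gradient is bounded and \<open>M\<close> is finite.\<close>
    have "\<forall>\<^sub>F n in sequentially. (\<integral>\<^sup>+x. ennreal (norm (grad (\<phi> n) x - g' x) powr p) \<partial>M) < 1"
      using convM2 by (rule order_tendstoD) simp
    then obtain n where n: "(\<integral>\<^sup>+x. ennreal (norm (grad (\<phi> n) x - g' x) powr p) \<partial>M) < 1"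
      by (auto simp: eventually_sequentially)
    have i: "integrable M (\<lambda>x. norm (grad (\<phi> n) x - g' x) powr p)"
      using n by (intro integrableI_bounded) (auto intro: less_le_trans[of _ 1])
    obtain R where R: "R \<ge> 0" "\<And>x. \<bar>\<phi> n x\<bar> \<le> R" "\<And>x. norm (grad (\<phi> n) x) \<le> R" using test_fun_bounded[OF tst[of n]] by metis
    show ?thesis
    proof (rule Bochner_Integration.integrable_bound)
      show "integrable M (\<lambda>x. 2 powr p * ((1 + R) powr p + norm (grad (\<phi> n) x - g' x) powr p))"
        using i const by auto
      have "(1 + norm (g' x)) powr p \<le> 2 powr p * ((1 + R) powr p + norm (grad (\<phi> n) x - g' x) powr p)" for x
      proof -
        have "norm (g' x) \<le> norm (grad (\<phi> n) x) + norm (grad (\<phi> n) x - g' x)"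
          using norm_triangle_ineq4[of "grad (\<phi> n) x" "grad (\<phi> n) x - g' x"] by simp
        then have "1 + norm (g' x) \<le> (1 + R) + norm (grad (\<phi> n) x - g' x)" using R(3)[of x] by linarith
        then have "(1 + norm (g' x)) powr p \<le> ((1 + R) + norm (grad (\<phi> n) x - g' x)) powr p"
          using p by (intro powr_mono2) auto
        also have "\<dots> \<le> 2 powr p * ((1 + R) powr p + norm (grad (\<phi> n) x - g' x) powr p)"
          using R(1) p by (intro powr_add_le) auto
        finally show ?thesis .
      qed
      then show "AE x in M. norm ((1 + norm (g' x)) powr p) \<le> norm (2 powr p * ((1 + R) powr p + norm (grad (\<phi> n) x - g' x) powr p))"
        by (intro AE_I2) (auto intro: order_trans[OF _ abs_ge_self])
    qed measurable
  qed
  have u'01: "0 \<le> u' x" "u' x \<le> 1" for x by (auto simp: u'_def)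
  have ulim: "(\<lambda>n. \<integral>\<^sup>+x. ennreal ((1 + norm (g' x)) powr (p - 1) * \<bar>\<phi> n x - u' x\<bar>) \<partial>M) \<longlonglongrightarrow> 0"
    by (rule tendsto_nn_integral_young[OF p gint]) (use convM1 in auto)
  have glim: "(\<lambda>n. \<integral>\<^sup>+x. ennreal ((1 + norm (g' x)) powr (p - 1) * norm (grad (\<phi> n) x - g' x)) \<partial>M) \<longlonglongrightarrow> 0"
    by (rule tendsto_nn_integral_young[OF p gint]) (use convM2 in auto)
  \<comment> \<open>Weighted \<open>Lp\<close> convergence gives \<open>L1\<close> convergence with
    respect to the finite measure \<open>M\<close>, hence a subsequence converging almost
    everywhere; the other limits persist along it.\<close>
  have "\<exists>s. strict_mono s \<and> (AE x in M. (\<lambda>n. \<phi> (s n) x - u' x) \<longlonglongrightarrow> 0)"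
  proof (rule tendsto_L1_AE_subseq)
    show "integrable M (\<lambda>x. \<phi> n x - u' x)" for n
    proof -
      obtain R where R: "R \<ge> 0" "\<And>x. \<bar>\<phi> n x\<bar> \<le> R" "\<And>x. norm (grad (\<phi> n) x) \<le> R" using test_fun_bounded[OF tst[of n]] by metis
      have "\<bar>\<phi> n x - u' x\<bar> \<le> R + 1" for x using R(2)[of x] u'01[of x] by linarith
      then show ?thesis by (intro finite_measure.integrable_const_bound[OF fM, of _ "R + 1"]) auto
    qed
    have "(\<lambda>n. \<integral>\<^sup>+x. ennreal (1 powr (p - 1) * \<bar>\<phi> n x - u' x\<bar>) \<partial>M) \<longlonglongrightarrow> 0"
      by (rule tendsto_nn_integral_young[OF p]) (use convM1 const in auto)
    then have "(\<lambda>n. enn2real (\<integral>\<^sup>+x. ennreal \<bar>\<phi> n x - u' x\<bar> \<partial>M)) \<longlonglongrightarrow> enn2real 0"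
      by (intro tendsto_enn2real) auto
    then show "(\<lambda>n. \<integral>x. norm (\<phi> n x - u' x) \<partial>M) \<longlonglongrightarrow> 0"
      by (simp add: integral_eq_nn_integral)
  qed
  then obtain s where s: "strict_mono s" "AE x in M. (\<lambda>n. \<phi> (s n) x - u' x) \<longlonglongrightarrow> 0" by blast
  have sub: "(\<lambda>n. F (s n)) \<longlonglongrightarrow> l" if "F \<longlonglongrightarrow> l" for F :: "nat \<Rightarrow> ennreal" and l
    using LIMSEQ_subseq_LIMSEQ[OF that s(1)] by (simp add: o_def)
  have weak: "(\<integral>x. norm (g' x) powr (p - 2) * (g' x \<bullet> grad \<psi> x) \<partial>M) = lam * (\<integral>x. u' x powr (p - 1) * \<psi> x \<partial>M)"
    if tp: "test_fun \<Omega> \<psi>" for \<psi>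
  proof -
    have [measurable]: "\<psi> \<in> borel_measurable borel" "grad \<psi> \<in> borel_measurable borel"
      using tp smooth_fun_measurable grad_measurable by (auto simp: test_fun_def)
    have leb: "f \<in> borel_measurable lebesgue" if "f \<in> borel_measurable borel" for f :: "'a \<Rightarrow> 'b::{second_countable_topology, real_normed_vector}"
      using that by (intro measurable_completion) simp
    have l\<psi>: "\<psi> \<in> borel_measurable lebesgue" "grad \<psi> \<in> borel_measurable lebesgue"
      by (rule leb, measurable)+
    have iM: "(\<integral>x. f x \<partial>M) = (\<integral>x. W x * f x \<partial>lborel)" if "f \<in> borel_measurable borel" for f :: "'a \<Rightarrow> real"
      unfolding M_def using that W0 by (subst integral_density) auto
    have r: "(LINT x:\<Omega>|lebesgue. w x * f x) = (\<integral>x. f' x \<partial>M)"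
      if [measurable]: "f \<in> borel_measurable lebesgue" "f' \<in> borel_measurable borel"
        and ff: "AE x in lebesgue. x \<in> \<Omega> \<longrightarrow> f x = f' x" for f f' :: "'a \<Rightarrow> real"
    proof -
      have "(LINT x:\<Omega>|lebesgue. w x * f x) = (\<integral>x. W x * f x \<partial>lebesgue)"
        unfolding set_lebesgue_integral_def by (intro Bochner_Integration.integral_cong) (auto simp: W_def indicator_def)
      also have "\<dots> = (\<integral>x. W x * f' x \<partial>lebesgue)"
      proof (rule integral_cong_AE)
        show "(\<lambda>x. W x * f x) \<in> borel_measurable lebesgue" "(\<lambda>x. W x * f' x) \<in> borel_measurable lebesgue"
          using leb[OF Wm] leb[OF that(2)] by (auto intro!: borel_measurable_times)
        show "AE x in lebesgue. W x * f x = W x * f' x" using ff by eventually_elim (auto simp: W_def)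
      qed
      also have "\<dots> = (\<integral>x. W x * f' x \<partial>lborel)" by (rule integral_completion) measurable
      also have "\<dots> = (\<integral>x. f' x \<partial>M)" by (rule iM[symmetric]) measurable
      finally show ?thesis .
    qed
    have "(LINT x:\<Omega>|lebesgue. w x * (norm (g x) powr (p - 2) * (g x \<bullet> grad \<psi> x))) = (\<integral>x. norm (g' x) powr (p - 2) * (g' x \<bullet> grad \<psi> x) \<partial>M)"
    proof (rule r)
      show "(\<lambda>x. norm (g x) powr (p - 2) * (g x \<bullet> grad \<psi> x)) \<in> borel_measurable lebesgue"
        by (intro borel_measurable_times powr_real_measurable borel_measurable_inner
            measurable_compose[OF ml(2) borel_measurable_norm] borel_measurable_const ml l\<psi>)
      show "AE x in lebesgue. x \<in> \<Omega> \<longrightarrow> norm (g x) powr (p - 2) * (g x \<bullet> grad \<psi> x) = norm (g' x) powr (p - 2) * (g' x \<bullet> grad \<psi> x)"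
        using eqs' by eventually_elim auto
    qed measurable
    moreover have "(LINT x:\<Omega>|lebesgue. w x * (\<bar>u x\<bar> powr (p - 2) * u x * \<psi> x)) = (\<integral>x. u' x powr (p - 1) * \<psi> x \<partial>M)"
    proof (rule r)
      show "(\<lambda>x. \<bar>u x\<bar> powr (p - 2) * u x * \<psi> x) \<in> borel_measurable lebesgue"
        by (intro borel_measurable_times powr_real_measurable borel_measurable_abs borel_measurable_const ml l\<psi>)
      have pw: "\<bar>y\<bar> powr (p - 2) * y = y powr (p - 1)" if "y \<ge> 0" for y :: real
      proof (cases "y = 0")
        case False
        have "y powr ((p - 2) + 1) = y powr (p - 2) * y powr 1" by (rule powr_add)
        then show ?thesis using False that by simp
      qed simp
      have pwu: "u' x powr (p - 2) * u' x = u' x powr (p - 1)" for x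
        using pw[OF u'01(1)[of x]] u'01(1)[of x] by simp
      show "AE x in lebesgue. x \<in> \<Omega> \<longrightarrow> \<bar>u x\<bar> powr (p - 2) * u x * \<psi> x = u' x powr (p - 1) * \<psi> x"
        using eqs' by eventually_elim (simp add: pwu u'01)
    qed measurable
    moreover have "(LINT x:\<Omega>|lebesgue. w x * (norm (g x) powr (p - 2) * (g x \<bullet> grad \<psi> x)))
        = lam * (LINT x:\<Omega>|lebesgue. w x * (\<bar>u x\<bar> powr (p - 2) * u x * \<psi> x))"
      using ep tp unfolding eigenpair_def by blast
    ultimately show ?thesis by simp
  qed
  have ws: "weak_solution M \<Omega> p lam u' g' (\<lambda>n. \<phi> (s n))"
  proof (rule weak_solution.intro[OF fM sM p _ _ u'01 gint tst sub[OF ulim] sub[OF glim] _ weak])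
    show "AE x in M. (\<lambda>n. \<phi> (s n) x) \<longlonglongrightarrow> u' x"
      using s(2) by eventually_elim (simp add: LIM_zero_iff)
  qed measurable
  have ae: "AE x in lborel. x \<in> \<Omega> \<longrightarrow> u x = u' x" using eqs by eventually_elim auto
  have off: "\<forall>x. x \<notin> \<Omega> \<longrightarrow> u' x = 0 \<and> g' x = 0" by (auto simp: u'_def g'_def)
  show ?thesis
    unfolding M_def[symmetric]
    by (rule exI[of _ u'], rule exI[of _ g'], rule exI[of _ "\<lambda>n. \<phi> (s n)"])
      (intro conjI ws ae off sub[OF conv1] sub[OF conv2])
qed

lemma set_integrable_lebesgue_imp_lborel:
  fixes f F :: "'a::euclidean_space \<Rightarrow> real"
  assumes "set_integrable lebesgue A f" and [measurable]: "A \<in> sets borel" "F \<in> borel_measurable borel"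
    and eq: "\<And>x. x \<in> A \<Longrightarrow> F x = f x"
  shows "integrable lborel (\<lambda>x. indicator A x * F x)"
proof -
  have "integrable lebesgue (\<lambda>x. indicator A x * F x)"
    using assms(1) unfolding set_integrable_def
    by (rule Bochner_Integration.integrable_cong[THEN iffD1, rotated -1]) (auto simp: indicator_def eq)
  then show ?thesis by (subst (asm) integrable_completion) auto
qed

lemma open_not_AE_avoided:
  fixes S :: "'a::euclidean_space set"
  assumes "open S" "S \<noteq> {}"
  shows "\<not> (AE x in lborel. x \<notin> S)"
proof
  assume ae: "AE x in lborel. x \<notin> S"
  obtain y e where e: "e > 0" "ball y e \<subseteq> S" using assms open_contains_ball by blast
  have "AE x in lborel. x \<notin> ball y e" using ae by eventually_elim (use e in auto)
  then have "ball y e \<in> null_sets lborel" by (subst AE_iff_null_sets) auto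
  then have "measure lborel (ball y e) = 0" by (simp add: measure_def null_setsD1)
  then show False using e(1) by simp
qed

theorem theorem2p2:
  fixes \<Omega> :: "'a::euclidean_space set" and p q :: real
    and w u z :: "'a \<Rightarrow> real"
  assumes "DIM('a) \<ge> 2"
    and "open \<Omega>" and "connected \<Omega>" and "\<Omega> \<noteq> {}" and "bounded \<Omega>"
    and "C2_domain \<Omega>" and "convex \<Omega>" and "symmetric_domain \<Omega>"
    and "1 < q" and "q < p" and "p < real DIM('a)"
    and "p < real DIM('a) * q / (real DIM('a) - q)"
    and "\<forall>x\<in>closure \<Omega>. 0 \<le> w x" and "C1_closure \<Omega> w" and "Ap_weight p \<Omega> w"
    and "first_eigenfunction p w \<Omega> u"
    and "first_eigenfunction q (\<lambda>_. 1) \<Omega> z"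
  shows "\<not> (AE x in lebesgue. x \<in> \<Omega> \<longrightarrow> u x = z x)"
proof
  assume uz: "AE x in lebesgue. x \<in> \<Omega> \<longrightarrow> u x = z x"
  note \<Omega> = \<open>open \<Omega>\<close> \<open>bounded \<Omega>\<close>
  have p: "p > 1" and q: "q > 1" using assms by auto
  have [measurable]: "\<Omega> \<in> sets borel" using \<Omega> by simp
  have wc: "continuous_on (closure \<Omega>) w" using assms(14) by (simp add: C1_closure_def)
  have wpos: "AE x in lebesgue. x \<in> \<Omega> \<longrightarrow> w x > 0" using assms(15) by (simp add: Ap_weight_def)
  obtain lamp gu where P: "eigenpair p w \<Omega> lamp u gu" "AE x in lebesgue. x \<in> \<Omega> \<longrightarrow> u x > 0"
      "AE x in lebesgue. x \<in> \<Omega> \<longrightarrow> \<bar>u x\<bar> \<le> 1"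
    using assms(16) unfolding first_eigenfunction_def by blast
  obtain lamq gz where Q: "eigenpair q (\<lambda>_. 1) \<Omega> lamq z gz" "AE x in lebesgue. x \<in> \<Omega> \<longrightarrow> z x > 0"
      "AE x in lebesgue. x \<in> \<Omega> \<longrightarrow> \<bar>z x\<bar> \<le> 1" "\<And>c. c < 1 \<Longrightarrow> \<not> (AE x in lebesgue. x \<in> \<Omega> \<longrightarrow> \<bar>z x\<bar> \<le> c)"
    using assms(17) unfolding first_eigenfunction_def by blast
  define W where "W x = (if x \<in> \<Omega> then w x else 0)" for x
  have "W = (\<lambda>x. indicator \<Omega> x *\<^sub>R w x)" by (auto simp: W_def indicator_def)
  then have Wm [measurable]: "W \<in> borel_measurable borel"
    using borel_measurable_continuous_on_indicator[OF _ continuous_on_subset[OF wc closure_subset]] by simp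
  have W0: "0 \<le> W x" for x using assms(13) closure_subset[of \<Omega>] by (auto simp: W_def)
  have AE_lborel: "AE x in lborel. R x" if "AE x in lebesgue. R x" "Measurable.pred lborel R" for R :: "'a \<Rightarrow> bool"
    using that AE_completion_iff by blast
  have Wpos: "AE x in lborel. x \<in> \<Omega> \<longrightarrow> W x > 0"
  proof (rule AE_lborel)
    show "AE x in lebesgue. x \<in> \<Omega> \<longrightarrow> W x > 0" using wpos by eventually_elim (simp add: W_def)
  qed measurable
  obtain u' g\<^sub>u \<phi> where uP: "weak_solution (density lborel (\<lambda>x. ennreal (W x))) \<Omega> p lamp u' g\<^sub>u \<phi>"
      "AE x in lborel. x \<in> \<Omega> \<longrightarrow> u x = u' x"
      "(\<lambda>n. \<integral>\<^sup>+x. ennreal (W x * \<bar>\<phi> n x - u' x\<bar> powr p) \<partial>lborel) \<longlonglongrightarrow> 0"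
      "(\<lambda>n. \<integral>\<^sup>+x. ennreal (W x * norm (grad (\<phi> n) x - g\<^sub>u x) powr p) \<partial>lborel) \<longlonglongrightarrow> 0"
    using eigenpair_weak_solution[OF \<Omega> p wc assms(13) wpos P] unfolding W_def by blast
  obtain z' g\<^sub>z \<psi> where zQ: "weak_solution (density lborel (\<lambda>x. ennreal (if x \<in> \<Omega> then 1 else 0))) \<Omega> q lamq z' g\<^sub>z \<psi>"
      "AE x in lborel. x \<in> \<Omega> \<longrightarrow> z x = z' x" "\<forall>x. x \<notin> \<Omega> \<longrightarrow> z' x = 0 \<and> g\<^sub>z x = 0"
    using eigenpair_weak_solution[OF \<Omega> q continuous_on_const _ _ Q(1-3)] by auto
  have ind: "(\<lambda>x. ennreal (if x \<in> \<Omega> then 1 else 0)) = indicator \<Omega>" by (auto simp: indicator_def)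
  define M where "M = density lborel (\<lambda>x. ennreal (W x))"
  interpret P: weak_solution M \<Omega> p lamp u' g\<^sub>u \<phi> unfolding M_def by (rule uP(1))
  interpret Q: unweighted_solution "density lborel (indicator \<Omega>)" \<Omega> q lamq z' g\<^sub>z \<psi>
    by (intro unweighted_solution.intro unweighted_solution_axioms.intro)
      (use zQ \<Omega> in \<open>auto simp: ind\<close>)
  have eq: "AE x in lborel. x \<in> \<Omega> \<longrightarrow> u' x = z' x"
  proof (rule AE_lborel)
    show "AE x in lebesgue. x \<in> \<Omega> \<longrightarrow> u' x = z' x"
      using AE_completion[OF uP(2)] AE_completion[OF zQ(2)] uz by eventually_elim auto
  qed measurable
  have z1: "\<not> (AE x in lborel. x \<in> \<Omega> \<longrightarrow> z' x \<le> c)" if "c < 1" for c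
  proof
    assume "AE x in lborel. x \<in> \<Omega> \<longrightarrow> z' x \<le> c"
    from AE_completion[OF this] AE_completion[OF zQ(2)] Q(2)
    have "AE x in lebesgue. x \<in> \<Omega> \<longrightarrow> \<bar>z x\<bar> \<le> c" by eventually_elim auto
    then show False using Q(4)[OF that] by simp
  qed
  obtain x0 where mx: "Q.max_point x0" using Q.max_point_exists[OF \<Omega>(2) z1] by blast
  have x0: "x0 \<in> \<Omega>" by (rule Q.max_point_interior[OF assms(7,4) mx])
  have lamq: "lamq \<ge> 0"
  proof (rule Q.lam_nonneg)
    show "\<not> (AE x in density lborel (indicator \<Omega>). z' x = 0)"
    proof
      assume "AE x in density lborel (indicator \<Omega>). z' x = 0"
      then have "AE x in lborel. x \<in> \<Omega> \<longrightarrow> z' x = 0" by (subst (asm) AE_density) auto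
      then have "AE x in lborel. x \<in> \<Omega> \<longrightarrow> z' x \<le> 0" by eventually_elim auto
      then show False using z1[of 0] by simp
    qed
  qed
  have AE_M: "(AE x in M. R x) \<longleftrightarrow> (AE x in lborel. 0 < W x \<longrightarrow> R x)" for R
    unfolding M_def by (subst AE_density) auto
  have lamp: "lamp \<ge> 0"
  proof (rule P.lam_nonneg)
    show "\<not> (AE x in M. u' x = 0)"
    proof
      assume "AE x in M. u' x = 0"
      then have "AE x in lborel. 0 < W x \<longrightarrow> u' x = 0" by (simp add: AE_M)
      then have "AE x in lborel. x \<in> \<Omega> \<longrightarrow> z' x \<le> 0" using Wpos eq by eventually_elim auto
      then show False using z1[of 0] by simp
    qed
  qed
  show False
  proof (cases "lamp = 0")
    case True
    \<comment> \<open>Zero eigenvalue: the ball around \<open>x0\<close> is made as large as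
      \<open>\<Omega>\<close> allows, so that its closure contains a point \<open>y\<close> of the
      complement. On this ball the function turns out to be 1, which makes \<open>y\<close> a
      maximum point as well.\<close>
    have "\<Omega> \<noteq> UNIV" using \<Omega>(2) not_bounded_UNIV by auto
    then have "closed (- \<Omega>)" "- \<Omega> \<noteq> {}" using \<Omega>(1) by auto
    then obtain y where y: "y \<in> - \<Omega>" "infdist x0 (- \<Omega>) = dist x0 y" using infdist_attains_inf by blast
    define R where "R = dist x0 y"
    have R: "R > 0" using y x0 by (auto simp: R_def)
    have sub: "ball x0 R \<subseteq> \<Omega>"
    proof
      fix x assume "x \<in> ball x0 R"
      then have "dist x0 x < infdist x0 (- \<Omega>)" using y by (simp add: R_def)
      then show "x \<in> \<Omega>" using infdist_le[of x "- \<Omega>" x0] by (cases "x \<in> \<Omega>") auto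
    qed
    have one: "AE x in lborel. x \<in> ball x0 R \<longrightarrow> 1 \<le> u' x"
    proof (rule eq_1_on_ball_of_zero_gradient[OF p Wm P.u_measurable W0 _ _ P.\<phi>_smooth uP(3)])
      show "AE x in lborel. x \<in> ball x0 R \<longrightarrow> 0 < W x" using Wpos by eventually_elim (use sub in auto)
      \<comment> \<open>The Muckenhoupt condition supplies the dual weight on the whole ball,
        although the ball touches the complement and is not compactly contained in
        \<open>\<Omega>\<close>.\<close>
      have "set_integrable lebesgue (ball x0 R) (\<lambda>y. w y powr (1 / (1 - p)))"
        using assms(15) R sub unfolding Ap_weight_def by blast
      then show "integrable lborel (\<lambda>x. indicator (ball x0 R) x * W x powr (1 / (1 - p)))"
      proof (rule set_integrable_lebesgue_imp_lborel)
        show "(\<lambda>x. W x powr (1 / (1 - p))) \<in> borel_measurable borel" by measurable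
      qed (use sub in \<open>auto simp: W_def\<close>)
      have g0: "AE x in lborel. 0 < W x \<longrightarrow> g\<^sub>u x = 0" using P.gradient_zero[OF True] by (simp add: AE_M)
      \<comment> \<open>The weak gradient vanishes wherever \<open>W\<close> is positive, so the
        gradients of the test functions themselves tend to 0 in the weighted norm.\<close>
      have "(\<integral>\<^sup>+x. ennreal (W x * norm (grad (\<phi> n) x - g\<^sub>u x) powr p) \<partial>lborel) = (\<integral>\<^sup>+x. ennreal (W x * norm (grad (\<phi> n) x) powr p) \<partial>lborel)" for n
      proof (rule nn_integral_cong_AE)
        show "AE x in lborel. ennreal (W x * norm (grad (\<phi> n) x - g\<^sub>u x) powr p) = ennreal (W x * norm (grad (\<phi> n) x) powr p)"
          using g0
        proof eventually_elim
          case (elim x)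
          then show ?case using W0[of x] by (cases "W x = 0") auto
        qed
      qed
      then show "(\<lambda>n. \<integral>\<^sup>+x. ennreal (W x * norm (grad (\<phi> n) x) powr p) \<partial>lborel) \<longlonglongrightarrow> 0" using uP(4) by simp
      show "\<not> (AE x in lborel. x \<in> ball x0 R \<longrightarrow> u' x \<le> s)" if "s < 1" for s
      proof
        assume "AE x in lborel. x \<in> ball x0 R \<longrightarrow> u' x \<le> s"
        then have "AE x in lborel. x \<in> ball x0 R \<longrightarrow> z' x \<le> 1 - (1 - s)" using eq by eventually_elim (use sub in auto)
        moreover have "1 - s > 0" using that by simp
        ultimately show False using mx R unfolding Q.max_point_def by blast
      qed
    qed
    have "Q.max_point y"
      unfolding Q.max_point_def
    proof (intro allI impI notI)
      fix r \<epsilon> :: real assume re: "r > 0" "\<epsilon> > 0" and ae: "AE x in lborel. x \<in> ball y r \<longrightarrow> z' x \<le> 1 - \<epsilon>"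
      have "AE x in lborel. x \<notin> ball y r \<inter> ball x0 R"
        using ae one eq
      proof eventually_elim
        case (elim x)
        then show ?case using re sub by auto
      qed
      moreover have "ball y r \<inter> ball x0 R \<noteq> {}"
      proof -
        have "y \<in> ball y r" "y \<in> closure (ball x0 R)" using re R by (simp_all add: R_def)
        then have "ball y r \<inter> closure (ball x0 R) \<noteq> {}" by blast
        then show ?thesis by (simp only: open_Int_closure_eq_empty[OF open_ball] not_False_eq_True)
      qed
      ultimately show False using open_not_AE_avoided[of "ball y r \<inter> ball x0 R"] by auto
    qed
    then have "y \<in> \<Omega>" by (rule Q.max_point_interior[OF assms(7,4)])
    then show False using y by simp
  next
    case False
    with lamp have lamp: "lamp > 0" by simp
    define q' where "q' = q / (q - 1)"
    \<comment> \<open>The second inequality is \<open>q * (p - 1) > p * (q - 1)\<close>, that is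
      \<open>p > q\<close>.\<close>
    have q': "q' > 1" "q' * (p - 1) > p" using q assms(10) by (auto simp: q'_def field_simps)
    define c0 where "c0 = (2::real) powr (- q')"
    obtain r0 where r0: "r0 > 0" "cball x0 r0 \<subseteq> \<Omega>"
      and gr: "\<And>k::nat. AE x in lborel. x \<in> ball x0 (r0 / 2 ^ k) \<longrightarrow> 1 - z' x \<le> c0 ^ k"
      using Q.max_point_growth[OF lamq x0 mx] unfolding c0_def q'_def by blast
    have c0: "0 < c0" "c0 \<le> 1 / 2"
    proof -
      have "c0 \<le> 2 powr (-1)" unfolding c0_def using q' by (intro powr_mono) auto
      then show "c0 \<le> 1 / 2" by (simp add: powr_minus_divide)
    qed (simp add: c0_def)
    obtain C where C: "C > 0" and decay: "\<And>x0 r S. 0 < r \<Longrightarrow> 0 < S \<Longrightarrow> S \<le> 1 / 2 \<Longrightarrow> cball x0 r \<subseteq> \<Omega> \<Longrightarrow>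
       (AE x in M. x \<in> ball x0 r \<longrightarrow> 1 - u' x \<le> S) \<Longrightarrow>
       measure M (ball x0 (r / 2)) \<le> C * r powr (- p) * S powr (p - 1) * measure M (ball x0 r)"
      using P.weighted_ball_decay[OF lamp] by blast
    define B where "B k = ball x0 (r0 / 2 ^ k)" for k :: nat
    have [measurable]: "B k \<in> sets borel" for k by (simp add: B_def)
    have rk: "r0 / 2 ^ k \<le> r0" "0 < r0 / 2 ^ k" for k :: nat
    proof -
      have "(2::real) ^ k \<ge> 1" by simp
      then show "r0 / 2 ^ k \<le> r0" using r0(1) mult_left_mono[of 1 "2 ^ k" r0] by (simp add: divide_le_eq)
    qed (use r0 in simp)
    have Bsub: "B k \<subseteq> cball x0 r0" "B k \<subseteq> \<Omega>" "cball x0 (r0 / 2 ^ k) \<subseteq> \<Omega>" for k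
    proof -
      have "cball x0 (r0 / 2 ^ k) \<subseteq> cball x0 r0" using rk(1)[of k] by (rule subset_cball)
      then show "cball x0 (r0 / 2 ^ k) \<subseteq> \<Omega>" "B k \<subseteq> cball x0 r0" "B k \<subseteq> \<Omega>" using r0(2) ball_subset_cball unfolding B_def by blast+
    qed
    define m where "m k = measure M (B k)" for k
    have mI: "m k = (\<integral>x. indicator (B k) x * W x \<partial>lborel)" for k
    proof -
      have "m k = (\<integral>x. indicator (B k) x \<partial>M)" by (simp add: m_def P.M_space)
      also have "\<dots> = (\<integral>x. indicator (B k) x * W x \<partial>lborel)"
        unfolding M_def using W0 by (subst integral_density) (auto simp: mult.commute)
      finally show ?thesis .
    qed
    have Kint: "set_integrable lebesgue (cball x0 r0) w" "set_integrable lebesgue (cball x0 r0) (\<lambda>x. inverse (w x))"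
      using assms(15) r0(2) unfolding Ap_weight_def by auto
    have intW: "integrable lborel (\<lambda>x. indicator (cball x0 r0) x * W x)"
      by (rule set_integrable_lebesgue_imp_lborel[OF Kint(1) _ Wm]) (use r0(2) in \<open>auto simp: W_def\<close>)
    have intV: "integrable lborel (\<lambda>x. indicator (cball x0 r0) x * inverse (W x))"
    proof (rule set_integrable_lebesgue_imp_lborel[OF Kint(2)])
      show "(\<lambda>x. inverse (W x)) \<in> borel_measurable borel" by measurable
    qed (use r0(2) in \<open>auto simp: W_def\<close>)
    have restr: "integrable lborel (\<lambda>x. indicator (B k) x * f x)"
      if "integrable lborel (\<lambda>x. indicator (cball x0 r0) x * f x)" and [measurable]: "f \<in> borel_measurable borel" for f :: "'a \<Rightarrow> real" and k
    proof (rule Bochner_Integration.integrable_bound[OF that(1)])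
      have "norm (indicator (B k) x * f x) \<le> norm (indicator (cball x0 r0) x * f x)" for x
        using Bsub(1)[of k] by (cases "x \<in> B k") auto
      then show "AE x in lborel. norm (indicator (B k) x * f x) \<le> norm (indicator (cball x0 r0) x * f x)" by simp
    qed measurable
    define J where "J = (\<integral>x. indicator (cball x0 r0) x * inverse (W x) \<partial>lborel)"
    have J0: "J \<ge> 0" unfolding J_def using W0 by (intro Bochner_Integration.integral_nonneg) auto
    define N where "N = DIM('a)"
    define b where "b = unit_ball_vol (real DIM('a)) * r0 ^ N"
    have b: "b > 0" using r0 by (simp add: b_def)
    \<comment> \<open>The squared volume of the ball of radius \<open>r0 / 2 ^ k\<close> shrinks by
      \<open>1 / 4 ^ N\<close> per step, and the integral of \<open>1 / W\<close> over any of these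
      balls is at most \<open>J\<close>.\<close>
    have low: "b\<^sup>2 / (J + 1) * (1 / 4 ^ N) ^ k \<le> m k" for k
    proof -
      have mB: "measure lborel (B k) = b * (1 / 2 ^ N) ^ k"
        using content_ball[OF less_imp_le[OF rk(2)[of k]], of x0]
        by (simp add: B_def b_def N_def power_divide power_mult[symmetric] mult.commute)
      have "(b * (1 / 2 ^ N) ^ k)\<^sup>2 \<le> (J + 1) * (\<integral>x. indicator (B k) x * W x \<partial>lborel)"
      proof (rule ball_volume_square_le[where B = "B k"])
        show "integrable lborel (indicator (B k) :: 'a \<Rightarrow> real)"
          by (rule integrable_real_indicator) (use emeasure_lborel_ball_finite[of x0 "r0 / 2 ^ k"] in \<open>auto simp: B_def\<close>)
        show "AE x in lborel. x \<in> B k \<longrightarrow> 0 < W x" using Wpos by eventually_elim (use Bsub in auto)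
        show "integrable lborel (\<lambda>x. indicator (B k) x * W x)" by (rule restr[OF intW]) measurable
        show iVk: "integrable lborel (\<lambda>x. indicator (B k) x * inverse (W x))" by (rule restr[OF intV]) measurable
        show "(\<integral>x. indicator (B k) x * inverse (W x) \<partial>lborel) \<le> J"
          unfolding J_def by (rule integral_mono[OF iVk intV]) (use Bsub(1)[of k] W0 in \<open>auto simp: indicator_def\<close>)
      qed (use b mB J0 in auto)
      also have "(b * (1 / 2 ^ N) ^ k)\<^sup>2 = b\<^sup>2 * (1 / 4 ^ N) ^ k"
      proof -
        have "((1 / 2 ^ N :: real) ^ k)\<^sup>2 = ((1 / 2 ^ N)\<^sup>2) ^ k" for k :: nat
          using power_mult[of "1 / 2 ^ N :: real" k 2] power_mult[of "1 / 2 ^ N :: real" 2 k] by (simp only: mult.commute)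
        moreover have "((1::real) / 2 ^ N)\<^sup>2 = 1 / 4 ^ N"
          using power_mult[of "2::real" N 2] power_mult[of "2::real" 2 N] by (simp add: power_divide mult.commute)
        ultimately show ?thesis by (simp add: power_mult_distrib)
      qed
      finally have "b\<^sup>2 * (1 / 4 ^ N) ^ k \<le> m k * (J + 1)" unfolding mI by (simp only: mult.commute)
      then have "b\<^sup>2 * (1 / 4 ^ N) ^ k / (J + 1) \<le> m k" using J0 by (simp only: pos_divide_le_eq)
      then show ?thesis by simp
    qed
    \<comment> \<open>Per halving of the radius, \<open>r powr (- p)\<close> grows by
      \<open>2 powr p\<close> and \<open>S powr (p - 1)\<close> shrinks by
      \<open>c0 powr (p - 1)\<close>; the product is below 1 because
      \<open>q' * (p - 1) > p\<close>.\<close>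
    define \<theta> where "\<theta> = 2 powr p * c0 powr (p - 1)"
    have \<theta>: "0 < \<theta>" "\<theta> < 1"
    proof -
      have "\<theta> = 2 powr (p + - q' * (p - 1))" unfolding \<theta>_def c0_def powr_powr by (simp only: powr_add)
      also have "\<dots> < 2 powr 0" using q' by (intro powr_less_mono) auto
      finally show "\<theta> < 1" by simp
    qed (simp add: \<theta>_def c0_def)
    have dec: "m (Suc k) \<le> (C * r0 powr (- p)) * \<theta> ^ k * m k" if "k \<ge> 1" for k
    proof -
      \<comment> \<open>The step \<open>k = 0\<close> is left out because
        \<open>weighted_ball_decay\<close> requires \<open>S \<le> 1 / 2\<close>, whereas
        \<open>c0 ^ 0 = 1\<close>.\<close>
      have "c0 ^ k \<le> c0 ^ 1" using c0 that by (intro power_decreasing) auto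
      then have S: "0 < c0 ^ k" "c0 ^ k \<le> 1 / 2" using c0 by auto
      have "AE x in lborel. x \<in> ball x0 (r0 / 2 ^ k) \<longrightarrow> 1 - u' x \<le> c0 ^ k"
        using gr[of k] eq by eventually_elim (use Bsub(2)[of k] in \<open>auto simp: B_def\<close>)
      then have "AE x in M. x \<in> ball x0 (r0 / 2 ^ k) \<longrightarrow> 1 - u' x \<le> c0 ^ k" unfolding AE_M by eventually_elim auto
      then have "measure M (ball x0 (r0 / 2 ^ k / 2)) \<le> C * (r0 / 2 ^ k) powr (- p) * (c0 ^ k) powr (p - 1) * measure M (ball x0 (r0 / 2 ^ k))"
        by (rule decay[OF rk(2) S Bsub(3)])
      moreover have "(r0 / 2 ^ k) powr (- p) = r0 powr (- p) * (2 powr p) ^ k"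
        using r0 by (simp add: powr_divide powr_minus_divide powr_powr mult.commute flip: powr_realpow)
      moreover have "(c0 ^ k) powr (p - 1) = (c0 powr (p - 1)) ^ k"
        using c0 by (simp add: powr_powr mult.commute flip: powr_realpow)
      ultimately show ?thesis by (simp add: m_def B_def \<theta>_def power_mult_distrib mult_ac)
    qed
    show False
      by (rule superpolynomial_decay_impossible[OF low _ _ dec \<theta>]) (use b J0 in \<open>auto simp: m_def\<close>)
  qed
qed

end
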